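(* Let $M$ be a smooth, closed, oriented, finite-dimensional manifold. Let $\{g^0_k\}$ and $\{g^1_k\}$ be two $\omega$-convergent sequences in $\mathcal{M}$ with $\omega$-limits $[g_0]$ and $[g_1]$, respectively. If $\{g^0_k\}$ and $\{g^1_k\}$ are equivalent, i.e. if $$\lim_{k\to\infty}d(g^0_k,g^1_k)=0,$$ then $[g_0]=[g_1]$.
   Context: $\mathcal{S}$: smooth symmetric $(0,2)$-tensor fields on $M$; $\mathcal{M}\subset\mathcal{S}$: smooth Riemannian metrics, with the $L^2$ Riemannian metric $(h,k)_{\tilde g}=\int_M\operatorname{tr}(\tilde g^{-1}h\tilde g^{-1}k)\,\mu_{\tilde g}$ and its distance function $d$ on $\mathcal{M}$ (infimum of lengths $\int_0^1\sqrt{(g_t',g_t')_{g_t}}dt$ of piecewise $C^1$ paths in $\mathcal{M}$). Fix a reference metric $g\in\mathcal{M}$; "nullset", "a.e." refer to $\mu_g$; for a symmetric $(0,2)$-tensor $\tilde g$ put $\tilde G=g^{-1}\tilde g$. A semimetric is a section of $S^2T^*M$ that is positive semidefinite at each point; $\mathcal{M}_m$ is the set of semimetrics with measurable coefficients. $X_{\tilde g}=\{x\in M\mid\tilde g(x)\text{ not positive definite}\}$; for a sequence in $\mathcal{M}$, $X_{\{g_k\}}=\{x\in M\mid\forall\delta>0\ \exists k:\det G_k(x)<\delta\}$. On $\mathcal{M}_m$: $g_0\sim g_1$ iff $X_{g_0},X_{g_1}$ differ at most by a nullset and $g_0=g_1$ a.e. on $M\setminus(X_{g_0}\cup X_{g_1})$;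 $\widehat{\mathcal{M}_m}=\mathcal{M}_m/{\sim}$. A sequence $\{g_k\}\subset\mathcal{M}$ $\omega$-converges to $[g_\infty]\in\widehat{\mathcal{M}_m}$ (its $\omega$-limit) if for every representative $g_\infty$: (1) $\{g_k\}$ is $d$-Cauchy; (2) $X_{g_\infty}$ and $X_{\{g_k\}}$ differ at most by a nullset; (3) $g_k(x)\to g_\infty(x)$ for a.e. $x\in M\setminus X_{\{g_k\}}$; (4) $\sum_k d(g_k,g_{k+1})<\infty$. *)

theory Defs
  imports "HOL-Analysis.Analysis"
begin

text \<open>
  The manifold is the type \<open>'a\<close>; its smooth structure is an atlas of charts \<open>(U, \<phi>)\<close> with values
  in \<open>real^'n\<close>. The values of \<open>\<phi>\<close> outside \<open>U\<close> are irrelevant.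
\<close>

type_synonym ('a, 'n) chart = "'a set \<times> ('a \<Rightarrow> real^'n)"

abbreviation chart_dom :: "('a, 'n::finite) chart \<Rightarrow> 'a set"
  where "chart_dom c \<equiv> fst c"

abbreviation coord :: "('a, 'n::finite) chart \<Rightarrow> 'a \<Rightarrow> real^'n"
  where "coord c \<equiv> snd c"

abbreviation chart_img :: "('a, 'n::finite) chart \<Rightarrow> (real^'n) set"
  where "chart_img c \<equiv> coord c ` chart_dom c"

definition param :: "('a, 'n::finite) chart \<Rightarrow> real^'n \<Rightarrow> 'a"
  where "param c = inv_into (chart_dom c) (coord c)"


section \<open>Smooth functions on open subsets of Euclidean space\<close>

text \<open>\<open>partials [i, j, \<dots>] f\<close> is \<open>\<partial>\<^sub>i (\<partial>\<^sub>j \<dots> f)\<close>.\<close>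

primrec partials :: "'n list \<Rightarrow> (real^'n \<Rightarrow> 'b) \<Rightarrow> real^'n::finite \<Rightarrow> 'b::real_normed_vector"
  where
    "partials [] f = f"
  | "partials (i # is) f = (\<lambda>y. frechet_derivative (partials is f) (at y) (axis i 1))"

text \<open>Meant for open \<open>S\<close>. Differentiability of all iterated partial derivatives also yields their
  continuity, so this is \<open>C\<^sup>\<infinity>\<close>.\<close>

definition smooth_on :: "(real^'n::finite) set \<Rightarrow> (real^'n \<Rightarrow> 'b::real_normed_vector) \<Rightarrow> bool"
  where "smooth_on S f \<longleftrightarrow> (\<forall>is. \<forall>y\<in>S. partials is f differentiable (at y))"


section \<open>Smooth and oriented atlases\<close>

definition transition :: "('a, 'n::finite) chart \<Rightarrow> ('a, 'n) chart \<Rightarrow> real^'n \<Rightarrow> real^'n"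
  where "transition c d = coord d \<circ> param c"

definition jacobian :: "('a, 'n::finite) chart \<Rightarrow> ('a, 'n) chart \<Rightarrow> 'a \<Rightarrow> real^'n^'n"
  where "jacobian c d x = matrix (frechet_derivative (transition c d) (at (coord c x)))"

text \<open>Charts are onto open subsets of \<open>real^'n\<close>, so there is no boundary.\<close>

definition smooth_atlas :: "('a::topological_space, 'n::finite) chart set \<Rightarrow> bool"
  where "smooth_atlas A \<longleftrightarrow>
    (\<forall>c\<in>A. open (chart_dom c) \<and> open (chart_img c) \<and>
            homeomorphism (chart_dom c) (chart_img c) (coord c) (param c)) \<and>
    (\<Union>c\<in>A. chart_dom c) = UNIV \<and>
    (\<forall>c\<in>A. \<forall>d\<in>A. smooth_on (coord c ` (chart_dom c \<inter> chart_dom d)) (transition c d))"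

text \<open>An orientation is given by an atlas of positively oriented charts.\<close>

definition oriented_atlas :: "('a, 'n::finite) chart set \<Rightarrow> bool"
  where "oriented_atlas A \<longleftrightarrow> (\<forall>c\<in>A. \<forall>d\<in>A. \<forall>x \<in> chart_dom c \<inter> chart_dom d. det (jacobian c d x) > 0)"

definition chart_at :: "('a, 'n::finite) chart set \<Rightarrow> 'a \<Rightarrow> ('a, 'n) chart"
  where "chart_at A x = (SOME c. c \<in> A \<and> x \<in> chart_dom c)"


section \<open>Symmetric (0,2)-tensor fields\<close>

text \<open>
  A (0,2)-tensor field \<open>h\<close> is the family of its component matrices: \<open>h c x\<close> is the matrix of the
  bilinear form at \<open>x\<close> in the coordinates of the chart \<open>c\<close>. The value \<open>0\<close> for charts which do not
  belong to the atlas or do not contain \<open>x\<close> makes the representation unique.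
\<close>

type_synonym ('a, 'n) tensor_field = "('a, 'n) chart \<Rightarrow> 'a \<Rightarrow> real^'n^'n"

definition sym_tensor_field :: "('a, 'n::finite) chart set \<Rightarrow> ('a, 'n) tensor_field \<Rightarrow> bool"
  where "sym_tensor_field A h \<longleftrightarrow>
    (\<forall>c\<in>A. \<forall>x\<in>chart_dom c. transpose (h c x) = h c x) \<and>
    (\<forall>c\<in>A. \<forall>d\<in>A. \<forall>x \<in> chart_dom c \<inter> chart_dom d.
       h c x = transpose (jacobian c d x) ** h d x ** jacobian c d x) \<and>
    (\<forall>c x. \<not> (c \<in> A \<and> x \<in> chart_dom c) \<longrightarrow> h c x = 0)"

definition coord_rep ::
    "('a, 'n::finite) chart \<Rightarrow> ('a, 'n) tensor_field \<Rightarrow> real^'n \<Rightarrow> real^'n^'n"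
  where "coord_rep c h y = h c (param c y)"

definition pos_def_at ::
    "('a, 'n::finite) chart set \<Rightarrow> ('a, 'n) tensor_field \<Rightarrow> 'a \<Rightarrow> bool"
  where "pos_def_at A h x \<longleftrightarrow> (\<forall>c\<in>A. x \<in> chart_dom c \<longrightarrow> (\<forall>v. v \<noteq> 0 \<longrightarrow> v \<bullet> (h c x *v v) > 0))"

definition pos_semidef_at ::
    "('a, 'n::finite) chart set \<Rightarrow> ('a, 'n) tensor_field \<Rightarrow> 'a \<Rightarrow> bool"
  where "pos_semidef_at A h x \<longleftrightarrow> (\<forall>c\<in>A. x \<in> chart_dom c \<longrightarrow> (\<forall>v. v \<bullet> (h c x *v v) \<ge> 0))"

definition smooth_sym_tensors :: "('a, 'n::finite) chart set \<Rightarrow> ('a, 'n) tensor_field set"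
  where "smooth_sym_tensors A =
    {h. sym_tensor_field A h \<and> (\<forall>c\<in>A. smooth_on (chart_img c) (coord_rep c h))}"

definition metrics :: "('a, 'n::finite) chart set \<Rightarrow> ('a, 'n) tensor_field set"
  where "metrics A = {h \<in> smooth_sym_tensors A. \<forall>x. pos_def_at A h x}"

definition measurable_semimetrics :: "('a, 'n::finite) chart set \<Rightarrow> ('a, 'n) tensor_field set"
  where "measurable_semimetrics A =
    {h. sym_tensor_field A h \<and> (\<forall>x. pos_semidef_at A h x) \<and>
        (\<forall>c\<in>A. coord_rep c h \<in> borel_measurable (lebesgue_on (chart_img c)))}"


section \<open>The volume measure and the \<open>L\<^sup>2\<close> metric\<close>

text \<open>
  The Riemannian measure \<open>\<mu>\<^sub>g\<close> is the unique Borel measure which in each chart has the density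
  \<open>sqrt (det g)\<close> with respect to Lebesgue measure. It is not completed; ``a.e.'' is expressed by
  \<open>AE\<close>, which only asks the exceptional set to be contained in a Borel nullset.
\<close>

definition is_volume_measure ::
    "('a::topological_space, 'n::finite) chart set \<Rightarrow> ('a, 'n) tensor_field \<Rightarrow> 'a measure \<Rightarrow> bool"
  where "is_volume_measure A g \<mu> \<longleftrightarrow> sets \<mu> = sets borel \<and>
    (\<forall>c\<in>A. \<forall>E\<in>sets borel. E \<subseteq> chart_dom c \<longrightarrow>
       emeasure \<mu> E = (\<integral>\<^sup>+ y \<in> coord c ` E. ennreal (sqrt (det (coord_rep c g y))) \<partial>lborel))"

definition volume_measure ::
    "('a::topological_space, 'n::finite) chart set \<Rightarrow> ('a, 'n) tensor_field \<Rightarrow> 'a measure"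
  where "volume_measure A g = (THE \<mu>. is_volume_measure A g \<mu>)"

text \<open>\<open>tr (g\<^sup>-\<^sup>1 h g\<^sup>-\<^sup>1 k)\<close> and \<open>det (g\<^sup>-\<^sup>1 h)\<close> do not depend on the chart used to compute them.\<close>

definition pointwise_inner :: "('a, 'n::finite) chart set \<Rightarrow> ('a, 'n) tensor_field \<Rightarrow>
    ('a, 'n) tensor_field \<Rightarrow> ('a, 'n) tensor_field \<Rightarrow> 'a \<Rightarrow> real"
  where "pointwise_inner A g h k x = (let c = chart_at A x in
    trace (matrix_inv (g c x) ** h c x ** matrix_inv (g c x) ** k c x))"

definition L2_inner :: "('a::topological_space, 'n::finite) chart set \<Rightarrow> ('a, 'n) tensor_field \<Rightarrow>
    ('a, 'n) tensor_field \<Rightarrow> ('a, 'n) tensor_field \<Rightarrow> real"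
  where "L2_inner A g h k = (\<integral>x. pointwise_inner A g h k x \<partial>volume_measure A g)"

definition rel_det :: "('a, 'n::finite) chart set \<Rightarrow> ('a, 'n) tensor_field \<Rightarrow>
    ('a, 'n) tensor_field \<Rightarrow> 'a \<Rightarrow> real"
  where "rel_det A g h x = (let c = chart_at A x in det (matrix_inv (g c x) ** h c x))"


section \<open>Piecewise \<open>C\<^sup>1\<close> paths and the distance function\<close>

text \<open>Convergence in the \<open>C\<^sup>\<infinity>\<close> topology: in each chart all partial derivatives of the components
  converge uniformly on compact sets.\<close>

definition Cinf_tendsto :: "('a, 'n::finite) chart set \<Rightarrow> ('i \<Rightarrow> ('a, 'n) tensor_field) \<Rightarrow>
    ('a, 'n) tensor_field \<Rightarrow> 'i filter \<Rightarrow> bool"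
  where "Cinf_tendsto A h l F \<longleftrightarrow>
    (\<forall>c\<in>A. \<forall>K. compact K \<and> K \<subseteq> chart_img c \<longrightarrow>
       (\<forall>is. uniform_limit K (\<lambda>s. partials is (coord_rep c (h s))) (partials is (coord_rep c l)) F))"

text \<open>\<open>\<eta>\<close> is the derivative of \<open>\<gamma>\<close> as a map from \<open>{a..b}\<close> into the Frechet space of smooth
  symmetric tensor fields, one-sided at \<open>a\<close> and \<open>b\<close>.\<close>

definition C1_path_on :: "('a, 'n::finite) chart set \<Rightarrow> real \<Rightarrow> real \<Rightarrow>
    (real \<Rightarrow> ('a, 'n) tensor_field) \<Rightarrow> bool"
  where "C1_path_on A a b \<gamma> \<longleftrightarrow>
    (\<exists>\<eta>. \<forall>t\<in>{a..b}. \<eta> t \<in> smooth_sym_tensors A \<and>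
       Cinf_tendsto A (\<lambda>s c x. (\<gamma> s c x - \<gamma> t c x) /\<^sub>R (s - t)) (\<eta> t) (at t within {a..b}) \<and>
       Cinf_tendsto A \<eta> (\<eta> t) (at t within {a..b}))"

text \<open>\<open>S\<close> is the set of break points. Since \<open>\<gamma>\<close> is \<open>C\<^sup>1\<close> on the closed intervals
  between them, it is continuous on \<open>{0..1}\<close>.\<close>

definition piecewise_C1_path :: "('a, 'n::finite) chart set \<Rightarrow>
    (real \<Rightarrow> ('a, 'n) tensor_field) \<Rightarrow> bool"
  where "piecewise_C1_path A \<gamma> \<longleftrightarrow>
    (\<exists>S. finite S \<and> (\<forall>a b. 0 \<le> a \<and> a < b \<and> b \<le> 1 \<and> {a<..<b} \<inter> S = {} \<longrightarrow> C1_path_on A a b \<gamma>))"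

definition velocity :: "(real \<Rightarrow> ('a, 'n::finite) tensor_field) \<Rightarrow> real \<Rightarrow> ('a, 'n) tensor_field"
  where "velocity \<gamma> t = (\<lambda>c x. vector_derivative (\<lambda>s. \<gamma> s c x) (at t))"

text \<open>The velocity may be meaningless at the finitely many break points and at \<open>0\<close> and \<open>1\<close>, which
  does not affect the integral.\<close>

definition L2_length :: "('a::topological_space, 'n::finite) chart set \<Rightarrow>
    (real \<Rightarrow> ('a, 'n) tensor_field) \<Rightarrow> real"
  where "L2_length A \<gamma> =
    integral {0..1} (\<lambda>t. sqrt (L2_inner A (\<gamma> t) (velocity \<gamma> t) (velocity \<gamma> t)))"

definition L2_dist :: "('a::topological_space, 'n::finite) chart set \<Rightarrow> ('a, 'n) tensor_field \<Rightarrow>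
    ('a, 'n) tensor_field \<Rightarrow> real"
  where "L2_dist A g\<^sub>0 g\<^sub>1 =
    Inf {L2_length A \<gamma> |\<gamma>. (\<forall>t\<in>{0..1}. \<gamma> t \<in> metrics A) \<and> piecewise_C1_path A \<gamma> \<and>
                            \<gamma> 0 = g\<^sub>0 \<and> \<gamma> 1 = g\<^sub>1}"


section \<open>\<open>\<omega>\<close>-convergence\<close>

definition degenerate_set :: "('a, 'n::finite) chart set \<Rightarrow> ('a, 'n) tensor_field \<Rightarrow> 'a set"
  where "degenerate_set A h = {x. \<not> pos_def_at A h x}"

definition deflated_set :: "('a, 'n::finite) chart set \<Rightarrow> ('a, 'n) tensor_field \<Rightarrow>
    (nat \<Rightarrow> ('a, 'n) tensor_field) \<Rightarrow> 'a set"
  where "deflated_set A g gs = {x. \<forall>\<delta>>0. \<exists>k. rel_det A g (gs k) x < \<delta>}"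

definition semimetric_rel :: "('a::topological_space, 'n::finite) chart set \<Rightarrow>
    ('a, 'n) tensor_field \<Rightarrow> (('a, 'n) tensor_field \<times> ('a, 'n) tensor_field) set"
  where "semimetric_rel A g =
    {(g\<^sub>0, g\<^sub>1). g\<^sub>0 \<in> measurable_semimetrics A \<and> g\<^sub>1 \<in> measurable_semimetrics A \<and>
       (AE x in volume_measure A g. x \<in> degenerate_set A g\<^sub>0 \<longleftrightarrow> x \<in> degenerate_set A g\<^sub>1) \<and>
       (AE x in volume_measure A g. x \<notin> degenerate_set A g\<^sub>0 \<union> degenerate_set A g\<^sub>1 \<longrightarrow>
          (\<forall>c\<in>A. x \<in> chart_dom c \<longrightarrow> g\<^sub>0 c x = g\<^sub>1 c x))}"

definition semimetric_classes :: "('a::topological_space, 'n::finite) chart set \<Rightarrow>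
    ('a, 'n) tensor_field \<Rightarrow> ('a, 'n) tensor_field set set"
  where "semimetric_classes A g = measurable_semimetrics A // semimetric_rel A g"

definition L2_Cauchy :: "('a::topological_space, 'n::finite) chart set \<Rightarrow>
    (nat \<Rightarrow> ('a, 'n) tensor_field) \<Rightarrow> bool"
  where "L2_Cauchy A gs \<longleftrightarrow> (\<forall>\<epsilon>>0. \<exists>N. \<forall>i\<ge>N. \<forall>j\<ge>N. L2_dist A (gs i) (gs j) < \<epsilon>)"

text \<open>\<open>G\<close> is an equivalence class of semimetrics; \<open>g\<close> is the fixed reference metric.\<close>

definition omega_converges :: "('a::topological_space, 'n::finite) chart set \<Rightarrow>
    ('a, 'n) tensor_field \<Rightarrow> (nat \<Rightarrow> ('a, 'n) tensor_field) \<Rightarrow> ('a, 'n) tensor_field set \<Rightarrow> bool"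
  where "omega_converges A g gs G \<longleftrightarrow>
    (\<forall>k. gs k \<in> metrics A) \<and> G \<in> semimetric_classes A g \<and>
    (\<forall>h\<in>G.
       L2_Cauchy A gs \<and>
       (AE x in volume_measure A g. x \<in> degenerate_set A h \<longleftrightarrow> x \<in> deflated_set A g gs) \<and>
       (AE x in volume_measure A g. x \<notin> deflated_set A g gs \<longrightarrow>
          (\<forall>c\<in>A. x \<in> chart_dom c \<longrightarrow> (\<lambda>k. gs k c x) \<longlonglongrightarrow> h c x)) \<and>
       summable (\<lambda>k. L2_dist A (gs k) (gs (Suc k))))"

end

theory Submission
  imports Defs
begin

text \<open>
  For a chart \<open>c\<close> and a vector \<open>v\<close> consider
  \<open>F(h) = det(g\<^sup>-\<^sup>1 h)\<^bsup>1/4\<^esup> / (1 + h\<^sub>c(v, v))\<close>. By Jacobi's formula and the Cauchy-Schwarz inequality its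
  derivative along a path \<open>h\<^sub>t\<close> is bounded pointwise by a constant times
  \<open>(tr(h\<^sup>-\<^sup>1 h' h\<^sup>-\<^sup>1 h') sqrt(det(g\<^sup>-\<^sup>1 h)))\<^bsup>1/2\<^esup>\<close>, whose square integrates over the manifold to the
  squared speed of the path. Hence the \<open>L\<^sup>1\<close> distance of \<open>F(h\<^sub>0)\<close> and \<open>F(h\<^sub>1)\<close> is at most a constant times
  \<open>d(h\<^sub>0, h\<^sub>1)\<close>. For two equivalent sequences the functions \<open>F\<close> therefore have the same limit almost
  everywhere. The choice \<open>v = 0\<close> identifies the deflated sets, and away from them the values
  \<open>h\<^sub>c(v, v)\<close> of the limits, hence the limits themselves, can be read off.
\<close>

section \<open>Positive definite matrices\<close>

text \<open>The exponents come from scaling. The volume density of h relative to g is det^(1/2) with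
  det = det(g^-1 h), so over the fixed measure of g the squared speed has the integrand N^2
  det^(1/2), where N is the norm of h' measured by h. Its root N det^(1/4) bounds the derivative of
  det^(1/4) up to a constant. The derivative of h(v, v) is bounded only by N h(v, v): the numerator
  supplies the determinant that is missing, and the denominator removes the unbounded factor h(v,
  v). The obstacle is that d gives no control of the components where det tends to 0. There F tends
  to 0 as well, so F sees of a limit just what its class remembers. Convergence in L^1 gives
  convergence almost everywhere only along a subsequence. This suffices because each sequence of
  weights also converges by itself: for v = 0 almost everywhere, by summability of the consecutive
  distances; for the other v almost everywhere off the deflated set, by convergence of the metrics.
  Every test vector and every chart costs a nullset, hence the restriction to the vectors e_i + e_j
  and to countably many charts.\<close>

lemma matrix_inv_unique:
  fixes A B :: "real^'n^'n"
  assumes "A ** B = mat 1"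
  shows "matrix_inv A = B"
proof -
  have BA: "B ** A = mat 1" using assms matrix_left_right_inverse by blast
  have "A ** matrix_inv A = mat 1 \<and> matrix_inv A ** A = mat 1"
    \<comment> \<open>\<open>matrix_inv\<close> is a Hilbert choice among two-sided inverses;
      \<open>B\<close> witnesses that there is one.\<close>
    unfolding matrix_inv_def by (rule someI[of _ B]) (use assms BA in auto)
  then show ?thesis
    by (metis BA matrix_mul_assoc matrix_mul_lid matrix_mul_rid)
qed

lemma
  fixes A :: "real^'n^'n"
  assumes "invertible A"
  shows matrix_inv_right: "A ** matrix_inv A = mat 1"
    and matrix_inv_left: "matrix_inv A ** A = mat 1"
  using assms unfolding invertible_def by (metis matrix_inv_unique)+

lemma continuous_on_det [continuous_intros]:
  fixes f :: "'a::topological_space \<Rightarrow> real^'n^'n"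
  assumes "continuous_on S f"
  shows "continuous_on S (\<lambda>x. det (f x))"
  unfolding det_def using assms by (intro continuous_intros)

lemma continuous_on_trace [continuous_intros]:
  fixes f :: "'a::topological_space \<Rightarrow> real^'n^'n"
  assumes "continuous_on S f"
  shows "continuous_on S (\<lambda>x. trace (f x))"
  unfolding trace_def using assms by (intro continuous_intros)

lemma continuous_on_matrix_mult [continuous_intros]:
  fixes f :: "'a::topological_space \<Rightarrow> real^'n^'m" and g :: "'a \<Rightarrow> real^'p^'n"
  assumes "continuous_on S f" "continuous_on S g"
  shows "continuous_on S (\<lambda>x. f x ** g x)"
  unfolding matrix_matrix_mult_def using assms by (intro continuous_intros)

text \<open>Column \<open>l\<close> of the inverse solves the system with right-hand side the
  \<open>l\<close>-th unit vector. The entries become quotients of determinants, which yields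
  continuity of the inverse.\<close>

lemma matrix_inv_cramer:
  fixes A :: "real^'n^'n"
  assumes "invertible A"
  shows "matrix_inv A = (\<chi> k l. det (\<chi> i j. if j = k then axis l 1 $ i else A$i$j) / det A)"
proof -
  have d: "det A \<noteq> 0" using assms invertible_det_nz by blast
  have "A *v (matrix_inv A *v axis l 1) = axis l 1" for l
    by (simp add: matrix_vector_mul_assoc matrix_inv_right[OF assms])
  then have "matrix_inv A *v axis l 1 = (\<chi> k. det (\<chi> i j. if j = k then axis l 1 $ i else A$i$j) / det A)" for l
    using cramer[OF d] by blast
  moreover have "(matrix_inv A *v axis l 1) $ k = matrix_inv A $ k $ l" for k l
    by (simp add: matrix_vector_mult_basis column_def)
  ultimately show ?thesis
    by (metis (no_types, lifting) vec_eq_iff vec_lambda_beta)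
qed

lemma continuous_on_matrix_inv [continuous_intros]:
  fixes f :: "'a::topological_space \<Rightarrow> real^'n^'n"
  assumes "continuous_on S f" "\<And>x. x \<in> S \<Longrightarrow> invertible (f x)"
  shows "continuous_on S (\<lambda>x. matrix_inv (f x))"
proof -
  have *: "continuous_on S (\<lambda>x. if j = k then axis l 1 $ i else f x $ i $ j)" for i j k l
    by (cases "j = k") (auto intro!: continuous_intros assms(1))
  have "continuous_on S (\<lambda>x. \<chi> k l. det (\<chi> i j. if j = k then axis l 1 $ i else f x$i$j) / det (f x))"
    by (intro continuous_intros assms(1) *) (use assms(2) invertible_det_nz in auto)
  then show ?thesis
    by (rule continuous_on_eq) (simp add: matrix_inv_cramer assms(2))
qed

section \<open>Orthonormal frames of a positive definite matrix and the norm it induces on symmetric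
  matrices\<close>

definition pos_def :: "real^'n^'n \<Rightarrow> bool"
  where "pos_def P \<longleftrightarrow> transpose P = P \<and> (\<forall>v. v \<noteq> 0 \<longrightarrow> v \<bullet> (P *v v) > 0)"

lemma symmetric_matrix_inner:
  fixes P :: "real^'n^'n"
  assumes "transpose P = P"
  shows "v \<bullet> (P *v w) = w \<bullet> (P *v v)"
  by (metis assms dot_lmul_matrix inner_commute transpose_matrix_vector)

lemma inner_congruence:
  fixes P J :: "real^'n^'n"
  shows "v \<bullet> ((transpose J ** P ** J) *v w) = (J *v v) \<bullet> (P *v (J *v w))"
proof -
  have "v \<bullet> (transpose J *v y) = (J *v v) \<bullet> y" for y
    unfolding transpose_matrix_vector by (metis dot_lmul_matrix inner_commute)
  then show ?thesis
    by (simp only: matrix_vector_mul_assoc[symmetric])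
qed

text \<open>Gram-Schmidt for the inner product of \<open>P\<close>, as an induction over the set of
  indices already treated; \<open>I = UNIV\<close> gives a basis.\<close>

lemma pos_def_partial_orthonormal:
  fixes P :: "real^'n^'n"
  assumes P: "pos_def P"
  shows "\<exists>v :: 'n \<Rightarrow> real^'n. \<forall>i\<in>I. \<forall>j\<in>I. v i \<bullet> (P *v v j) = (if i = j then 1 else 0)"
proof -
  have "finite I" by simp
  then show ?thesis
  proof (induction I rule: finite_induct)
    case empty
    then show ?case by simp
  next
    case (insert k I)
    then obtain v :: "'n \<Rightarrow> real^'n" where
      v: "\<And>i j. i \<in> I \<Longrightarrow> j \<in> I \<Longrightarrow> v i \<bullet> (P *v v j) = (if i = j then 1 else 0)" by blast
    \<comment> \<open>The vectors \<open>P *v v i\<close> are too few to span, so a nonzero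
      \<open>w\<close> is Euclidean-orthogonal to all of them, which means
      \<open>P\<close>-orthogonal to every \<open>v i\<close>.\<close>
    have "card I < CARD('n)"
      using insert.hyps by (intro psubset_card_mono) auto
    moreover have "dim ((\<lambda>i. P *v v i) ` I) \<le> card I"
      using insert.hyps dim_le_card' card_image_le by (meson finite_imageI le_trans)
    ultimately obtain w where w: "w \<noteq> 0" "\<And>y. y \<in> span ((\<lambda>i. P *v v i) ` I) \<Longrightarrow> orthogonal w y"
      by (metis DIM_cart DIM_real mult.right_neutral orthogonal_to_subspace_exists order.strict_trans1)
    have wv: "w \<bullet> (P *v v i) = 0" if "i \<in> I" for i
      using w(2)[OF span_base] that by (auto simp: orthogonal_def)
    define q where "q = w \<bullet> (P *v w)"
    have q: "q > 0" using P w(1) unfolding pos_def_def q_def by blast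
    define u where "u = (1 / sqrt q) *\<^sub>R w"
    have uu: "u \<bullet> (P *v u) = 1"
      using q unfolding u_def by (simp add: q_def[symmetric] real_div_sqrt scaleR_matrix_vector_assoc[symmetric] matrix_vector_mult_scaleR)
    have uv: "u \<bullet> (P *v v i) = 0" "v i \<bullet> (P *v u) = 0" if "i \<in> I" for i
      using wv[OF that] symmetric_matrix_inner[of P] P unfolding u_def pos_def_def
      by (auto simp: matrix_vector_mult_scaleR)
    show ?case
      using insert.hyps(2) v uu uv
      by (intro exI[of _ "v(k := u)"]) (auto simp: fun_upd_def)
  qed
qed

lemma pos_def_diagonalize:
  fixes P :: "real^'n^'n"
  assumes "pos_def P"
  obtains Q :: "real^'n^'n" where "invertible Q" "transpose Q ** P ** Q = mat 1"
proof -
  obtain v :: "'n \<Rightarrow> real^'n" where v: "\<And>i j. v i \<bullet> (P *v v j) = (if i = j then 1 else 0)"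
    using pos_def_partial_orthonormal[OF assms, of UNIV] by auto
  define Q :: "real^'n^'n" where "Q = (\<chi> i j. v j $ i)"
  have Qv: "Q *v axis j 1 = v j" for j
    by (simp add: matrix_vector_mult_basis column_def Q_def)
  have *: "transpose Q ** P ** Q = mat 1"
  proof -
    have "(transpose Q ** P ** Q) $ i $ j = axis i 1 \<bullet> ((transpose Q ** P ** Q) *v axis j 1)" for i j
      by (simp only: matrix_vector_mult_basis column_def inner_axis' vec_lambda_beta) simp
    also have "axis i 1 \<bullet> ((transpose Q ** P ** Q) *v axis j 1) = v i \<bullet> (P *v v j)" for i j
      by (simp only: inner_congruence Qv)
    finally show ?thesis
      by (simp add: vec_eq_iff v mat_def)
  qed
  then have "invertible Q"
    by (metis invertible_left_inverse)
  with * that show thesis by blast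
qed

lemma pos_def_det_pos:
  fixes P :: "real^'n^'n"
  assumes "pos_def P"
  shows "det P > 0"
proof -
  obtain Q :: "real^'n^'n" where "transpose Q ** P ** Q = mat 1"
    using pos_def_diagonalize[OF assms] by metis
  then have "det (transpose Q ** P ** Q) = 1" by simp
  then have "(det Q)\<^sup>2 * det P = 1"
    by (simp add: det_mul power2_eq_square mult_ac)
  then show ?thesis
    by (metis zero_less_mult_iff zero_less_one zero_le_power2 not_less)
qed

lemma pos_def_invertible: "pos_def P \<Longrightarrow> invertible P"
  using pos_def_det_pos invertible_det_nz by (metis less_irrefl)

text \<open>In a basis that is orthonormal for \<open>P\<close> the form \<open>tr (P\<^sup>-\<^sup>1 H P\<^sup>-\<^sup>1 H)\<close> becomes the squared
  Frobenius norm of the matrix of \<open>H\<close>.\<close>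

lemma pos_def_frame:
  fixes P H :: "real^'n^'n"
  assumes P: "pos_def P" and H: "transpose H = H"
  obtains Q B :: "real^'n^'n" where "invertible Q" "transpose B = B"
    "trace (matrix_inv P ** H) = trace B"
    "trace (matrix_inv P ** H ** matrix_inv P ** H) = (\<Sum>i\<in>UNIV. \<Sum>j\<in>UNIV. (B$i$j)\<^sup>2)"
    "\<And>w. (Q *v w) \<bullet> (P *v (Q *v w)) = w \<bullet> w"
    "\<And>w. (Q *v w) \<bullet> (H *v (Q *v w)) = w \<bullet> (B *v w)"
proof -
  obtain Q :: "real^'n^'n" where Q: "invertible Q" "transpose Q ** P ** Q = mat 1"
    using pos_def_diagonalize[OF P] .
  have *: "(Q *v w) \<bullet> (K *v (Q *v w)) = w \<bullet> ((transpose Q ** K ** Q) *v w)" for w K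
    by (simp only: inner_congruence)
  define B where "B = transpose Q ** H ** Q"
  \<comment> \<open>Moving factors around products equal to the identity shows that
    \<open>Q ** transpose Q\<close> inverts \<open>P\<close>. Cyclicity then turns both traces into
    traces of \<open>B\<close> and \<open>B ** B\<close>.\<close>
  have "Q ** (transpose Q ** P) = mat 1"
    using Q(2) matrix_left_right_inverse by blast
  then have "P ** (Q ** transpose Q) = mat 1"
    unfolding matrix_mul_assoc using matrix_left_right_inverse[of "Q ** transpose Q" P]
    by (simp add: matrix_mul_assoc)
  then have inv: "matrix_inv P = Q ** transpose Q"
    by (rule matrix_inv_unique)
  have B: "transpose B = B"
    by (simp add: B_def matrix_transpose_mul transpose_transpose H matrix_mul_assoc)
  have 1: "trace (matrix_inv P ** H) = trace B"
    unfolding inv B_def using trace_mul_sym[of Q "transpose Q ** H"] by (simp add: matrix_mul_assoc)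
  have "trace (matrix_inv P ** H ** matrix_inv P ** H) = trace (B ** B)"
    unfolding inv B_def using trace_mul_sym[of Q "transpose Q ** H ** Q ** transpose Q ** H"]
    by (simp add: matrix_mul_assoc)
  also have "\<dots> = (\<Sum>i\<in>UNIV. \<Sum>j\<in>UNIV. B$i$j * B$j$i)"
    by (simp add: trace_def matrix_matrix_mult_def)
  also have "\<dots> = (\<Sum>i\<in>UNIV. \<Sum>j\<in>UNIV. (B$i$j)\<^sup>2)"
  proof (intro sum.cong refl)
    fix i j show "B$i$j * B$j$i = (B$i$j)\<^sup>2"
      using arg_cong[OF B, of "\<lambda>M. M$i$j"] by (simp add: transpose_def power2_eq_square)
  qed
  finally have 2: "trace (matrix_inv P ** H ** matrix_inv P ** H) = (\<Sum>i\<in>UNIV. \<Sum>j\<in>UNIV. (B$i$j)\<^sup>2)" .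
  show thesis
    by (rule that[OF Q(1) B 1 2]) (auto simp: * Q(2) B_def)
qed

lemma trace_inner_nonneg:
  fixes P H :: "real^'n^'n"
  assumes "pos_def P" "transpose H = H"
  shows "trace (matrix_inv P ** H ** matrix_inv P ** H) \<ge> 0"
proof -
  obtain Q B :: "real^'n^'n" where
    "trace (matrix_inv P ** H ** matrix_inv P ** H) = (\<Sum>i\<in>UNIV. \<Sum>j\<in>UNIV. (B$i$j)\<^sup>2)"
    by (rule pos_def_frame[OF assms]) 
  then show ?thesis by (simp add: sum_nonneg)
qed

text \<open>Cauchy-Schwarz between the diagonal of \<open>B\<close> and the constant vector 1, whose
  squared length is the dimension; the diagonal is only a part of the Frobenius norm.\<close>

lemma abs_trace_le:
  fixes P H :: "real^'n^'n"
  assumes "pos_def P" "transpose H = H"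
  shows "\<bar>trace (matrix_inv P ** H)\<bar> \<le> sqrt (CARD('n)) * sqrt (trace (matrix_inv P ** H ** matrix_inv P ** H))"
proof -
  obtain Q B :: "real^'n^'n" where
    1: "trace (matrix_inv P ** H) = trace B" and
    2: "trace (matrix_inv P ** H ** matrix_inv P ** H) = (\<Sum>i\<in>UNIV. \<Sum>j\<in>UNIV. (B$i$j)\<^sup>2)"
    by (rule pos_def_frame[OF assms])
  have "(trace B)\<^sup>2 \<le> (\<Sum>i\<in>(UNIV::'n set). 1\<^sup>2) * (\<Sum>i\<in>UNIV. (B$i$i)\<^sup>2)"
    using Cauchy_Schwarz_ineq_sum[of "\<lambda>_. 1" "\<lambda>i. B$i$i" UNIV] by (simp add: trace_def)
  also have "(\<Sum>i\<in>UNIV. (B$i$i)\<^sup>2) \<le> (\<Sum>i\<in>UNIV. \<Sum>j\<in>UNIV. (B$i$j)\<^sup>2)"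
    by (intro sum_mono member_le_sum) auto
  finally have "(trace B)\<^sup>2 \<le> CARD('n) * (\<Sum>i\<in>UNIV. \<Sum>j\<in>UNIV. (B$i$j)\<^sup>2)"
    by (simp add: mult_left_mono)
  then show ?thesis
    unfolding 1 2 by (simp add: real_sqrt_mult[symmetric] real_le_rsqrt)
qed

text \<open>In the frame \<open>P\<close> becomes the identity, and the Frobenius norm of
  \<open>B\<close> dominates its operator norm.\<close>

lemma abs_quadratic_form_le:
  fixes P H :: "real^'n^'n"
  assumes "pos_def P" "transpose H = H"
  shows "\<bar>v \<bullet> (H *v v)\<bar> \<le> sqrt (trace (matrix_inv P ** H ** matrix_inv P ** H)) * (v \<bullet> (P *v v))"
proof -
  obtain Q B :: "real^'n^'n" where Q: "invertible Q" and
    2: "trace (matrix_inv P ** H ** matrix_inv P ** H) = (\<Sum>i\<in>UNIV. \<Sum>j\<in>UNIV. (B$i$j)\<^sup>2)" and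
    3: "\<And>w. (Q *v w) \<bullet> (P *v (Q *v w)) = w \<bullet> w" and
    4: "\<And>w. (Q *v w) \<bullet> (H *v (Q *v w)) = w \<bullet> (B *v w)"
    by (rule pos_def_frame[OF assms]) (assumption | blast)+
  define w where "w = matrix_inv Q *v v"
  have v: "v = Q *v w" unfolding w_def by (simp add: matrix_vector_mul_assoc matrix_inv_right[OF Q])
  have "(norm (B *v w))\<^sup>2 = (\<Sum>i\<in>UNIV. ((B *v w) $ i)\<^sup>2)"
    by (simp add: norm_vec_def L2_set_def sum_nonneg)
  also have "\<dots> \<le> (\<Sum>i\<in>UNIV. (norm (B$i))\<^sup>2 * (norm w)\<^sup>2)"
  proof (rule sum_mono)
    fix i
    have "\<bar>(B *v w) $ i\<bar> \<le> norm (B$i) * norm w"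
      by (metis Cauchy_Schwarz_ineq2 matrix_vector_mul_component)
    then show "((B *v w) $ i)\<^sup>2 \<le> (norm (B$i))\<^sup>2 * (norm w)\<^sup>2"
      by (metis abs_le_square_iff abs_mult abs_norm_cancel power_mult_distrib)
  qed
  also have "\<dots> = (\<Sum>i\<in>UNIV. \<Sum>j\<in>UNIV. (B$i$j)\<^sup>2) * (norm w)\<^sup>2"
    by (simp add: sum_distrib_right norm_vec_def L2_set_def sum_nonneg)
  finally have "norm (B *v w) \<le> sqrt ((\<Sum>i\<in>UNIV. \<Sum>j\<in>UNIV. (B$i$j)\<^sup>2) * (norm w)\<^sup>2)"
    by (rule real_le_rsqrt)
  then have "norm (B *v w) \<le> sqrt (\<Sum>i\<in>UNIV. \<Sum>j\<in>UNIV. (B$i$j)\<^sup>2) * norm w"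
    by (simp add: real_sqrt_mult)
  then have "\<bar>w \<bullet> (B *v w)\<bar> \<le> norm w * (sqrt (\<Sum>i\<in>UNIV. \<Sum>j\<in>UNIV. (B$i$j)\<^sup>2) * norm w)"
    by (meson Cauchy_Schwarz_ineq2 mult_left_mono norm_ge_zero order_trans)
  then show ?thesis
    unfolding v 2 3 4 by (simp add: power2_norm_eq_inner[symmetric] power2_eq_square mult_ac)
qed

section \<open>Change of coordinates\<close>

lemma congruence_inverse:
  fixes J G :: "real^'n^'n"
  assumes "invertible J" "invertible G"
  shows "matrix_inv (transpose J ** G ** J) = matrix_inv J ** matrix_inv G ** transpose (matrix_inv J)"
proof (rule matrix_inv_unique)
  have "transpose J ** G ** J ** (matrix_inv J ** matrix_inv G ** transpose (matrix_inv J))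
      = transpose J ** (G ** (J ** matrix_inv J) ** matrix_inv G) ** transpose (matrix_inv J)"
    by (simp only: matrix_mul_assoc)
  also have "\<dots> = transpose (matrix_inv J ** J)"
    by (simp only: matrix_inv_right assms matrix_mul_rid matrix_transpose_mul)
  also have "\<dots> = mat 1" by (simp only: matrix_inv_left assms transpose_mat)
  finally show "transpose J ** G ** J ** (matrix_inv J ** matrix_inv G ** transpose (matrix_inv J)) = mat 1" .
qed

text \<open>A congruence applied to both forms conjugates their quotient; this is why trace
  expressions in such quotients do not depend on the chart.\<close>

lemma congruence_quotient:
  fixes J G H :: "real^'n^'n"
  assumes "invertible J" "invertible G"
  shows "matrix_inv (transpose J ** G ** J) ** (transpose J ** H ** J) = matrix_inv J ** (matrix_inv G ** H) ** J"
proof -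
  have "matrix_inv (transpose J ** G ** J) ** (transpose J ** H ** J)
      = matrix_inv J ** matrix_inv G ** (transpose (matrix_inv J) ** transpose J) ** H ** J"
    by (simp only: congruence_inverse[OF assms] matrix_mul_assoc)
  also have "transpose (matrix_inv J) ** transpose J = mat 1"
    by (simp only: matrix_transpose_mul[symmetric] matrix_inv_right assms transpose_mat)
  finally show ?thesis by (simp only: matrix_mul_assoc matrix_mul_rid)
qed

section \<open>Derivatives along paths of positive definite matrices\<close>

lemma has_vector_derivative_matrix_nth:
  fixes f :: "real \<Rightarrow> real^'n^'m"
  assumes "(f has_vector_derivative f') (at t within S)"
  shows "((\<lambda>s. f s $ i $ j) has_real_derivative f' $ i $ j) (at t within S)"
  unfolding has_real_derivative_iff_has_vector_derivative
  by (intro bounded_linear.has_vector_derivative[OF bounded_linear_vec_nth] assms)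

lemma has_vector_derivative_quadratic_form:
  fixes f :: "real \<Rightarrow> real^'n^'n"
  assumes "(f has_vector_derivative f') (at t within S)"
  shows "((\<lambda>s. v \<bullet> (f s *v v)) has_real_derivative v \<bullet> (f' *v v)) (at t within S)"
proof -
  have "((\<lambda>s. v $ i * (\<Sum>j\<in>UNIV. f s $ i $ j * v $ j)) has_real_derivative
      v $ i * (\<Sum>j\<in>UNIV. f' $ i $ j * v $ j)) (at t within S)" for i
    by (intro DERIV_cmult DERIV_sum DERIV_cmult_right has_vector_derivative_matrix_nth[OF assms])
  then show ?thesis
    unfolding inner_vec_def matrix_vector_mult_def by (auto intro!: DERIV_sum)
qed

lemma has_vector_derivative_matrix_mult_left:
  fixes f :: "real \<Rightarrow> real^'n^'m" and P :: "real^'m^'p"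
  assumes "(f has_vector_derivative f') (at t within S)"
  shows "((\<lambda>s. P ** f s) has_vector_derivative P ** f') (at t within S)"
proof -
  have "linear (\<lambda>X :: real^'n^'m. P ** X)"
    by (auto intro!: linearI simp: vec_eq_iff matrix_matrix_mult_def distrib_left sum.distrib sum_distrib_left mult_ac)
  then have "bounded_linear (\<lambda>X :: real^'n^'m. P ** X)"
    by (simp only: linear_conv_bounded_linear)
  then show ?thesis
    using assms by (rule bounded_linear.has_vector_derivative)
qed

lemma has_field_derivative_prod_within:
  fixes f :: "'i \<Rightarrow> real \<Rightarrow> real"
  assumes "\<And>i. i \<in> I \<Longrightarrow> (f i has_real_derivative f' i) (at t within S)"
  shows "((\<lambda>s. \<Prod>i\<in>I. f i s) has_real_derivative (\<Sum>i\<in>I. f' i * (\<Prod>j\<in>I - {i}. f j t))) (at t within S)"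
proof -
  have "((\<lambda>s. \<Prod>i\<in>I. f i s) has_derivative (\<lambda>y. \<Sum>i\<in>I. (f' i * y) * (\<Prod>j\<in>I - {i}. f j t))) (at t within S)"
    using assms by (intro has_derivative_prod) (auto simp: has_field_derivative_def)
  then show ?thesis
    unfolding has_field_derivative_def
    by (rule has_derivative_eq_rhs) (simp add: sum_distrib_right sum_distrib_left fun_eq_iff mult_ac)
qed

text \<open>In the derivative of the Leibniz sum only the identity permutation survives.\<close>

lemma has_derivative_det_at_identity:
  fixes f :: "real \<Rightarrow> real^'n^'n"
  assumes f: "(f has_vector_derivative f') (at t within S)" and "f t = mat 1"
  shows "((\<lambda>s. det (f s)) has_real_derivative trace f') (at t within S)"
proof -
  let ?D = "\<lambda>p. \<Sum>i\<in>UNIV. f' $ i $ p i * (\<Prod>j\<in>UNIV - {i}. f t $ j $ p j)"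
  have "((\<lambda>s. det (f s)) has_real_derivative
      (\<Sum>p | p permutes (UNIV::'n set). of_int (sign p) * ?D p)) (at t within S)"
    unfolding det_def
    by (intro DERIV_sum DERIV_cmult has_field_derivative_prod_within has_vector_derivative_matrix_nth[OF f])
  moreover have "?D p = (if p = id then trace f' else 0)" if p: "p permutes UNIV" for p
  proof (cases "p = id")
    case True
    then show ?thesis by (simp add: assms(2) mat_def trace_def)
  next
    case False
    then obtain a where a: "p a \<noteq> a" by (auto simp: fun_eq_iff)
    \<comment> \<open>A nontrivial \<open>p\<close> moves both \<open>a\<close> and
      \<open>p a\<close>. The product rule omits a single row, so one of these two rows remains and
      contributes an off-diagonal zero.\<close>
    have pa: "p (p a) \<noteq> p a" using p a by (metis permutes_inj injD)
    have z: "(\<Prod>j\<in>UNIV - {i}. f t $ j $ p j) = 0" for i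
    proof (rule prod_zero)
      show "\<exists>j\<in>UNIV - {i}. f t $ j $ p j = 0"
      proof (cases "i = a")
        case True
        then show ?thesis
          using a pa by (intro bexI[of _ "p a"]) (auto simp: assms(2) mat_def)
      next
        case False
        then show ?thesis
          using a by (intro bexI[of _ a]) (auto simp: assms(2) mat_def)
      qed
    qed simp
    have "?D p = 0" by (simp only: z mult_zero_right sum.neutral_const)
    then show ?thesis using False by (simp only: if_False)
  qed
  then have "(\<Sum>p | p permutes (UNIV::'n set). of_int (sign p) * ?D p) =
      (\<Sum>p | p permutes (UNIV::'n set). if p = id then trace f' else 0)"
    by (intro sum.cong) (auto simp: sign_id)
  moreover have "\<dots> = trace f'"
    by (simp add: sum.delta' finite_permutations permutes_id)
  ultimately show ?thesis by simp
qed

text \<open>Jacobi's formula: multiplication by the constant matrix \<open>matrix_inv (f t)\<close>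
  moves the base point to the identity.\<close>

lemma has_derivative_det:
  fixes f :: "real \<Rightarrow> real^'n^'n"
  assumes f: "(f has_vector_derivative f') (at t within S)" and inv: "invertible (f t)"
  shows "((\<lambda>s. det (f s)) has_real_derivative det (f t) * trace (matrix_inv (f t) ** f')) (at t within S)"
proof -
  have "((\<lambda>s. det (matrix_inv (f t) ** f s)) has_real_derivative trace (matrix_inv (f t) ** f')) (at t within S)"
    by (intro has_derivative_det_at_identity has_vector_derivative_matrix_mult_left f matrix_inv_left inv)
  then have "((\<lambda>s. det (f t) * det (matrix_inv (f t) ** f s)) has_real_derivative
      det (f t) * trace (matrix_inv (f t) ** f')) (at t within S)"
    by (rule DERIV_cmult)
  moreover have "det (f t) * det (matrix_inv (f t) ** f s) = det (f s)" for s
    by (metis det_mul matrix_inv_right[OF inv] matrix_mul_assoc matrix_mul_lid)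
  ultimately show ?thesis by simp
qed

text \<open>With u = C det f, q = f(v, v), \<tau> the trace of f^-1 f' and r = f'(v, v), the
  derivative is u^(1/4) (\<tau> / (4 (1 + q)) - r / (1 + q)^2). The first term is at most sqrt n
  times N u^(1/4), the second at most N u^(1/4), which explains the constant. \<open>C\<close>
  stands for 1 / det g at a fixed point.\<close>

lemma det_weight_derivative:
  fixes f :: "real \<Rightarrow> real^'n^'n"
  assumes f: "(f has_vector_derivative f') (at t within S)" and P: "pos_def (f t)"
    and f': "transpose f' = f'" and C: "C > 0"
  defines "N \<equiv> sqrt (trace (matrix_inv (f t) ** f' ** matrix_inv (f t) ** f'))"
  obtains D where
    "((\<lambda>s. (C * det (f s)) powr (1/4) / (1 + v \<bullet> (f s *v v))) has_real_derivative D) (at t within S)"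
    "\<bar>D\<bar> \<le> (sqrt (CARD('n)) + 1) * (N * (C * det (f t)) powr (1/4))"
proof -
  define u where "u = C * det (f t)"
  define q where "q = v \<bullet> (f t *v v)"
  define \<tau> where "\<tau> = trace (matrix_inv (f t) ** f')"
  define r where "r = v \<bullet> (f' *v v)"
  have u: "u > 0" using C pos_def_det_pos[OF P] by (simp add: u_def)
  have q: "q \<ge> 0" using P by (cases "v = 0") (auto simp: q_def pos_def_def less_imp_le)
  have \<tau>: "\<bar>\<tau>\<bar> \<le> sqrt (CARD('n)) * N"
    unfolding \<tau>_def N_def by (rule abs_trace_le[OF P f'])
  have r: "\<bar>r\<bar> \<le> N * q"
    unfolding r_def N_def q_def by (rule abs_quadratic_form_le[OF P f'])
  have N: "N \<ge> 0" unfolding N_def using trace_inner_nonneg[OF P f'] by simp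
  have du: "((\<lambda>s. C * det (f s)) has_real_derivative u * \<tau>) (at t within S)"
    unfolding u_def \<tau>_def mult.assoc
    by (intro DERIV_cmult has_derivative_det f pos_def_invertible P)
  have dq: "((\<lambda>s. v \<bullet> (f s *v v)) has_real_derivative r) (at t within S)"
    unfolding r_def by (rule has_vector_derivative_quadratic_form[OF f])
  have dpowr: "((\<lambda>s. (C * det (f s)) powr (1/4)) has_real_derivative
      (1/4) * u powr (1/4 - 1) * (u * \<tau>)) (at t within S)"
    by (rule DERIV_chain2[where g = "\<lambda>s. C * det (f s)" and f = "\<lambda>y. y powr (1/4)"])
       (use u du has_real_derivative_powr[of u "1/4"] in \<open>simp_all add: u_def[symmetric]\<close>)
  have "(1/4) * u powr (1/4 - 1) * (u * \<tau>) = u powr (1/4) * (\<tau> / 4)"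
    using u powr_add[of u "1/4 - 1" 1] by (simp add: mult_ac)
  with dpowr have dpowr: "((\<lambda>s. (C * det (f s)) powr (1/4)) has_real_derivative u powr (1/4) * (\<tau> / 4)) (at t within S)"
    by (simp only:)
  let ?D = "(u powr (1/4) * (\<tau> / 4) * (1 + q) - u powr (1/4) * r) / ((1 + q) * (1 + q))"
  have D: "((\<lambda>s. (C * det (f s)) powr (1/4) / (1 + v \<bullet> (f s *v v))) has_real_derivative ?D) (at t within S)"
  proof -
    have "((\<lambda>s. 1 + v \<bullet> (f s *v v)) has_real_derivative r) (at t within S)"
      using DERIV_add[OF DERIV_const dq, of 1] by simp
    then show ?thesis
      using DERIV_divide[OF dpowr, of "\<lambda>s. 1 + v \<bullet> (f s *v v)" r] q
      by (simp add: u_def[symmetric] q_def[symmetric])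
  qed
  have eq: "?D = u powr (1/4) * (\<tau> / (4 * (1 + q)) - r / (1 + q)\<^sup>2)"
  proof -
    have "(a * (\<tau> / 4) * k - a * r) / (k * k) = a * (\<tau> / (4 * k) - r / k\<^sup>2)" if "k \<noteq> 0" for a k
      using that by (simp add: field_simps power2_eq_square)
    then show ?thesis using q by simp
  qed
  have "\<bar>\<tau> / (4 * (1 + q))\<bar> \<le> \<bar>\<tau>\<bar>"
  proof -
    have "\<bar>\<tau> / (4 * (1 + q))\<bar> = \<bar>\<tau>\<bar> / (4 * (1 + q))" using q by (simp add: abs_mult)
    also have "\<dots> \<le> \<bar>\<tau>\<bar> / 1" using q by (intro divide_left_mono) auto
    finally show ?thesis by simp
  qed
  moreover have "\<bar>r / (1 + q)\<^sup>2\<bar> \<le> N"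
  proof -
    have "\<bar>r / (1 + q)\<^sup>2\<bar> = \<bar>r\<bar> / (1 + q)\<^sup>2" by simp
    also have "\<dots> \<le> N"
    proof -
      \<comment> \<open>The denominator absorbs the factor \<open>q\<close> of the bound on
        \<open>r\<close>, so the estimate is uniform in \<open>v\<close>.\<close>
      have "q \<le> (1 + q)\<^sup>2" using q by (simp add: power2_eq_square algebra_simps)
      then have "N * q \<le> N * (1 + q)\<^sup>2" using N by (rule mult_left_mono)
      with r have "\<bar>r\<bar> \<le> N * (1 + q)\<^sup>2" by linarith
      then show ?thesis using q by (simp add: divide_le_eq)
    qed
    finally show ?thesis .
  qed
  ultimately have "\<bar>\<tau> / (4 * (1 + q)) - r / (1 + q)\<^sup>2\<bar> \<le> (sqrt (CARD('n)) + 1) * N"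
    using \<tau> unfolding distrib_right by linarith
  then have "\<bar>?D\<bar> \<le> u powr (1/4) * ((sqrt (CARD('n)) + 1) * N)"
    unfolding eq abs_mult by (simp add: mult_left_mono)
  with that[OF D] show thesis by (simp add: u_def mult_ac)
qed

text \<open>Polarization with finitely many vectors; for i = j the vector is 2 e_i and yields the
  diagonal entries, which are then cancelled from the mixed ones.\<close>

lemma symmetric_matrix_eqI:
  fixes P Q :: "real^'n^'n"
  assumes P: "transpose P = P" and Q: "transpose Q = Q"
    and eq: "\<And>i j. (axis i 1 + axis j 1) \<bullet> (P *v (axis i 1 + axis j 1)) = (axis i 1 + axis j 1) \<bullet> (Q *v (axis i 1 + axis j 1))"
  shows "P = Q"
proof -
  have ax: "axis i 1 \<bullet> (M *v axis j 1) = M $ i $ j" for M :: "real^'n^'n" and i j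
    by (simp only: matrix_vector_mult_basis column_def inner_axis' vec_lambda_beta) simp
  have s: "P $ j $ i = P $ i $ j" "Q $ j $ i = Q $ i $ j" for i j
    using arg_cong[OF P, of "\<lambda>M. M$i$j"] arg_cong[OF Q, of "\<lambda>M. M$i$j"] by (auto simp: transpose_def)
  have expand: "P $ i $ i + P $ j $ j + 2 * P $ i $ j = Q $ i $ i + Q $ j $ j + 2 * Q $ i $ j" for i j
    using eq[of i j] by (simp add: matrix_vector_right_distrib inner_add_left inner_add_right ax s[of i j])
  have "P $ i $ i = Q $ i $ i" for i
    using expand[of i i] by simp
  then have "P $ i $ j = Q $ i $ j" for i j
    using expand[of i j] by simp
  then show ?thesis by (simp add: vec_eq_iff)
qed

section \<open>Change of variables for nonnegative functions\<close>

text \<open>The library proves the change of variables formula only for index types of class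
  \<^class>\<open>wellorder\<close>. A copy of the index type with an arbitrary enumeration removes this restriction.\<close>

typedef ('n::finite) enumerated = "UNIV :: 'n set" ..

definition enum_rank :: "'n::finite \<Rightarrow> nat"
  where "enum_rank = (SOME f. inj f)"

lemma inj_enum_rank: "inj (enum_rank :: 'n::finite \<Rightarrow> nat)"
  unfolding enum_rank_def using finite_imp_inj_to_nat_seg[OF finite[of "UNIV :: 'n set"]] by (metis someI_ex)

instantiation enumerated :: (finite) "{finite, wellorder}"
begin

definition less_eq_enumerated :: "'a enumerated \<Rightarrow> 'a enumerated \<Rightarrow> bool"
  where "less_eq_enumerated x y \<longleftrightarrow> enum_rank (Rep_enumerated x) \<le> enum_rank (Rep_enumerated y)"

definition less_enumerated :: "'a enumerated \<Rightarrow> 'a enumerated \<Rightarrow> bool"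
  where "less_enumerated x y \<longleftrightarrow> enum_rank (Rep_enumerated x) < enum_rank (Rep_enumerated y)"

instance
proof
  have "Abs_enumerated ` UNIV = (UNIV :: 'a enumerated set)"
    by (metis Abs_enumerated_cases surj_def)
  then show "finite (UNIV :: 'a enumerated set)"
    by (metis finite finite_imageI)
  fix x y :: "'a enumerated"
  show "x = y" if "x \<le> y" "y \<le> x"
    using that inj_enum_rank by (metis Rep_enumerated_inject injD le_antisym less_eq_enumerated_def)
  fix P and a :: "'a enumerated"
  show "P a" if "\<And>x. (\<And>y. y < x \<Longrightarrow> P y) \<Longrightarrow> P x"
  proof (induction a rule: measure_induct_rule[of "\<lambda>x. enum_rank (Rep_enumerated x)"])
    case (less a)
    show ?case
      by (rule that, rule less) (simp only: less_enumerated_def)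
  qed
qed (auto simp: less_eq_enumerated_def less_enumerated_def)

end

lemma bij_Rep_enumerated: "bij (Rep_enumerated :: 'n::finite enumerated \<Rightarrow> 'n)"
  by (metis Abs_enumerated_inverse Rep_enumerated_inject UNIV_I bijI inj_def surj_def)

text \<open>Relabelling conjugates the permutations in the Leibniz sum, which keeps their signs and
  merely reorders the products.\<close>

lemma det_reindex:
  fixes M :: "real^'n^'n" and \<pi> :: "'m::finite \<Rightarrow> 'n"
  assumes "bij \<pi>"
  shows "det (\<chi> i j. M $ \<pi> i $ \<pi> j) = det M"
proof -
  have inv: "\<pi> (inv \<pi> x) = x" "inv \<pi> (\<pi> z) = z" for x z
    using assms by (auto simp: bij_is_surj surj_f_inv_f bij_is_inj)
  have mp: "map_permutation UNIV \<pi> p = \<pi> \<circ> p \<circ> inv \<pi>" if "p permutes UNIV" for p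
    using assms by (simp add: map_permutation_def restrict_id_def bij_is_surj o_def)
  have "(\<Sum>p | p permutes (UNIV::'m set). of_int (sign p) * (\<Prod>i\<in>UNIV. (\<chi> i j. M $ \<pi> i $ \<pi> j) $ i $ p i))
      = (\<Sum>q | q permutes (UNIV::'n set). of_int (sign q) * (\<Prod>i\<in>UNIV. M $ i $ q i))"
  proof (rule sum.reindex_bij_witness[of _ "\<lambda>q. inv \<pi> \<circ> q \<circ> \<pi>" "\<lambda>p. \<pi> \<circ> p \<circ> inv \<pi>"])
    fix p assume "p \<in> {p. p permutes (UNIV :: 'm set)}"
    then have p: "p permutes UNIV" by simp
    then show "inv \<pi> \<circ> (\<pi> \<circ> p \<circ> inv \<pi>) \<circ> \<pi> = p" by (simp add: fun_eq_iff inv)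
    have "bij (\<pi> \<circ> p \<circ> inv \<pi>)"
      using p assms by (intro bij_comp bij_imp_bij_inv) (auto simp: permutes_bij)
    then show "\<pi> \<circ> p \<circ> inv \<pi> \<in> {q. q permutes (UNIV :: 'n set)}"
      by (auto intro!: bij_imp_permutes)
    have "sign (\<pi> \<circ> p \<circ> inv \<pi>) = sign p"
      using sign_map_permutation[of \<pi> UNIV p] p assms mp[OF p] by (simp add: bij_is_inj)
    moreover have "(\<Prod>i\<in>UNIV. M $ i $ (\<pi> \<circ> p \<circ> inv \<pi>) i) = (\<Prod>i\<in>UNIV. M $ \<pi> i $ \<pi> (p i))"
      by (rule prod.reindex_bij_witness[of _ \<pi> "inv \<pi>"]) (auto simp: inv)
    ultimately show "of_int (sign (\<pi> \<circ> p \<circ> inv \<pi>)) * (\<Prod>i\<in>UNIV. M $ i $ (\<pi> \<circ> p \<circ> inv \<pi>) i)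
        = of_int (sign p) * (\<Prod>i\<in>UNIV. (\<chi> i j. M $ \<pi> i $ \<pi> j) $ i $ p i)"
      by simp
  next
    fix q assume "q \<in> {q. q permutes (UNIV :: 'n set)}"
    then have q: "q permutes UNIV" by simp
    then show "\<pi> \<circ> (inv \<pi> \<circ> q \<circ> \<pi>) \<circ> inv \<pi> = q" by (simp add: fun_eq_iff inv)
    have "bij (inv \<pi> \<circ> q \<circ> \<pi>)"
      using q assms by (intro bij_comp bij_imp_bij_inv) (auto simp: permutes_bij)
    then show "inv \<pi> \<circ> q \<circ> \<pi> \<in> {p. p permutes (UNIV :: 'm set)}"
      by (auto intro!: bij_imp_permutes)
  qed
  then show ?thesis unfolding det_def .
qed

lemma emeasure_lborel_box_cart:
  fixes l u :: "real^'n"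
  assumes "\<And>i. l $ i \<le> u $ i"
  shows "emeasure lborel (box l u) = ennreal (\<Prod>i\<in>UNIV. u $ i - l $ i)"
proof -
  have ne: "cbox l u \<noteq> {}" using assms by (auto simp: mem_box_cart intro!: exI[of _ l] simp flip: ex_in_conv)
  have "emeasure lborel (box l u) = emeasure lborel (cbox l u)"
    by (simp add: emeasure_lborel_box_eq emeasure_lborel_cbox_eq)
  also have "\<dots> = ennreal (measure lborel (cbox l u))"
    using emeasure_lborel_cbox_finite[of l u] by (intro emeasure_eq_ennreal_measure) auto
  finally show ?thesis using content_cbox_cart[OF ne] by simp
qed

text \<open>Boxes are pulled back to boxes with the same side lengths, and the values on boxes
  characterise Lebesgue measure.\<close>

lemma lborel_reindex:
  fixes \<pi> :: "'m::finite \<Rightarrow> 'n::finite"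
  assumes "bij \<pi>"
  shows "distr lborel borel (\<lambda>x :: real^'n. \<chi> i. x $ \<pi> i) = (lborel :: (real^'m) measure)"
proof (rule lborel_eqI[symmetric])
  have [measurable]: "(\<lambda>x :: real^'n. \<chi> i. x $ \<pi> i) \<in> borel_measurable borel"
    by (intro borel_measurable_continuous_onI continuous_intros)
  fix l u :: "real^'m"
  assume "\<And>b. b \<in> Basis \<Longrightarrow> l \<bullet> b \<le> u \<bullet> b"
  then have le: "l $ i \<le> u $ i" for i
    by (simp add: cart_eq_inner_axis)
  define l' :: "real^'n" where "l' = (\<chi> i. l $ inv \<pi> i)"
  define u' :: "real^'n" where "u' = (\<chi> i. u $ inv \<pi> i)"
  have inv: "\<pi> (inv \<pi> x) = x" "inv \<pi> (\<pi> z) = z" for x z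
    using assms by (auto simp: bij_is_surj surj_f_inv_f bij_is_inj)
  have "(\<lambda>x :: real^'n. \<chi> i. x $ \<pi> i) -` box l u = box l' u'"
    unfolding l'_def u'_def by (auto simp: mem_box_cart) (metis inv)+
  then have "emeasure (distr lborel borel (\<lambda>x :: real^'n. \<chi> i. x $ \<pi> i)) (box l u) = emeasure lborel (box l' u')"
    by (simp add: emeasure_distr)
  also have "\<dots> = ennreal (\<Prod>i\<in>UNIV. u' $ i - l' $ i)"
    by (rule emeasure_lborel_box_cart) (simp add: l'_def u'_def le)
  also have "(\<Prod>i\<in>UNIV. u' $ i - l' $ i) = (\<Prod>i\<in>UNIV. u $ i - l $ i)"
    by (rule prod.reindex_bij_witness[of _ \<pi> "inv \<pi>"]) (auto simp: inv l'_def u'_def)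
  also have "ennreal \<dots> = emeasure lborel (box l u)"
    using emeasure_lborel_box_cart[of l u] le by simp
  also have "\<dots> = ennreal (\<Prod>b\<in>Basis. (u - l) \<bullet> b)"
    using \<open>\<And>b. b \<in> Basis \<Longrightarrow> l \<bullet> b \<le> u \<bullet> b\<close> by (simp add: emeasure_lborel_box)
  finally show "emeasure (distr lborel borel (\<lambda>x :: real^'n. \<chi> i. x $ \<pi> i)) (box l u) = ennreal (\<Prod>b\<in>Basis. (u - l) \<bullet> b)" .
qed simp

text \<open>Links two languages: integrability with a prescribed integral \<open>b\<close> becomes a
  single equation in \<open>ennreal\<close>.\<close>

lemma absolutely_integrable_iff_nn_integral:
  fixes w :: "real^'n \<Rightarrow> real"
  assumes "\<And>x. x \<in> S \<Longrightarrow> 0 \<le> w x" and "(\<lambda>x. indicator S x * w x) \<in> borel_measurable borel" and "b \<ge> 0"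
  shows "w absolutely_integrable_on S \<and> integral S w = b \<longleftrightarrow> (\<integral>\<^sup>+x. ennreal (indicator S x * w x) \<partial>lborel) = ennreal b"
proof -
  have "w absolutely_integrable_on S \<and> integral S w = b \<longleftrightarrow> (w has_integral b) S"
    using absolutely_integrable_on_iff_nonneg[where S = S and f = w] assms(1) by (auto simp: has_integral_iff)
  also have "\<dots> \<longleftrightarrow> ((\<lambda>x. indicator S x * w x) has_integral b) UNIV"
    unfolding has_integral_restrict_UNIV[symmetric, where f = w and s = S]
    by (intro arg_cong2[where f="\<lambda>f b. (f has_integral b) UNIV"]) (auto simp: indicator_def)
  also have "\<dots> \<longleftrightarrow> (\<integral>\<^sup>+x. ennreal (indicator S x * w x) \<partial>lborel) = ennreal b"
    using assms by (subst has_integral_iff_nn_integral_lebesgue)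
      (auto simp: nn_integral_completion indicator_def intro!: measurable_completion)
  finally show ?thesis .
qed

lemma nn_integral_change_of_variables_wellorder:
  fixes T :: "real^'m::{finite,wellorder} \<Rightarrow> real^'m::_" and u :: "real^'m::_ \<Rightarrow> real"
  assumes S: "S \<in> sets borel" and der: "\<And>x. x \<in> S \<Longrightarrow> (T has_derivative T' x) (at x within S)"
    and inj: "inj_on T S" and u: "\<And>y. y \<in> T ` S \<Longrightarrow> 0 \<le> u y"
    and m1: "(\<lambda>x. indicator S x * (\<bar>det (matrix (T' x))\<bar> * u (T x))) \<in> borel_measurable borel"
    and m2: "(\<lambda>y. indicator (T ` S) y * u y) \<in> borel_measurable borel"
  shows "(\<integral>\<^sup>+x. ennreal (indicator S x * (\<bar>det (matrix (T' x))\<bar> * u (T x))) \<partial>lborel) =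
    (\<integral>\<^sup>+y. ennreal (indicator (T ` S) y * u y) \<partial>lborel)" (is "?I = ?J")
proof -
  have iff: "?I = ennreal b \<longleftrightarrow> ?J = ennreal b" if "b \<ge> 0" for b
  proof -
    \<comment> \<open>The formula concerns vector-valued integrands, so the real function
      \<open>u\<close> is embedded into \<open>real^1\<close>.\<close>
    have "(\<lambda>x. \<bar>det (matrix (T' x))\<bar> *\<^sub>R (vec (u (T x)) :: real^1)) absolutely_integrable_on S \<and>
           integral S (\<lambda>x. \<bar>det (matrix (T' x))\<bar> *\<^sub>R (vec (u (T x)) :: real^1)) = vec b
        \<longleftrightarrow> (\<lambda>y. vec (u y) :: real^1) absolutely_integrable_on (T ` S) \<and> integral (T ` S) (\<lambda>y. vec (u y) :: real^1) = vec b"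
      using S der inj by (intro has_absolute_integral_change_of_variables) auto
    then have "(\<lambda>x. \<bar>det (matrix (T' x))\<bar> * u (T x)) absolutely_integrable_on S \<and>
           integral S (\<lambda>x. \<bar>det (matrix (T' x))\<bar> * u (T x)) = b
        \<longleftrightarrow> u absolutely_integrable_on (T ` S) \<and> integral (T ` S) u = b"
      by (simp add: absolutely_integrable_on_1_iff integral_on_1_eq)
    moreover have "(\<lambda>x. \<bar>det (matrix (T' x))\<bar> * u (T x)) absolutely_integrable_on S \<and>
           integral S (\<lambda>x. \<bar>det (matrix (T' x))\<bar> * u (T x)) = b \<longleftrightarrow> ?I = ennreal b"
      using that u m1 by (intro absolutely_integrable_iff_nn_integral) auto
    moreover have "u absolutely_integrable_on (T ` S) \<and> integral (T ` S) u = b \<longleftrightarrow> ?J = ennreal b"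
      using that u m2 by (intro absolutely_integrable_iff_nn_integral) auto
    ultimately show ?thesis by simp
  qed
  show ?thesis
  proof (cases ?I rule: ennreal_cases)
    case (real b)
    then show ?thesis using iff[of b] by simp
  next
    \<comment> \<open>A finite value of \<open>?J\<close> would be shared by \<open>?I\<close>
      through \<open>iff\<close>, so both sides are infinite.\<close>
    case top
    then show ?thesis using iff by (cases ?J rule: ennreal_cases) auto
  qed
qed

text \<open>Conjugating \<open>T\<close> with the coordinate relabelling \<open>\<rho>\<close> leads
  to the ordered index type. The relabelling is linear, preserves Lebesgue measure and does not
  change the Jacobian determinant.\<close>

lemma nn_integral_change_of_variables:
  fixes T :: "real^'n \<Rightarrow> real^'n" and u :: "real^'n \<Rightarrow> real"
  assumes S: "S \<in> sets borel" and der: "\<And>x. x \<in> S \<Longrightarrow> (T has_derivative T' x) (at x within S)"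
    and inj: "inj_on T S" and u: "\<And>y. y \<in> T ` S \<Longrightarrow> 0 \<le> u y"
    and m1: "(\<lambda>x. indicator S x * (\<bar>det (matrix (T' x))\<bar> * u (T x))) \<in> borel_measurable borel"
    and m2: "(\<lambda>y. indicator (T ` S) y * u y) \<in> borel_measurable borel"
  shows "(\<integral>\<^sup>+x. ennreal (indicator S x * (\<bar>det (matrix (T' x))\<bar> * u (T x))) \<partial>lborel) =
    (\<integral>\<^sup>+y. ennreal (indicator (T ` S) y * u y) \<partial>lborel)"
proof -
  define \<rho> :: "real^'n enumerated \<Rightarrow> real^'n" where "\<rho> = (\<lambda>z. \<chi> i. z $ inv Rep_enumerated i)"
  define \<rho>i :: "real^'n \<Rightarrow> real^'n enumerated" where "\<rho>i = (\<lambda>z. \<chi> i. z $ Rep_enumerated i)"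
  note bij = bij_Rep_enumerated[where 'n = 'n]
  have inv: "Rep_enumerated (inv Rep_enumerated x) = x" "inv Rep_enumerated (Rep_enumerated z) = z" for x :: 'n and z :: "'n enumerated"
    using bij by (auto simp: bij_is_surj surj_f_inv_f intro: inv_f_f bij_is_inj)
  have \<rho>[simp]: "\<rho> (\<rho>i x) = x" "\<rho>i (\<rho> z) = z" for x z
    by (auto simp: \<rho>_def \<rho>i_def vec_eq_iff inv)
  have lin: "linear \<rho>" "linear \<rho>i"
    by (auto simp: \<rho>_def \<rho>i_def vec_eq_iff intro!: linearI)
  then have bl: "bounded_linear \<rho>" "bounded_linear \<rho>i"
    by (auto simp: linear_conv_bounded_linear)
  have [measurable]: "\<rho> \<in> borel_measurable borel" "\<rho>i \<in> borel_measurable borel"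
    using bl by (auto intro!: borel_measurable_continuous_onI linear_continuous_on)
  have distr: "distr lborel borel \<rho> = (lborel :: (real^'n) measure)"
    unfolding \<rho>_def by (intro lborel_reindex bij_imp_bij_inv bij)
  define S' where "S' = \<rho>i ` S"
  have S'_eq: "S' = \<rho> -` S" unfolding S'_def by (auto simp: image_iff) (metis \<rho>)
  define R where "R = \<rho>i \<circ> T \<circ> \<rho>"
  define R' where "R' = (\<lambda>z. \<rho>i \<circ> T' (\<rho> z) \<circ> \<rho>)"
  have TS': "R ` S' = \<rho> -` (T ` S)"
    unfolding S'_def R_def by (auto simp: image_iff) (metis \<rho>)+
  have det: "det (matrix (R' z)) = det (matrix (T' (\<rho> z)))" for z
  proof -
    have "matrix (R' z) = (\<chi> i j. matrix (T' (\<rho> z)) $ Rep_enumerated i $ Rep_enumerated j)"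
    proof -
      have ax: "\<rho> (axis j 1) = axis (Rep_enumerated j) 1" for j
        by (auto simp: \<rho>_def axis_def vec_eq_iff inv)
      show ?thesis
        by (simp add: matrix_def R'_def \<rho>i_def ax)
    qed
    then show ?thesis using det_reindex[OF bij] by metis
  qed
  have ind: "indicator S' z = (indicator S (\<rho> z) :: real)" "indicator (R ` S') z = (indicator (T ` S) (\<rho> z) :: real)" for z
    unfolding TS' unfolding S'_eq by (simp_all add: indicator_def)
  have R\<rho>: "\<rho> (R z) = T (\<rho> z)" for z by (simp add: R_def)
  have *: "(\<integral>\<^sup>+x. ennreal (indicator S' x * (\<bar>det (matrix (R' x))\<bar> * u (\<rho> (R x)))) \<partial>lborel) =
    (\<integral>\<^sup>+y. ennreal (indicator (R ` S') y * u (\<rho> y)) \<partial>lborel)"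
  proof (rule nn_integral_change_of_variables_wellorder)
    show "S' \<in> sets borel" using measurable_sets_borel[of \<rho> borel S] S by (simp add: S'_eq)
    show "(R has_derivative R' x) (at x within S')" if "x \<in> S'" for x
    proof -
      have "(T has_derivative T' (\<rho> x)) (at (\<rho> x) within \<rho> ` S')"
        using der[of "\<rho> x"] that by (auto simp: S'_def image_image)
      then have "(T \<circ> \<rho> has_derivative T' (\<rho> x) \<circ> \<rho>) (at x within S')"
        by (rule diff_chain_within[OF bounded_linear_imp_has_derivative[OF bl(1)]])
      then have "(\<rho>i \<circ> (T \<circ> \<rho>) has_derivative \<rho>i \<circ> (T' (\<rho> x) \<circ> \<rho>)) (at x within S')"
        by (rule diff_chain_within[OF _ bounded_linear_imp_has_derivative[OF bl(2)]])
      then show ?thesis by (simp add: R_def R'_def o_assoc)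
    qed
    show "inj_on R S'"
      using inj unfolding R_def S'_def inj_on_def by (auto simp: image_iff) (metis \<rho>)
    show "0 \<le> u (\<rho> y)" if "y \<in> R ` S'" for y using that u by (auto simp: TS')
    show "(\<lambda>x. indicator S' x * (\<bar>det (matrix (R' x))\<bar> * u (\<rho> (R x)))) \<in> borel_measurable borel"
      unfolding ind det R\<rho> using measurable_compose[OF _ m1, of \<rho>] by simp
    show "(\<lambda>x. indicator (R ` S') x * u (\<rho> x)) \<in> borel_measurable borel"
      unfolding ind using measurable_compose[OF _ m2, of \<rho>] by simp
  qed
  show ?thesis
    using * unfolding ind det R\<rho>
    unfolding distr[symmetric] using m1 m2 by (simp add: nn_integral_distr)
qed

section \<open>Tensor fields on an oriented closed manifold\<close>

locale closed_oriented_manifold =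
  fixes A :: "('a::{t2_space, second_countable_topology}, 'n::finite) chart set"
  assumes atlas: "smooth_atlas A"
    and oriented: "oriented_atlas A"
    and compact_UNIV: "compact (UNIV :: 'a set)"
begin

lemma chart_at: "chart_at A x \<in> A" "x \<in> chart_dom (chart_at A x)"
proof -
  have "\<exists>c. c \<in> A \<and> x \<in> chart_dom c"
    using atlas unfolding smooth_atlas_def by blast
  then have "chart_at A x \<in> A \<and> x \<in> chart_dom (chart_at A x)"
    unfolding chart_at_def by (rule someI_ex)
  then show "chart_at A x \<in> A" "x \<in> chart_dom (chart_at A x)" by auto
qed

lemma
  assumes "c \<in> A"
  shows open_dom: "open (chart_dom c)"
    and open_img: "open (chart_img c)"
    and homeo: "homeomorphism (chart_dom c) (chart_img c) (coord c) (param c)"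
  using assms atlas unfolding smooth_atlas_def by auto

lemma
  assumes "c \<in> A"
  shows coord_continuous: "continuous_on (chart_dom c) (coord c)"
    and param_continuous: "continuous_on (chart_img c) (param c)"
    and param_coord: "x \<in> chart_dom c \<Longrightarrow> param c (coord c x) = x"
    and coord_param: "y \<in> chart_img c \<Longrightarrow> coord c (param c y) = y"
    and param_in_dom: "y \<in> chart_img c \<Longrightarrow> param c y \<in> chart_dom c"
  using homeo[OF assms] unfolding homeomorphism_def by auto

lemma coord_image_eq:
  assumes "c \<in> A" "E \<subseteq> chart_dom c"
  shows "coord c ` E = {y \<in> chart_img c. param c y \<in> E}"
  using assms param_coord[OF assms(1)] coord_param[OF assms(1)] by (force simp: image_iff)

lemma transition_coord:
  assumes "c \<in> A" "x \<in> chart_dom c"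
  shows "transition c d (coord c x) = coord d x"
  using assms by (simp add: transition_def param_coord)

lemma transition_has_derivative:
  assumes c: "c \<in> A" and d: "d \<in> A" and x: "x \<in> chart_dom c \<inter> chart_dom d"
  shows "(transition c d has_derivative frechet_derivative (transition c d) (at (coord c x))) (at (coord c x))"
proof -
  have "smooth_on (coord c ` (chart_dom c \<inter> chart_dom d)) (transition c d)"
    using atlas c d unfolding smooth_atlas_def by blast
  then have "partials [] (transition c d) differentiable (at (coord c x))"
    unfolding smooth_on_def using x by blast
  then show ?thesis by (simp add: frechet_derivative_works)
qed

lemma jacobian_det_pos:
  assumes "c \<in> A" "d \<in> A" "x \<in> chart_dom c \<inter> chart_dom d"
  shows "det (jacobian c d x) > 0"
  using oriented assms unfolding oriented_atlas_def by blast

lemma jacobian_invertible: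
  assumes "c \<in> A" "d \<in> A" "x \<in> chart_dom c \<inter> chart_dom d"
  shows "invertible (jacobian c d x)"
  using jacobian_det_pos[OF assms] invertible_det_nz by fastforce

lemma smooth_sym_tensors_sym:
  "h \<in> smooth_sym_tensors A \<Longrightarrow> sym_tensor_field A h"
  by (simp add: smooth_sym_tensors_def)

lemma metrics_smooth: "h \<in> metrics A \<Longrightarrow> h \<in> smooth_sym_tensors A"
  by (simp add: metrics_def)

lemma metrics_sym: "h \<in> metrics A \<Longrightarrow> sym_tensor_field A h"
  by (simp add: metrics_def smooth_sym_tensors_def)

lemma tensor_symmetric:
  "sym_tensor_field A h \<Longrightarrow> c \<in> A \<Longrightarrow> x \<in> chart_dom c \<Longrightarrow> transpose (h c x) = h c x"
  unfolding sym_tensor_field_def by blast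

lemma tensor_transform:
  "sym_tensor_field A h \<Longrightarrow> c \<in> A \<Longrightarrow> d \<in> A \<Longrightarrow> x \<in> chart_dom c \<inter> chart_dom d \<Longrightarrow>
    h c x = transpose (jacobian c d x) ** h d x ** jacobian c d x"
  unfolding sym_tensor_field_def by (elim conjE) (drule bspec, assumption, drule bspec, assumption, drule bspec, assumption, assumption)

lemma tensor_outside:
  "sym_tensor_field A h \<Longrightarrow> x \<notin> chart_dom c \<Longrightarrow> h c x = 0"
  unfolding sym_tensor_field_def by blast

lemma metrics_pos_def:
  "h \<in> metrics A \<Longrightarrow> c \<in> A \<Longrightarrow> x \<in> chart_dom c \<Longrightarrow> pos_def (h c x)"
  by (auto simp: metrics_def smooth_sym_tensors_def pos_def_def pos_def_at_def tensor_symmetric)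

lemma coord_rep_continuous:
  assumes "h \<in> smooth_sym_tensors A" "c \<in> A"
  shows "continuous_on (chart_img c) (coord_rep c h)"
proof (rule continuous_at_imp_continuous_on, rule ballI)
  fix y assume "y \<in> chart_img c"
  then have "partials [] (coord_rep c h) differentiable (at y)"
    using assms unfolding smooth_sym_tensors_def smooth_on_def by blast
  then show "isCont (coord_rep c h) y" using differentiable_imp_continuous_within by auto
qed

lemma tensor_continuous:
  assumes "h \<in> smooth_sym_tensors A" "c \<in> A"
  shows "continuous_on (chart_dom c) (h c)"
proof -
  have "continuous_on (chart_dom c) (coord_rep c h \<circ> coord c)"
    by (intro continuous_on_compose coord_continuous coord_rep_continuous assms)
  then show ?thesis
    by (rule continuous_on_eq) (simp add: coord_rep_def param_coord[OF assms(2)])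
qed

text \<open>Frees the definition from the chart selected by \<open>chart_at\<close>: the Jacobian
  conjugates both quotients and drops out of the trace by cyclicity.\<close>

lemma pointwise_inner_chart:
  assumes g: "g \<in> metrics A" and h: "sym_tensor_field A h" and k: "sym_tensor_field A k"
    and c: "c \<in> A" "x \<in> chart_dom c"
  shows "pointwise_inner A g h k x = trace (matrix_inv (g c x) ** h c x ** matrix_inv (g c x) ** k c x)"
proof -
  define d where "d = chart_at A x"
  define J where "J = jacobian d c x"
  have d: "d \<in> A" "x \<in> chart_dom d" using chart_at by (auto simp: d_def)
  have J: "invertible J" unfolding J_def using c d by (intro jacobian_invertible) auto
  have G: "invertible (g c x)" using metrics_pos_def[OF g c] by (rule pos_def_invertible)
  have t: "f d x = transpose J ** f c x ** J" if "sym_tensor_field A f" for f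
    unfolding J_def using that c d by (intro tensor_transform) auto
  define X where "X = matrix_inv (g c x) ** h c x"
  define Y where "Y = matrix_inv (g c x) ** k c x"
  have "pointwise_inner A g h k x = trace ((matrix_inv (g d x) ** h d x) ** (matrix_inv (g d x) ** k d x))"
    by (simp add: pointwise_inner_def d_def[symmetric] matrix_mul_assoc)
  also have "\<dots> = trace ((matrix_inv J ** X ** J) ** (matrix_inv J ** Y ** J))"
    by (simp only: t[OF metrics_sym[OF g]] t[OF h] t[OF k] congruence_quotient[OF J G] X_def Y_def)
  also have "\<dots> = trace (matrix_inv J ** (X ** (J ** matrix_inv J) ** Y ** J))"
    by (simp only: matrix_mul_assoc)
  also have "\<dots> = trace ((X ** Y) ** (J ** matrix_inv J))"
    by (subst trace_mul_sym) (simp only: matrix_inv_right[OF J] matrix_mul_assoc[symmetric] matrix_mul_rid)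
  finally show ?thesis by (simp only: matrix_inv_right[OF J] matrix_mul_rid X_def Y_def matrix_mul_assoc)
qed

text \<open>In another chart both determinants acquire the same factor, the squared determinant of
  the Jacobian.\<close>

lemma rel_det_chart:
  assumes g: "g \<in> metrics A" and h: "sym_tensor_field A h" and c: "c \<in> A" "x \<in> chart_dom c"
  shows "rel_det A g h x = det (h c x) / det (g c x)"
proof -
  define d where "d = chart_at A x"
  define J where "J = jacobian d c x"
  have d: "d \<in> A" "x \<in> chart_dom d" using chart_at by (auto simp: d_def)
  have J: "det J \<noteq> 0" unfolding J_def using c d jacobian_det_pos[of d c x] by auto
  have G: "det (g d x) > 0" using metrics_pos_def[OF g d] by (rule pos_def_det_pos)
  have t: "det (f d x) = (det J)\<^sup>2 * det (f c x)" if "sym_tensor_field A f" for f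
    using tensor_transform[OF that d(1) c(1), of x] c d by (simp add: det_mul J_def power2_eq_square)
  have "det (matrix_inv (g d x)) * det (g d x) = 1"
    using matrix_inv_left[of "g d x"] G by (metis det_I det_mul invertible_det_nz less_irrefl)
  then have "det (matrix_inv (g d x)) = 1 / det (g d x)" using G by (simp add: field_simps)
  then have "rel_det A g h x = det (h d x) / det (g d x)"
    by (simp add: rel_det_def d_def[symmetric] det_mul)
  then show ?thesis using t[OF h] t[OF metrics_sym[OF g]] J by simp
qed

lemma rel_det_pos:
  assumes "g \<in> metrics A" "h \<in> metrics A"
  shows "rel_det A g h x > 0"
  using rel_det_chart[OF assms(1) metrics_sym[OF assms(2)] chart_at, of x]
    pos_def_det_pos[OF metrics_pos_def[OF assms(1) chart_at]]
    pos_def_det_pos[OF metrics_pos_def[OF assms(2) chart_at]] by simp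

lemma pointwise_inner_nonneg:
  assumes "g \<in> metrics A" "sym_tensor_field A h"
  shows "pointwise_inner A g h h x \<ge> 0"
  using trace_inner_nonneg[OF metrics_pos_def[OF assms(1) chart_at] tensor_symmetric[OF assms(2) chart_at]]
  by (simp add: pointwise_inner_def Let_def)

text \<open>Chart domains are open, so around a point the neighbourhoods within
  \<open>T \<times> chart_dom c\<close> and within \<open>T \<times> UNIV\<close> agree, for an
  arbitrary time set \<open>T\<close>.\<close>

lemma continuous_on_charts:
  fixes f :: "'t::topological_space \<Rightarrow> 'a \<Rightarrow> 'b::topological_space"
  assumes "\<And>c. c \<in> A \<Longrightarrow> continuous_on (T \<times> chart_dom c) (\<lambda>(t, x). f t x)"
  shows "continuous_on (T \<times> UNIV) (\<lambda>(t, x). f t x)"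
  unfolding continuous_on_def
proof
  fix p assume p: "p \<in> T \<times> (UNIV :: 'a set)"
  obtain t x where tx: "p = (t, x)" by fastforce
  define c where "c = chart_at A x"
  have c: "c \<in> A" "x \<in> chart_dom c" using chart_at by (auto simp: c_def)
  have "((\<lambda>(t, x). f t x) \<longlongrightarrow> (\<lambda>(t, x). f t x) p) (at p within T \<times> chart_dom c)"
    using assms[OF c(1)] c p tx unfolding continuous_on_def by auto
  moreover have "at p within T \<times> chart_dom c = at p within T \<times> UNIV"
    using c open_Times[OF open_UNIV open_dom[OF c(1)]] tx
    by (intro at_within_nhd[of p "UNIV \<times> chart_dom c"]) auto
  ultimately show "((\<lambda>(t, x). f t x) \<longlongrightarrow> (\<lambda>(t, x). f t x) p) (at p within T \<times> UNIV)"
    by simp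
qed

lemma rel_det_continuous:
  assumes "g \<in> metrics A" "h \<in> smooth_sym_tensors A"
  shows "continuous_on UNIV (rel_det A g h)"
proof -
  have "continuous_on (chart_dom c) (rel_det A g h)" if c: "c \<in> A" for c
  proof -
    have "continuous_on (chart_dom c) (\<lambda>x. det (h c x) / det (g c x))"
      using pos_def_det_pos[OF metrics_pos_def[OF assms(1) c]]
      by (intro continuous_intros tensor_continuous metrics_smooth assms c) fastforce
    then show ?thesis
      by (rule continuous_on_eq) (rule rel_det_chart[OF assms(1) smooth_sym_tensors_sym[OF assms(2)] c, symmetric])
  qed
  then have "continuous_on (\<Union>c\<in>A. chart_dom c) (rel_det A g h)"
    by (intro continuous_on_open_UN open_dom)
  then show ?thesis using atlas by (simp add: smooth_atlas_def)
qed

section \<open>The volume measure\<close>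

text \<open>The value \<open>undefined\<close> off the image of the chart makes the map Borel
  measurable on the whole space; the density vanishes there, so no mass is sent to that
  value.\<close>

definition chart_measure :: "('a, 'n) chart \<Rightarrow> ('a, 'n) tensor_field \<Rightarrow> 'a measure"
  where "chart_measure c h =
    distr (density lborel (\<lambda>y. ennreal (indicator (chart_img c) y * sqrt (det (coord_rep c h y))))) borel
      (\<lambda>y. if y \<in> chart_img c then param c y else undefined)"

lemma borel_measurable_param:
  assumes c: "c \<in> A"
  shows "(\<lambda>y. if y \<in> chart_img c then param c y else undefined) \<in> borel \<rightarrow>\<^sub>M borel"
  using open_img[OF c] by (intro borel_measurable_continuous_on_if param_continuous c continuous_intros) auto

lemma coord_image_borel:
  assumes c: "c \<in> A" and E: "E \<in> sets borel" "E \<subseteq> chart_dom c"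
  shows "coord c ` E \<in> sets borel"
proof -
  have "coord c ` E = chart_img c \<inter> (\<lambda>y. if y \<in> chart_img c then param c y else undefined) -` E"
    using coord_image_eq[OF c E(2)] by auto
  then show ?thesis
    using measurable_sets_borel[OF borel_measurable_param[OF c] E(1)] open_img[OF c] by auto
qed

lemma sqrt_det_measurable:
  assumes h: "h \<in> metrics A" and c: "c \<in> A" and S: "S \<in> sets borel" "S \<subseteq> chart_img c"
  shows "(\<lambda>y. indicator S y * sqrt (det (coord_rep c h y))) \<in> borel_measurable borel"
proof -
  have "continuous_on S (\<lambda>y. sqrt (det (coord_rep c h y)))"
    by (intro continuous_intros continuous_on_subset[OF coord_rep_continuous S(2)] metrics_smooth h c)
  then have "(\<lambda>y. indicator S y *\<^sub>R sqrt (det (coord_rep c h y))) \<in> borel_measurable borel"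
    using S(1) by (intro borel_measurable_continuous_on_indicator)
  then show ?thesis by simp
qed

lemma nn_integral_chart_measure:
  assumes h: "h \<in> metrics A" and c: "c \<in> A" and u: "u \<in> borel_measurable borel"
  shows "(\<integral>\<^sup>+x. u x \<partial>chart_measure c h) =
    (\<integral>\<^sup>+y. ennreal (indicator (chart_img c) y * sqrt (det (coord_rep c h y))) * u (param c y) \<partial>lborel)"
proof -
  note [measurable] = borel_measurable_param[OF c] u sqrt_det_measurable[OF h c borel_open[OF open_img[OF c]] order_refl]
  have "(\<integral>\<^sup>+x. u x \<partial>chart_measure c h) =
    (\<integral>\<^sup>+y. ennreal (indicator (chart_img c) y * sqrt (det (coord_rep c h y))) *
       u (if y \<in> chart_img c then param c y else undefined) \<partial>lborel)"
    unfolding chart_measure_def by (subst nn_integral_distr; (subst nn_integral_density)?; measurable)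
  also have "\<dots> = (\<integral>\<^sup>+y. ennreal (indicator (chart_img c) y * sqrt (det (coord_rep c h y))) * u (param c y) \<partial>lborel)"
    by (intro nn_integral_cong) (auto simp: indicator_def)
  finally show ?thesis .
qed

lemma sets_chart_measure [simp]: "sets (chart_measure c h) = sets borel" "space (chart_measure c h) = UNIV"
  by (simp_all add: chart_measure_def)

lemma emeasure_chart_measure:
  assumes h: "h \<in> metrics A" and c: "c \<in> A" and E: "E \<in> sets borel" "E \<subseteq> chart_dom c"
  shows "emeasure (chart_measure c h) E = (\<integral>\<^sup>+y. ennreal (indicator (coord c ` E) y * sqrt (det (coord_rep c h y))) \<partial>lborel)"
proof -
  have "emeasure (chart_measure c h) E = (\<integral>\<^sup>+x. indicator E x \<partial>chart_measure c h)"
    using E by simp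
  also have "\<dots> = (\<integral>\<^sup>+y. ennreal (indicator (chart_img c) y * sqrt (det (coord_rep c h y))) * indicator E (param c y) \<partial>lborel)"
    using E by (intro nn_integral_chart_measure h c) auto
  also have "\<dots> = (\<integral>\<^sup>+y. ennreal (indicator (coord c ` E) y * sqrt (det (coord_rep c h y))) \<partial>lborel)"
    unfolding coord_image_eq[OF c E(2)] by (intro nn_integral_cong) (auto simp: indicator_def)
  finally show ?thesis .
qed

lemma is_volume_measure_iff:
  assumes h: "h \<in> metrics A"
  shows "is_volume_measure A h \<mu> \<longleftrightarrow> sets \<mu> = sets borel \<and>
    (\<forall>c\<in>A. \<forall>E\<in>sets borel. E \<subseteq> chart_dom c \<longrightarrow> emeasure \<mu> E = emeasure (chart_measure c h) E)"
proof -
  have "(\<integral>\<^sup>+y\<in>coord c ` E. ennreal (sqrt (det (coord_rep c h y))) \<partial>lborel) = emeasure (chart_measure c h) E"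
    if "c \<in> A" "E \<in> sets borel" "E \<subseteq> chart_dom c" for c E
    unfolding emeasure_chart_measure[OF h that]
    by (intro nn_integral_cong) (auto simp: indicator_def)
  then show ?thesis unfolding is_volume_measure_def by auto
qed

text \<open>Change of variables along the transition map: det h acquires the squared Jacobian
  determinant, so its root acquires exactly the absolute value that the formula demands.\<close>

lemma chart_measure_overlap:
  assumes h: "h \<in> metrics A" and c: "c \<in> A" and d: "d \<in> A"
    and E: "E \<in> sets borel" "E \<subseteq> chart_dom c \<inter> chart_dom d"
  shows "emeasure (chart_measure c h) E = emeasure (chart_measure d h) E"
proof -
  define S where "S = coord c ` E"
  define u where "u = (\<lambda>y. sqrt (det (coord_rep d h y)))"
  define T' where "T' = (\<lambda>y. frechet_derivative (transition c d) (at y))"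
  have TS: "transition c d ` S = coord d ` E"
    using E(2) by (force simp: S_def image_image transition_coord[OF c] intro!: image_cong)
  have S: "S \<in> sets borel" "S \<subseteq> chart_img c" "coord d ` E \<in> sets borel" "coord d ` E \<subseteq> chart_img d"
    using coord_image_borel[OF c E(1)] coord_image_borel[OF d E(1)] E(2) by (auto simp: S_def)
  have eq: "indicator S y * (\<bar>det (matrix (T' y))\<bar> * u (transition c d y)) =
      indicator S y * sqrt (det (coord_rep c h y))" for y
  proof (cases "y \<in> S")
    case True
    then obtain x where x: "x \<in> E" "y = coord c x" by (auto simp: S_def)
    then have xcd: "x \<in> chart_dom c \<inter> chart_dom d" using E(2) by auto
    have "h c x = transpose (jacobian c d x) ** h d x ** jacobian c d x"
      using tensor_transform[OF metrics_sym[OF h] c d xcd] .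
    then have "det (h c x) = (det (jacobian c d x))\<^sup>2 * det (h d x)"
      by (simp add: det_mul power2_eq_square)
    moreover have "matrix (T' y) = jacobian c d x"
      by (simp add: T'_def jacobian_def x)
    ultimately show ?thesis
      using xcd by (simp add: u_def x transition_coord[OF c] coord_rep_def param_coord c d real_sqrt_mult)
  qed simp
  have "emeasure (chart_measure c h) E = (\<integral>\<^sup>+y. ennreal (indicator S y * (\<bar>det (matrix (T' y))\<bar> * u (transition c d y))) \<partial>lborel)"
    unfolding eq unfolding S_def using E by (intro emeasure_chart_measure h c) auto
  also have "\<dots> = (\<integral>\<^sup>+y. ennreal (indicator (transition c d ` S) y * u y) \<partial>lborel)"
  proof (rule nn_integral_change_of_variables)
    show "(transition c d has_derivative T' y) (at y within S)" if "y \<in> S" for y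
    proof -
      obtain x where x: "x \<in> E" "y = coord c x" using \<open>y \<in> S\<close> by (auto simp: S_def)
      then have "x \<in> chart_dom c \<inter> chart_dom d" using E(2) by blast
      then show ?thesis
        unfolding T'_def x(2) by (rule has_derivative_at_withinI[OF transition_has_derivative[OF c d]])
    qed
    show "inj_on (transition c d) S"
    proof (rule inj_onI)
      fix y z assume "y \<in> S" "z \<in> S" and eq: "transition c d y = transition c d z"
      then obtain p q where pq: "p \<in> E" "y = coord c p" "q \<in> E" "z = coord c q" by (auto simp: S_def)
      then have dom: "p \<in> chart_dom c" "q \<in> chart_dom c" "p \<in> chart_dom d" "q \<in> chart_dom d"
        using E(2) by auto
      then have "coord d p = coord d q"
        using eq pq transition_coord[OF c, of p d] transition_coord[OF c, of q d] by auto
      then have "p = q" using dom(3,4) param_coord[OF d] by metis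
      then show "y = z" by (simp only: pq)
    qed
    show "0 \<le> u y" if "y \<in> transition c d ` S" for y
      using that E(2) pos_def_det_pos[OF metrics_pos_def[OF h d]]
      by (auto simp: TS u_def coord_rep_def param_coord[OF d] subset_iff intro!: less_imp_le)
    show "(\<lambda>y. indicator S y * (\<bar>det (matrix (T' y))\<bar> * u (transition c d y))) \<in> borel_measurable borel"
      unfolding eq by (rule sqrt_det_measurable[OF h c S(1,2)])
    show "(\<lambda>y. indicator (transition c d ` S) y * u y) \<in> borel_measurable borel"
      unfolding TS u_def by (rule sqrt_det_measurable[OF h d S(3,4)])
  qed (rule S)
  also have "\<dots> = emeasure (chart_measure d h) E"
    unfolding TS u_def using E by (intro emeasure_chart_measure[symmetric] h d) auto
  finally show ?thesis .
qed

text \<open>By compactness finitely many charts suffice. They are enumerated by \<open>nat\<close>,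
  with repetitions, to fit countable additivity; making the domains disjoint leaves empty pieces for
  the repeated charts.\<close>

lemma chart_partition:
  obtains cs :: "nat \<Rightarrow> ('a, 'n) chart" and D :: "nat \<Rightarrow> 'a set"
  where "\<And>i. cs i \<in> A" "\<And>i. D i \<in> sets borel" "\<And>i. D i \<subseteq> chart_dom (cs i)"
    "disjoint_family D" "(\<Union>i. D i) = UNIV"
proof -
  have "UNIV \<subseteq> (\<Union>c\<in>A. chart_dom c)" using atlas by (simp add: smooth_atlas_def)
  then obtain C where C: "C \<subseteq> A" "finite C" "UNIV \<subseteq> (\<Union>c\<in>C. chart_dom c)"
    using compactE_image[OF compact_UNIV, of A chart_dom] open_dom by metis
  then have ne: "C \<noteq> {}" by auto
  define cs where "cs = from_nat_into C"
  have cs: "range cs = C" unfolding cs_def using C ne by (intro range_from_nat_into countable_finite)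
  define D where "D = disjointed (\<lambda>i. chart_dom (cs i))"
  show thesis
  proof
    show csA: "cs i \<in> A" for i using cs C by blast
    have "chart_dom (cs i) \<in> sets borel" for i by (intro borel_open open_dom csA)
    then have "range D \<subseteq> sets borel"
      unfolding D_def by (intro sets.range_disjointed_sets) auto
    then show "D i \<in> sets borel" for i by auto
    show "D i \<subseteq> chart_dom (cs i)" for i unfolding D_def by (rule disjointed_subset)
    show "disjoint_family D" unfolding D_def by (rule disjoint_family_disjointed)
    show "(\<Union>i. D i) = UNIV" unfolding D_def UN_disjointed_eq using C(3) cs by auto
  qed
qed

text \<open>The chart measures are glued along the partition, each piece measured in its own chart;
  agreement on overlaps gives the right value in every other chart.\<close>

lemma volume_measure_exists:
  assumes h: "h \<in> metrics A"
  shows "\<exists>\<mu>. is_volume_measure A h \<mu>"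
proof -
  obtain cs :: "nat \<Rightarrow> ('a, 'n) chart" and D :: "nat \<Rightarrow> 'a set" where
    cs: "\<And>i. cs i \<in> A" and D: "\<And>i. D i \<in> sets borel" "\<And>i. D i \<subseteq> chart_dom (cs i)"
    "disjoint_family D" "(\<Union>i. D i) = UNIV"
    by (rule chart_partition) blast
  define F where "F E = (\<Sum>i. emeasure (chart_measure (cs i) h) (E \<inter> D i))" for E
  define \<mu> where "\<mu> = measure_of (UNIV :: 'a set) (sets borel) F"
  have sets: "sets \<mu> = sets borel"
    unfolding \<mu>_def by (metis sets.sets_measure_of_eq space_borel)
  have F: "emeasure \<mu> E = F E" if E: "E \<in> sets borel" for E
  proof (rule emeasure_measure_of[OF \<mu>_def])
    show "positive (sets \<mu>) F" by (simp add: positive_def F_def)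
    show "countably_additive (sets \<mu>) F"
    proof (rule countably_additiveI)
      fix B :: "nat \<Rightarrow> 'a set"
      assume B: "range B \<subseteq> sets \<mu>" "disjoint_family B"
      have *: "(\<Sum>j. emeasure (chart_measure (cs i) h) (B j \<inter> D i)) = emeasure (chart_measure (cs i) h) ((\<Union>j. B j) \<inter> D i)" for i
        using B D sets unfolding Int_UN_distrib2 image_image
        by (subst suminf_emeasure) (auto simp: disjoint_family_on_def)
      \<comment> \<open>One of the two sums is read as an integral over counting measure, so that
        exchanging them is monotone convergence.\<close>
      have "(\<Sum>j. F (B j)) = (\<integral>\<^sup>+j. (\<Sum>i. emeasure (chart_measure (cs i) h) (B j \<inter> D i)) \<partial>count_space UNIV)"
        by (simp add: F_def nn_integral_count_space_nat)
      also have "\<dots> = (\<Sum>i. \<integral>\<^sup>+j. emeasure (chart_measure (cs i) h) (B j \<inter> D i) \<partial>count_space UNIV)"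
        by (rule nn_integral_suminf) simp
      finally show "(\<Sum>j. F (B j)) = F (\<Union>j. B j)"
        by (simp add: F_def nn_integral_count_space_nat *)
    qed
  qed (use E sets in auto)
  have "emeasure \<mu> E = emeasure (chart_measure c h) E" if c: "c \<in> A" and E: "E \<in> sets borel" "E \<subseteq> chart_dom c" for c E
  proof -
    have "emeasure \<mu> E = (\<Sum>i. emeasure (chart_measure c h) (E \<inter> D i))"
      unfolding F[OF E(1)] F_def using E D cs c
      by (intro arg_cong[where f = suminf] ext chart_measure_overlap h) auto
    also have "\<dots> = emeasure (chart_measure c h) (\<Union>i. E \<inter> D i)"
      using E D(1) disjoint_family_on_bisimulation[OF D(3), of "\<lambda>i. E \<inter> D i"]
      by (intro suminf_emeasure) auto
    also have "(\<Union>i. E \<inter> D i) = E" using D(4) by auto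
    finally show ?thesis .
  qed
  then show ?thesis unfolding is_volume_measure_iff[OF h] using sets by blast
qed

lemma volume_measure_unique:
  assumes h: "h \<in> metrics A" and \<mu>: "is_volume_measure A h \<mu>" and \<nu>: "is_volume_measure A h \<nu>"
  shows "\<mu> = \<nu>"
proof (rule measure_eqI)
  obtain cs :: "nat \<Rightarrow> ('a, 'n) chart" and D :: "nat \<Rightarrow> 'a set" where
    cs: "\<And>i. cs i \<in> A" and D: "\<And>i. D i \<in> sets borel" "\<And>i. D i \<subseteq> chart_dom (cs i)"
    "disjoint_family D" "(\<Union>i. D i) = UNIV"
    by (rule chart_partition) blast
  show "sets \<mu> = sets \<nu>" using \<mu> \<nu> by (simp add: is_volume_measure_def)
  have *: "emeasure \<rho> E = (\<Sum>i. emeasure (chart_measure (cs i) h) (E \<inter> D i))"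
    if \<rho>: "is_volume_measure A h \<rho>" and E: "E \<in> sets borel" for \<rho> E
  proof -
    have "emeasure \<rho> E = emeasure \<rho> (\<Union>i. E \<inter> D i)" using D(4) by (simp flip: Int_UN_distrib)
    also have "\<dots> = (\<Sum>i. emeasure \<rho> (E \<inter> D i))"
      using E D(1) \<rho> disjoint_family_on_bisimulation[OF D(3), of "\<lambda>i. E \<inter> D i"]
      by (intro suminf_emeasure[symmetric]) (auto simp: is_volume_measure_def)
    also have "\<dots> = (\<Sum>i. emeasure (chart_measure (cs i) h) (E \<inter> D i))"
      using \<rho> E D cs unfolding is_volume_measure_iff[OF h]
      by (intro arg_cong[where f = suminf] ext) (auto simp: le_infI2)
    finally show ?thesis .
  qed
  fix E assume "E \<in> sets \<mu>"
  then show "emeasure \<mu> E = emeasure \<nu> E"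
    using *[OF \<mu>] *[OF \<nu>] \<mu> by (simp add: is_volume_measure_def)
qed

lemma is_volume_measure_volume_measure:
  assumes h: "h \<in> metrics A"
  shows "is_volume_measure A h (volume_measure A h)"
  unfolding volume_measure_def
  using volume_measure_exists[OF h] volume_measure_unique[OF h] by (metis theI)

lemma
  assumes "h \<in> metrics A"
  shows sets_volume_measure: "sets (volume_measure A h) = sets borel"
    and space_volume_measure: "space (volume_measure A h) = UNIV"
    and emeasure_volume_measure: "c \<in> A \<Longrightarrow> E \<in> sets borel \<Longrightarrow> E \<subseteq> chart_dom c \<Longrightarrow>
      emeasure (volume_measure A h) E = emeasure (chart_measure c h) E"
proof -
  show s: "sets (volume_measure A h) = sets borel"
    using is_volume_measure_volume_measure[OF assms] by (simp add: is_volume_measure_def)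
  show "space (volume_measure A h) = UNIV" using sets_eq_imp_space_eq[OF s] by simp
  show "c \<in> A \<Longrightarrow> E \<in> sets borel \<Longrightarrow> E \<subseteq> chart_dom c \<Longrightarrow>
      emeasure (volume_measure A h) E = emeasure (chart_measure c h) E"
    using is_volume_measure_volume_measure[OF assms] unfolding is_volume_measure_iff[OF assms] by blast
qed

text \<open>The density has the values in charts that characterise the volume measure of
  \<open>h\<close>, since sqrt(det g) sqrt(det h / det g) = sqrt(det h). All metrics along a path
  can thus be compared over the single measure of \<open>g\<close>.\<close>

lemma volume_measure_density:
  assumes g: "g \<in> metrics A" and h: "h \<in> metrics A"
  shows "volume_measure A h = density (volume_measure A g) (\<lambda>x. ennreal (sqrt (rel_det A g h x)))"
proof (rule volume_measure_unique[OF h is_volume_measure_volume_measure[OF h]])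
  let ?\<mu> = "volume_measure A g"
  define r where "r = (\<lambda>x. ennreal (sqrt (rel_det A g h x)))"
  have r: "r \<in> borel_measurable borel"
    unfolding r_def
    by (intro measurable_compose[OF _ measurable_ennreal] borel_measurable_continuous_onI
        continuous_intros rel_det_continuous g metrics_smooth h)
  have "emeasure (density ?\<mu> r) E = emeasure (chart_measure c h) E"
    if c: "c \<in> A" and E: "E \<in> sets borel" "E \<subseteq> chart_dom c" for c E
  proof -
    \<comment> \<open>The volume and the chart measure agree only inside the chart; restricted to
      \<open>E\<close> they are equal as measures, so integrals of \<open>r\<close> over
      \<open>E\<close> agree too.\<close>
    have "density ?\<mu> (indicator E) = density (chart_measure c g) (indicator E)"
    proof (rule measure_eqI)
      fix B assume "B \<in> sets (density ?\<mu> (indicator E))"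
      then have B: "B \<in> sets borel" by (simp add: sets_volume_measure[OF g])
      then have "emeasure ?\<mu> (E \<inter> B) = emeasure (chart_measure c g) (E \<inter> B)"
        using E by (intro emeasure_volume_measure g c) auto
      then show "emeasure (density ?\<mu> (indicator E)) B = emeasure (density (chart_measure c g) (indicator E)) B"
        using E B by (simp add: emeasure_restricted sets_volume_measure[OF g])
    qed (simp add: sets_volume_measure[OF g])
    then have eq: "(\<integral>\<^sup>+x. r x \<partial>density ?\<mu> (indicator E)) = (\<integral>\<^sup>+x. r x \<partial>density (chart_measure c g) (indicator E))"
      by simp
    have m: "E \<in> sets ?\<mu>" "r \<in> borel_measurable ?\<mu>" "r \<in> borel_measurable (chart_measure c g)"
      using r E by (auto simp: sets_volume_measure[OF g] cong: measurable_cong_sets)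
    have "emeasure (density ?\<mu> r) E = (\<integral>\<^sup>+x. indicator E x * r x \<partial>?\<mu>)"
      using m by (simp add: emeasure_density mult.commute)
    also have "\<dots> = (\<integral>\<^sup>+x. indicator E x * r x \<partial>chart_measure c g)"
      using eq E unfolding nn_integral_density[OF borel_measurable_indicator[OF m(1)] m(2)]
      by (subst (asm) nn_integral_density) (auto intro!: m(3) borel_measurable_indicator)
    also have "\<dots> = (\<integral>\<^sup>+y. ennreal (indicator (chart_img c) y * sqrt (det (coord_rep c g y))) *
        (indicator E (param c y) * r (param c y)) \<partial>lborel)"
      using r E by (intro nn_integral_chart_measure g c) auto
    also have "\<dots> = (\<integral>\<^sup>+y. ennreal (indicator (chart_img c) y * sqrt (det (coord_rep c h y))) *
        indicator E (param c y) \<partial>lborel)"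
    proof (intro nn_integral_cong)
      fix y
      have "sqrt (det (coord_rep c g y)) * sqrt (rel_det A g h (param c y)) = sqrt (det (coord_rep c h y))"
        if "y \<in> chart_img c"
        using rel_det_chart[OF g metrics_sym[OF h] c param_in_dom[OF c that]]
          pos_def_det_pos[OF metrics_pos_def[OF g c param_in_dom[OF c that]]]
        by (simp add: coord_rep_def flip: real_sqrt_mult)
      then show "ennreal (indicator (chart_img c) y * sqrt (det (coord_rep c g y))) * (indicator E (param c y) * r (param c y))
          = ennreal (indicator (chart_img c) y * sqrt (det (coord_rep c h y))) * indicator E (param c y)"
        using pos_def_det_pos[OF metrics_pos_def[OF g c param_in_dom[OF c, of y]]] rel_det_pos[OF g h, of "param c y"]
        by (auto simp: indicator_def r_def coord_rep_def simp flip: ennreal_mult)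
    qed
    also have "\<dots> = (\<integral>\<^sup>+x. indicator E x \<partial>chart_measure c h)"
      using E by (intro nn_integral_chart_measure[symmetric] h c) auto
    finally show ?thesis using E by simp
  qed
  then show "is_volume_measure A h (density ?\<mu> r)"
    unfolding is_volume_measure_iff[OF h] by (simp add: sets_volume_measure[OF g])
qed

text \<open>The density is bounded over a closed ball inside a chart image, so the volume is locally
  finite, and compactness does the rest.\<close>

lemma finite_volume_measure:
  assumes h: "h \<in> metrics A"
  shows "finite_measure (volume_measure A h)"
proof (rule finite_measureI)
  let ?\<mu> = "volume_measure A h"
  have "\<exists>U. open U \<and> x \<in> U \<and> emeasure ?\<mu> U < \<infinity>" for x
  proof -
    define c where "c = chart_at A x"
    have c: "c \<in> A" "x \<in> chart_dom c" using chart_at by (auto simp: c_def)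
    then obtain e where e: "e > 0" "cball (coord c x) e \<subseteq> chart_img c"
      using open_img[OF c(1)] open_contains_cball by blast
    define K where "K = cball (coord c x) e"
    define U where "U = chart_dom c \<inter> coord c -` ball (coord c x) e"
    have U: "open U" unfolding U_def
      using continuous_open_preimage[OF coord_continuous[OF c(1)] open_dom[OF c(1)]] by blast
    have xU: "x \<in> U" using c e by (simp add: U_def)
    have "continuous_on K (\<lambda>y. sqrt (det (coord_rep c h y)))"
      unfolding K_def
      by (intro continuous_intros continuous_on_subset[OF coord_rep_continuous e(2)] metrics_smooth h c)
    then have "bounded ((\<lambda>y. sqrt (det (coord_rep c h y))) ` K)"
      by (intro compact_imp_bounded compact_continuous_image) (auto simp: K_def)
    then obtain B where "\<forall>z\<in>(\<lambda>y. sqrt (det (coord_rep c h y))) ` K. norm z \<le> B"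
      by (auto simp: bounded_iff)
    then have B: "sqrt (det (coord_rep c h y)) \<le> B" if "y \<in> K" for y
      using that by fastforce
    have sub: "coord c ` U \<subseteq> K" by (auto simp: U_def K_def)
    have "emeasure ?\<mu> U = (\<integral>\<^sup>+y. ennreal (indicator (coord c ` U) y * sqrt (det (coord_rep c h y))) \<partial>lborel)"
      using U c by (subst emeasure_volume_measure[OF h c(1)], simp, simp add: U_def,
          subst emeasure_chart_measure[OF h c(1)]) (auto simp: U_def)
    also have "\<dots> \<le> (\<integral>\<^sup>+y. ennreal B * indicator K y \<partial>lborel)"
      using B sub by (intro nn_integral_mono) (auto simp: indicator_def intro!: ennreal_leI)
    also have "\<dots> = ennreal B * emeasure lborel K"
      by (intro nn_integral_cmult_indicator) (simp add: K_def)
    also have "\<dots> < \<infinity>"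
      using emeasure_bounded_finite[of K] by (simp add: K_def ennreal_mult_less_top)
    finally show ?thesis using U xU by blast
  qed
  then obtain U where U: "\<And>x. open (U x)" "\<And>x. x \<in> U x" "\<And>x. emeasure ?\<mu> (U x) < \<infinity>"
    by metis
  obtain C where C: "finite C" "UNIV \<subseteq> (\<Union>x\<in>C. U x)"
    using compactE_image[OF compact_UNIV, of UNIV U] U by (metis UNIV_I UN_iff subsetI)
  have "emeasure ?\<mu> UNIV \<le> emeasure ?\<mu> (\<Union>x\<in>C. U x)"
    using C U by (intro emeasure_mono) (auto simp: sets_volume_measure[OF h])
  also have "\<dots> \<le> (\<Sum>x\<in>C. emeasure ?\<mu> (U x))"
    using C U by (intro emeasure_subadditive_finite) (auto simp: sets_volume_measure[OF h])
  also have "\<dots> < \<infinity>" using U C by (simp add: ennreal_sum_less_top)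
  finally show "emeasure ?\<mu> (space ?\<mu>) \<noteq> \<infinity>" by (simp add: space_volume_measure[OF h])
qed

end

section \<open>The length of a path bounds an integral distance\<close>

text \<open>Tonelli's theorem in time and space, followed by the Cauchy-Schwarz inequality in space.\<close>

lemma integral_increment_bound:
  fixes f :: "real \<Rightarrow> 'a::{t2_space, second_countable_topology} \<Rightarrow> real" and w :: "'a \<Rightarrow> real"
  assumes "finite_measure M" and sets: "sets M = sets borel"
    and "compact (UNIV :: 'a set)"
    and cont: "continuous_on ({a..b} \<times> UNIV) (\<lambda>(t, x). f t x)"
    and f0: "\<And>t x. t \<in> {a..b} \<Longrightarrow> 0 \<le> f t x"
    and K: "K \<ge> 0" and w: "\<And>x. \<bar>w x\<bar> \<le> K * integral {a..b} (\<lambda>t. sqrt (f t x))"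
  shows "(\<lambda>t. sqrt (\<integral>x. f t x \<partial>M)) integrable_on {a..b}"
    and "(\<integral>\<^sup>+x. ennreal \<bar>w x\<bar> \<partial>M) \<le> ennreal (K * sqrt (measure M UNIV) * integral {a..b} (\<lambda>t. sqrt (\<integral>x. f t x \<partial>M)))"
proof -
  interpret finite_measure M by fact
  interpret pair_sigma_finite lborel M by unfold_locales
  have space: "space M = UNIV" using sets_eq_imp_space_eq[OF sets] by simp
  \<comment> \<open>Extension by zero in time makes \<open>F\<close> measurable on the full product,
    as Tonelli's theorem requires.\<close>
  define F where "F = (\<lambda>t x. indicator {a..b} t * f t x)"
  have F0: "0 \<le> F t x" for t x using f0 by (simp add: F_def indicator_def)
  have "(\<lambda>p. indicator ({a..b} \<times> UNIV) p *\<^sub>R (\<lambda>(t, x). f t x) p) \<in> borel_measurable borel"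
    by (intro borel_measurable_continuous_on_indicator cont borel_closed closed_Times closed_UNIV closed_atLeastAtMost)
  moreover have "(\<lambda>p. indicator ({a..b} \<times> UNIV) p *\<^sub>R (\<lambda>(t, x). f t x) p) = (\<lambda>(t, x). F t x)"
    by (auto simp: F_def indicator_def)
  ultimately have "(\<lambda>(t, x). F t x) \<in> borel_measurable (borel \<Otimes>\<^sub>M borel)"
    by (simp add: borel_prod)
  also have "borel_measurable (borel \<Otimes>\<^sub>M borel) = borel_measurable (lborel \<Otimes>\<^sub>M M)"
    by (intro measurable_cong_sets sets_pair_measure_cong) (simp_all add: sets)
  finally have Fm [measurable]: "(\<lambda>(t, x). F t x) \<in> borel_measurable (lborel \<Otimes>\<^sub>M M)" .
  have Fx [measurable]: "(\<lambda>x. F t x) \<in> borel_measurable M" for t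
    using measurable_compose[OF measurable_Pair1' Fm, of t] by simp
  have Ft [measurable]: "(\<lambda>t. F t x) \<in> borel_measurable borel" for x
    using measurable_compose[OF measurable_Pair2' Fm, of x] by (simp add: space)
  \<comment> \<open>Compactness of time times space bounds \<open>F\<close>; integrability of
    \<open>F t\<close> in space and of \<open>s\<close> in time follows from this bound.\<close>
  have "bounded ((\<lambda>(t, x). f t x) ` ({a..b} \<times> UNIV))"
    by (intro compact_imp_bounded compact_continuous_image cont compact_Times compact_Icc assms)
  then obtain B0 where B0: "\<And>t x. t \<in> {a..b} \<Longrightarrow> \<bar>f t x\<bar> \<le> B0"
    unfolding bounded_iff by force
  define B where "B = max B0 0"
  have FB: "F t x \<le> B" and B: "B \<ge> 0" for t x
    using B0[of t x] by (auto simp: F_def B_def indicator_def)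
  have int: "integrable M (\<lambda>x. F t x)" for t
  proof (rule integrable_const_bound[of _ B])
    show "AE x in M. norm (F t x) \<le> B" using F0 FB by simp
  qed simp
  define s where "s = (\<lambda>t. sqrt (\<integral>x. F t x \<partial>M))"
  have sm [measurable]: "s \<in> borel_measurable lborel" unfolding s_def by measurable
  have s_eq: "s t = indicator {a..b} t * sqrt (\<integral>x. f t x \<partial>M)" for t
    by (auto simp: s_def F_def indicator_def)
  have s0: "0 \<le> s t" for t unfolding s_def using F0 by simp
  have sB: "s t \<le> sqrt (B * measure M UNIV)" for t
  proof -
    have "(\<integral>x. F t x \<partial>M) \<le> (\<integral>x. B \<partial>M)"
      using FB by (intro integral_mono int) auto
    then show ?thesis by (simp add: s_def space mult.commute)
  qed
  have s_ind: "s t = indicator {a..b} t *\<^sub>R s t" for t by (simp add: s_eq indicator_def)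
  have si: "integrable lborel s"
    using sB s0 by (subst s_ind[abs_def], intro integrableI_bounded_set_indicator[where B = "sqrt (B * measure M UNIV)"])
      (auto simp: emeasure_lborel_Icc_eq)
  have "(s has_integral (\<integral>t. s t \<partial>lborel)) UNIV"
    by (rule has_integral_integral_lborel[OF si])
  then have hs: "((\<lambda>t. sqrt (\<integral>x. f t x \<partial>M)) has_integral (\<integral>t. s t \<partial>lborel)) {a..b}"
    unfolding has_integral_restrict_UNIV[symmetric, where s = "{a..b}"]
    by (rule has_integral_eq[rotated]) (simp add: s_eq indicator_def)
  then show "(\<lambda>t. sqrt (\<integral>x. f t x \<partial>M)) integrable_on {a..b}" by blast
  have wx: "ennreal \<bar>w x\<bar> \<le> ennreal K * (\<integral>\<^sup>+t. ennreal (sqrt (F t x)) \<partial>lborel)" for x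
  proof -
    have "continuous_on {a..b} (\<lambda>t. (\<lambda>(t, x). f t x) (t, x))"
      by (rule continuous_on_compose2[OF cont]) (auto intro!: continuous_intros)
    then have "(\<lambda>t. sqrt (f t x)) integrable_on {a..b}"
      by (intro integrable_continuous_real continuous_intros) simp
    then have "((\<lambda>t. sqrt (f t x)) has_integral integral {a..b} (\<lambda>t. sqrt (f t x))) {a..b}"
      by (rule integrable_integral)
    then have "((\<lambda>t. sqrt (F t x)) has_integral integral {a..b} (\<lambda>t. sqrt (f t x))) UNIV"
      unfolding has_integral_restrict_UNIV[symmetric, where s = "{a..b}"]
      by (rule has_integral_eq[rotated]) (simp add: F_def indicator_def)
    then have "(\<integral>\<^sup>+t. ennreal (sqrt (F t x)) \<partial>lborel) = ennreal (integral {a..b} (\<lambda>t. sqrt (f t x)))"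
      using F0 by (intro nn_integral_has_integral_lborel) auto
    then show ?thesis using w[of x] K by (simp add: ennreal_leI flip: ennreal_mult')
  qed
  \<comment> \<open>Cauchy-Schwarz against the constant function 1 produces the root of the total
    volume.\<close>
  have CS: "(\<integral>\<^sup>+x. ennreal (sqrt (F t x)) \<partial>M) \<le> ennreal (sqrt (measure M UNIV) * s t)" for t
  proof -
    have "(\<integral>\<^sup>+x. ennreal (sqrt (F t x)) * 1 \<partial>M)\<^sup>2 \<le> (\<integral>\<^sup>+x. (ennreal (sqrt (F t x)))\<^sup>2 \<partial>M) * (\<integral>\<^sup>+x. 1\<^sup>2 \<partial>M)"
      by (rule Cauchy_Schwarz_nn_integral) auto
    also have "(\<integral>\<^sup>+x. (ennreal (sqrt (F t x)))\<^sup>2 \<partial>M) = (\<integral>\<^sup>+x. ennreal (F t x) \<partial>M)"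
      using F0 by (simp add: ennreal_power)
    also have "\<dots> = ennreal (\<integral>x. F t x \<partial>M)"
      using F0 by (intro nn_integral_eq_integral int) auto
    also have "(\<integral>\<^sup>+x. 1\<^sup>2 \<partial>M) = ennreal (measure M UNIV)"
      using space by (simp add: emeasure_eq_measure)
    also have "ennreal (\<integral>x. F t x \<partial>M) * ennreal (measure M UNIV) = (ennreal (sqrt (measure M UNIV) * s t))\<^sup>2"
      using F0 s0[of t] by (simp add: s_def ennreal_power power_mult_distrib mult.commute flip: ennreal_mult)
    finally show ?thesis
      using s0[of t]
      by (cases "\<integral>\<^sup>+x. ennreal (sqrt (F t x)) \<partial>M" rule: ennreal_cases)
         (auto simp: ennreal_power ennreal_le_iff power_mono_iff top_unique intro!: ennreal_leI power2_le_imp_le)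
  qed
  have "(\<integral>\<^sup>+x. ennreal \<bar>w x\<bar> \<partial>M) \<le> (\<integral>\<^sup>+x. ennreal K * (\<integral>\<^sup>+t. ennreal (sqrt (F t x)) \<partial>lborel) \<partial>M)"
    by (intro nn_integral_mono wx)
  also have "\<dots> = ennreal K * (\<integral>\<^sup>+x. (\<integral>\<^sup>+t. ennreal (sqrt (F t x)) \<partial>lborel) \<partial>M)"
    by (intro nn_integral_cmult) measurable
  also have "(\<integral>\<^sup>+x. (\<integral>\<^sup>+t. ennreal (sqrt (F t x)) \<partial>lborel) \<partial>M) = (\<integral>\<^sup>+t. (\<integral>\<^sup>+x. ennreal (sqrt (F t x)) \<partial>M) \<partial>lborel)"
    by (intro Fubini') measurable
  also have "\<dots> \<le> (\<integral>\<^sup>+t. ennreal (sqrt (measure M UNIV) * s t) \<partial>lborel)"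
    by (intro nn_integral_mono CS)
  also have "\<dots> = ennreal (\<integral>t. sqrt (measure M UNIV) * s t \<partial>lborel)"
    using s0 by (intro nn_integral_eq_integral integrable_mult_right si) auto
  also have "(\<integral>t. sqrt (measure M UNIV) * s t \<partial>lborel) = sqrt (measure M UNIV) * integral {a..b} (\<lambda>t. sqrt (\<integral>x. f t x \<partial>M))"
    using hs by (simp add: integral_unique)
  finally show "(\<integral>\<^sup>+x. ennreal \<bar>w x\<bar> \<partial>M) \<le> ennreal (K * sqrt (measure M UNIV) * integral {a..b} (\<lambda>t. sqrt (\<integral>x. f t x \<partial>M)))"
    using K by (simp add: mult_left_mono mult.assoc ennreal_mult')
qed

lemma has_vector_derivativeI_quotient:
  fixes f :: "real \<Rightarrow> 'v::real_normed_vector"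
  assumes "((\<lambda>s. (f s - f t) /\<^sub>R (s - t)) \<longlongrightarrow> D) (at t within S)"
  shows "(f has_vector_derivative D) (at t within S)"
  unfolding has_vector_derivative_def
proof (rule has_derivativeI)
  have "((\<lambda>s. norm ((f s - f t) /\<^sub>R (s - t) - D)) \<longlongrightarrow> 0) (at t within S)"
    using assms by (simp add: LIM_zero_iff tendsto_norm_zero_iff)
  moreover have "norm ((f s - f t - (s - t) *\<^sub>R D) /\<^sub>R norm (s - t)) = norm ((f s - f t) /\<^sub>R (s - t) - D)"
    if "s \<noteq> t" for s
  proof -
    have "(f s - f t) /\<^sub>R (s - t) - D = (f s - f t - (s - t) *\<^sub>R D) /\<^sub>R (s - t)"
      using that by (simp add: scaleR_diff_right)
    then show ?thesis by simp
  qed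
  then have "\<forall>\<^sub>F s in at t within S. norm ((f s - f t) /\<^sub>R (s - t) - D) = norm ((f s - f t - (s - t) *\<^sub>R D) /\<^sub>R norm (s - t))"
    by (auto simp: eventually_at intro!: exI[of _ 1])
  ultimately have "((\<lambda>s. norm ((f s - f t - (s - t) *\<^sub>R D) /\<^sub>R norm (s - t))) \<longlongrightarrow> 0) (at t within S)"
    by (rule Lim_transform_eventually)
  then show "((\<lambda>s. (f s - f t - (s - t) *\<^sub>R D) /\<^sub>R norm (s - t)) \<longlongrightarrow> 0) (at t within S)"
    by (rule tendsto_norm_zero_cancel)
qed (rule bounded_linear_scaleR_left)

context closed_oriented_manifold
begin

section \<open>Regularity of paths of metrics and the derivative of the weight\<close>

lemma uniform_family_continuous:
  fixes \<phi> :: "real \<Rightarrow> ('a, 'n) tensor_field"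
  assumes smooth: "\<And>t. t \<in> T \<Longrightarrow> \<phi> t \<in> smooth_sym_tensors A"
    and c: "c \<in> A"
    and lim: "\<And>t K. t \<in> T \<Longrightarrow> compact K \<Longrightarrow> K \<subseteq> chart_img c \<Longrightarrow>
      uniform_limit K (\<lambda>s. coord_rep c (\<phi> s)) (coord_rep c (\<phi> t)) (at t within T)"
  shows "continuous_on (T \<times> chart_dom c) (\<lambda>(t, x). \<phi> t c x)"
proof -
  have "continuous_on (T \<times> chart_img c) (\<lambda>(t, y). coord_rep c (\<phi> t) y)"
    unfolding continuous_on_iff
  proof (intro ballI allI impI)
    fix p and e :: real assume p: "p \<in> T \<times> chart_img c" and e: "e > 0"
    obtain t y where ty: "p = (t, y)" "t \<in> T" "y \<in> chart_img c" using p by auto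
    obtain r where r: "r > 0" "cball y r \<subseteq> chart_img c"
      using open_img[OF c] ty open_contains_cball by blast
    have "\<forall>\<^sub>F s in at t within T. \<forall>z\<in>cball y r. dist (coord_rep c (\<phi> s) z) (coord_rep c (\<phi> t) z) < e / 2"
      using lim[OF ty(2) compact_cball r(2)] e by (auto dest!: uniform_limitD[where e = "e / 2"])
    then obtain d1 where d1: "d1 > 0" "\<And>s z. s \<in> T \<Longrightarrow> s \<noteq> t \<Longrightarrow> dist s t < d1 \<Longrightarrow> z \<in> cball y r \<Longrightarrow>
        dist (coord_rep c (\<phi> s) z) (coord_rep c (\<phi> t) z) < e / 2"
      unfolding eventually_at by blast
    obtain d2 where d2: "d2 > 0" "\<And>z. z \<in> chart_img c \<Longrightarrow> dist z y < d2 \<Longrightarrow>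
        dist (coord_rep c (\<phi> t) z) (coord_rep c (\<phi> t) y) < e / 2"
      using coord_rep_continuous[OF smooth[OF ty(2)] c] ty e unfolding continuous_on_iff
      by (metis half_gt_zero)
    show "\<exists>d>0. \<forall>q\<in>T \<times> chart_img c. dist q p < d \<longrightarrow>
        dist (case q of (t, y) \<Rightarrow> coord_rep c (\<phi> t) y) (case p of (t, y) \<Rightarrow> coord_rep c (\<phi> t) y) < e"
    proof (intro exI[of _ "min d1 (min d2 r)"] conjI ballI impI)
      fix q assume q: "q \<in> T \<times> chart_img c" "dist q p < min d1 (min d2 r)"
      obtain s z where sz: "q = (s, z)" "s \<in> T" "z \<in> chart_img c" using q by auto
      have "dist s t \<le> dist q p" "dist z y \<le> dist q p"
        using dist_fst_le[of q p] dist_snd_le[of q p] by (auto simp: sz ty)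
      then have d: "dist s t < d1" "dist z y < d2" "dist z y < r" using q by auto
      have "dist (coord_rep c (\<phi> s) z) (coord_rep c (\<phi> t) z) < e / 2"
        \<comment> \<open>The filter \<open>at t within T\<close> omits \<open>s = t\<close>, where
          the distance is 0 anyway.\<close>
        using d1(2)[OF sz(2) _ d(1), of z] d(3) e by (cases "s = t") (auto simp: dist_commute)
      moreover have "dist (coord_rep c (\<phi> t) z) (coord_rep c (\<phi> t) y) < e / 2"
        using d2(2)[OF sz(3) d(2)] .
      ultimately show "dist (case q of (t, y) \<Rightarrow> coord_rep c (\<phi> t) y) (case p of (t, y) \<Rightarrow> coord_rep c (\<phi> t) y) < e"
        using dist_triangle[of "coord_rep c (\<phi> s) z" "coord_rep c (\<phi> t) y" "coord_rep c (\<phi> t) z"]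
        unfolding sz ty by simp
    qed (use d1 d2 r in auto)
  qed
  then have "continuous_on (T \<times> chart_dom c) (\<lambda>p. (\<lambda>(t, y). coord_rep c (\<phi> t) y) (fst p, coord c (snd p)))"
    by (rule continuous_on_compose2)
       (auto intro!: continuous_intros continuous_on_compose2[OF coord_continuous[OF c]])
  then show ?thesis
    by (rule continuous_on_eq) (auto simp: coord_rep_def param_coord[OF c])
qed

text \<open>The integrand of the squared norm of \<open>k\<close> at \<open>h\<close>, transferred
  from the volume measure of \<open>h\<close> to that of \<open>g\<close>.\<close>

definition speed_density :: "('a, 'n) tensor_field \<Rightarrow> ('a, 'n) tensor_field \<Rightarrow> ('a, 'n) tensor_field \<Rightarrow> 'a \<Rightarrow> real"
  where "speed_density g h k x = pointwise_inner A h k k x * sqrt (rel_det A g h x)"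

lemma speed_density_nonneg:
  assumes "g \<in> metrics A" "h \<in> metrics A" "sym_tensor_field A k"
  shows "speed_density g h k x \<ge> 0"
  unfolding speed_density_def
  using pointwise_inner_nonneg[OF assms(2,3)] rel_det_pos[OF assms(1,2), of x] by simp

text \<open>Off \<open>chart_dom c\<close> the component \<open>h c x\<close> is 0 by convention, so
  the function is defined on the whole manifold and equals there the fourth root of
  \<open>rel_det\<close>.\<close>

definition weight :: "('a, 'n) tensor_field \<Rightarrow> ('a, 'n) chart \<Rightarrow> real^'n \<Rightarrow> ('a, 'n) tensor_field \<Rightarrow> 'a \<Rightarrow> real"
  where "weight g c v h x = rel_det A g h x powr (1/4) / (1 + v \<bullet> (h c x *v v))"

text \<open>Extracts from convergence in the space of tensor fields what calculus at points needs:
  derivatives in time for fixed x, and joint continuity in time and space.\<close>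

lemma C1_path:
  assumes C1: "C1_path_on A a b \<gamma>" and \<gamma>: "\<And>t. t \<in> {a..b} \<Longrightarrow> \<gamma> t \<in> metrics A"
  obtains \<eta> where "\<And>t. t \<in> {a..b} \<Longrightarrow> \<eta> t \<in> smooth_sym_tensors A"
    "\<And>c t x. c \<in> A \<Longrightarrow> x \<in> chart_dom c \<Longrightarrow> t \<in> {a..b} \<Longrightarrow>
      ((\<lambda>s. \<gamma> s c x) has_vector_derivative \<eta> t c x) (at t within {a..b})"
    "\<And>c. c \<in> A \<Longrightarrow> continuous_on ({a..b} \<times> chart_dom c) (\<lambda>(t, x). \<gamma> t c x)"
    "\<And>c. c \<in> A \<Longrightarrow> continuous_on ({a..b} \<times> chart_dom c) (\<lambda>(t, x). \<eta> t c x)"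
proof -
  obtain \<eta> where \<eta>: "\<And>t. t \<in> {a..b} \<Longrightarrow> \<eta> t \<in> smooth_sym_tensors A"
    and diff: "\<And>t. t \<in> {a..b} \<Longrightarrow> Cinf_tendsto A (\<lambda>s c x. (\<gamma> s c x - \<gamma> t c x) /\<^sub>R (s - t)) (\<eta> t) (at t within {a..b})"
    and cont: "\<And>t. t \<in> {a..b} \<Longrightarrow> Cinf_tendsto A \<eta> (\<eta> t) (at t within {a..b})"
    using C1 unfolding C1_path_on_def by (elim exE) (rule that, blast+)
  have lim\<eta>: "uniform_limit K (\<lambda>s. coord_rep c (\<eta> s)) (coord_rep c (\<eta> t)) (at t within {a..b})"
    if "c \<in> A" "t \<in> {a..b}" "compact K" "K \<subseteq> chart_img c" for c t K
  proof -
    have "uniform_limit K (\<lambda>s. partials [] (coord_rep c (\<eta> s))) (partials [] (coord_rep c (\<eta> t))) (at t within {a..b})"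
      by (rule cont[OF that(2), unfolded Cinf_tendsto_def, rule_format, OF that(1) conjI[OF that(3,4)]])
    then show ?thesis by simp
  qed
  have limD: "uniform_limit K (\<lambda>s y. (\<gamma> s c (param c y) - \<gamma> t c (param c y)) /\<^sub>R (s - t)) (coord_rep c (\<eta> t)) (at t within {a..b})"
    if "c \<in> A" "t \<in> {a..b}" "compact K" "K \<subseteq> chart_img c" for c t K
  proof -
    have "uniform_limit K (\<lambda>s. partials [] (coord_rep c (\<lambda>c x. (\<gamma> s c x - \<gamma> t c x) /\<^sub>R (s - t)))) (partials [] (coord_rep c (\<eta> t))) (at t within {a..b})"
      by (rule diff[OF that(2), unfolded Cinf_tendsto_def, rule_format, OF that(1) conjI[OF that(3,4)]])
    then show ?thesis by (simp add: coord_rep_def[abs_def])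
  qed
  have lim\<gamma>: "uniform_limit K (\<lambda>s. coord_rep c (\<gamma> s)) (coord_rep c (\<gamma> t)) (at t within {a..b})"
    if "c \<in> A" "t \<in> {a..b}" "compact K" "K \<subseteq> chart_img c" for c t K
  proof -
    \<comment> \<open>\<open>\<gamma> s - \<gamma> t\<close> is \<open>s - t\<close> times the
      difference quotient. Uniform limits may be multiplied when the limits are bounded, so
      \<open>\<gamma> s\<close> tends to \<open>\<gamma> t\<close> uniformly on
      \<open>K\<close>.\<close>
    have bdd: "bounded (coord_rep c (\<eta> t) ` K)"
      using that by (intro compact_imp_bounded compact_continuous_image
          continuous_on_subset[OF coord_rep_continuous[OF \<eta>]]) auto
    have "uniform_limit K (\<lambda>s y. s - t) (\<lambda>y. 0) (at t within {a..b})"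
    proof (rule uniform_limitI)
      fix e :: real assume "e > 0"
      then have "\<forall>\<^sub>F s in at t within {a..b}. dist s t < e" by (auto simp: eventually_at)
      then show "\<forall>\<^sub>F s in at t within {a..b}. \<forall>y\<in>K. dist (s - t) 0 < e"
        by (rule eventually_mono) (simp add: dist_real_def)
    qed
    then have "uniform_limit K (\<lambda>s y. (s - t) *\<^sub>R ((\<gamma> s c (param c y) - \<gamma> t c (param c y)) /\<^sub>R (s - t)))
        (\<lambda>y. 0 *\<^sub>R coord_rep c (\<eta> t) y) (at t within {a..b})"
      by (intro bounded_bilinear.bounded_uniform_limit[OF bounded_bilinear_scaleR] limD that bdd)
         (auto intro: bounded_subset[of "{0}"])
    then have "uniform_limit K (\<lambda>s y. (s - t) *\<^sub>R ((\<gamma> s c (param c y) - \<gamma> t c (param c y)) /\<^sub>R (s - t)) + coord_rep c (\<gamma> t) y)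
        (\<lambda>y. 0 *\<^sub>R coord_rep c (\<eta> t) y + coord_rep c (\<gamma> t) y) (at t within {a..b})"
      by (intro uniform_limit_add uniform_limit_const)
    then show ?thesis
    proof (rule uniform_limit_cong[THEN iffD1, rotated 2])
      show "\<forall>\<^sub>F s in at t within {a..b}. \<forall>y\<in>K. (s - t) *\<^sub>R ((\<gamma> s c (param c y) - \<gamma> t c (param c y)) /\<^sub>R (s - t)) + coord_rep c (\<gamma> t) y = coord_rep c (\<gamma> s) y"
        by (auto simp: eventually_at coord_rep_def intro!: exI[of _ 1])
    qed simp
  qed
  show thesis
  proof (rule that[of \<eta>])
    fix c t x assume c: "c \<in> A" and x: "x \<in> chart_dom c" and t: "t \<in> {a..b}"
    \<comment> \<open>On the compact set consisting of one point, uniform convergence is the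
      pointwise limit.\<close>
    have "((\<lambda>s. (\<gamma> s c (param c (coord c x)) - \<gamma> t c (param c (coord c x))) /\<^sub>R (s - t)) \<longlongrightarrow> coord_rep c (\<eta> t) (coord c x)) (at t within {a..b})"
      using limD[OF c t, of "{coord c x}"] x by simp
    then show "((\<lambda>s. \<gamma> s c x) has_vector_derivative \<eta> t c x) (at t within {a..b})"
      by (intro has_vector_derivativeI_quotient) (simp add: coord_rep_def param_coord[OF c x])
  next
    fix c assume c: "c \<in> A"
    show "continuous_on ({a..b} \<times> chart_dom c) (\<lambda>(t, x). \<gamma> t c x)"
      using \<gamma> metrics_smooth lim\<gamma> c by (intro uniform_family_continuous) auto
    show "continuous_on ({a..b} \<times> chart_dom c) (\<lambda>(t, x). \<eta> t c x)"
      using \<eta> lim\<eta> c by (intro uniform_family_continuous) auto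
  qed (rule \<eta>)
qed

lemma speed_density_continuous:
  assumes g: "g \<in> metrics A" and \<gamma>: "\<And>t. t \<in> T \<Longrightarrow> \<gamma> t \<in> metrics A" and \<eta>: "\<And>t. t \<in> T \<Longrightarrow> \<eta> t \<in> smooth_sym_tensors A"
    and c1: "\<And>c. c \<in> A \<Longrightarrow> continuous_on (T \<times> chart_dom c) (\<lambda>(t, x). \<gamma> t c x)"
    and c2: "\<And>c. c \<in> A \<Longrightarrow> continuous_on (T \<times> chart_dom c) (\<lambda>(t, x). \<eta> t c x)"
  shows "continuous_on (T \<times> UNIV) (\<lambda>(t, x). speed_density g (\<gamma> t) (\<eta> t) x)"
proof (rule continuous_on_charts)
  fix c assume c: "c \<in> A"
  let ?\<gamma> = "\<lambda>p. \<gamma> (fst p) c (snd p)" and ?\<eta> = "\<lambda>p. \<eta> (fst p) c (snd p)" and ?g = "\<lambda>p. g c (snd p)"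
  have cg: "continuous_on (T \<times> chart_dom c) ?g"
    by (rule continuous_on_compose2[OF tensor_continuous[OF metrics_smooth[OF g] c]]) (auto intro!: continuous_intros)
  have c\<gamma>: "continuous_on (T \<times> chart_dom c) ?\<gamma>" and c\<eta>: "continuous_on (T \<times> chart_dom c) ?\<eta>"
    using c1[OF c] c2[OF c] by (simp_all add: case_prod_unfold)
  have inv: "invertible (?\<gamma> p)" if "p \<in> T \<times> chart_dom c" for p
    using that pos_def_invertible[OF metrics_pos_def[OF \<gamma> c]] by auto
  have nz: "\<forall>p\<in>T \<times> chart_dom c. det (?g p) \<noteq> 0"
    using pos_def_det_pos[OF metrics_pos_def[OF g c]] by fastforce
  have "continuous_on (T \<times> chart_dom c) (\<lambda>p. trace (matrix_inv (?\<gamma> p) ** ?\<eta> p ** matrix_inv (?\<gamma> p) ** ?\<eta> p) * sqrt (det (?\<gamma> p) / det (?g p)))"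
    by (intro continuous_on_mult continuous_on_trace continuous_on_matrix_mult continuous_on_matrix_inv
        continuous_on_real_sqrt continuous_on_divide continuous_on_det c\<gamma> c\<eta> cg nz) (erule inv)+
  then show "continuous_on (T \<times> chart_dom c) (\<lambda>(t, x). speed_density g (\<gamma> t) (\<eta> t) x)"
    by (rule continuous_on_eq)
       (auto simp: speed_density_def pointwise_inner_chart[OF \<gamma> smooth_sym_tensors_sym[OF \<eta>] smooth_sym_tensors_sym[OF \<eta>] c]
          rel_det_chart[OF g metrics_sym[OF \<gamma>] c])
qed

lemma weight_derivative:
  assumes g: "g \<in> metrics A" and \<gamma>: "\<And>t. t \<in> {a..b} \<Longrightarrow> \<gamma> t \<in> metrics A" and \<eta>: "\<And>t. t \<in> {a..b} \<Longrightarrow> \<eta> t \<in> smooth_sym_tensors A"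
    and der: "\<And>c t x. c \<in> A \<Longrightarrow> x \<in> chart_dom c \<Longrightarrow> t \<in> {a..b} \<Longrightarrow>
      ((\<lambda>s. \<gamma> s c x) has_vector_derivative \<eta> t c x) (at t within {a..b})"
    and c: "c \<in> A" and t: "t \<in> {a..b}"
  shows "\<exists>D. ((\<lambda>s. weight g c v (\<gamma> s) x) has_real_derivative D) (at t within {a..b}) \<and>
    \<bar>D\<bar> \<le> (sqrt (CARD('n)) + 1) * sqrt (speed_density g (\<gamma> t) (\<eta> t) x)"
proof -
  \<comment> \<open>The chart \<open>d\<close> used for computing may differ from the chart
    \<open>c\<close> of the weight, as long as some vector \<open>u\<close> reproduces the quadratic
    form; this covers the points outside \<open>chart_dom c\<close>.\<close>
  have *: "\<exists>D. ((\<lambda>s. weight g c v (\<gamma> s) x) has_real_derivative D) (at t within {a..b}) \<and>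
      \<bar>D\<bar> \<le> (sqrt (CARD('n)) + 1) * sqrt (speed_density g (\<gamma> t) (\<eta> t) x)"
    if d: "d \<in> A" "x \<in> chart_dom d" and vu: "\<And>s. s \<in> {a..b} \<Longrightarrow> v \<bullet> (\<gamma> s c x *v v) = u \<bullet> (\<gamma> s d x *v u)" for d u
  proof -
    define C where "C = 1 / det (g d x)"
    have C: "C > 0" using pos_def_det_pos[OF metrics_pos_def[OF g d]] by (simp add: C_def)
    have P: "pos_def (\<gamma> t d x)" by (rule metrics_pos_def[OF \<gamma>[OF t] d])
    have S: "transpose (\<eta> t d x) = \<eta> t d x" by (rule tensor_symmetric[OF smooth_sym_tensors_sym[OF \<eta>[OF t]] d])
    have rd: "rel_det A g (\<gamma> s) x = C * det (\<gamma> s d x)" if "s \<in> {a..b}" for s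
      using rel_det_chart[OF g metrics_sym[OF \<gamma>[OF that]] d] by (simp add: C_def)
    have sd: "sqrt (speed_density g (\<gamma> t) (\<eta> t) x) =
        sqrt (trace (matrix_inv (\<gamma> t d x) ** \<eta> t d x ** matrix_inv (\<gamma> t d x) ** \<eta> t d x)) * (C * det (\<gamma> t d x)) powr (1/4)"
    proof -
      \<comment> \<open>The root of the speed density contains the root of sqrt(det), and this is
        where the exponent 1/4 matches.\<close>
      have "C * det (\<gamma> t d x) > 0" using C pos_def_det_pos[OF P] by simp
      then have "sqrt (sqrt (C * det (\<gamma> t d x))) = (C * det (\<gamma> t d x)) powr (1/4)"
        by (simp add: powr_half_sqrt[symmetric] powr_powr)
      then show ?thesis
        using smooth_sym_tensors_sym[OF \<eta>[OF t]]
        by (simp add: speed_density_def pointwise_inner_chart[OF \<gamma>[OF t] _ _ d] rd[OF t] real_sqrt_mult)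
    qed
    obtain D where D: "((\<lambda>s. (C * det (\<gamma> s d x)) powr (1/4) / (1 + u \<bullet> (\<gamma> s d x *v u))) has_real_derivative D) (at t within {a..b})"
      "\<bar>D\<bar> \<le> (sqrt (CARD('n)) + 1) * (sqrt (trace (matrix_inv (\<gamma> t d x) ** \<eta> t d x ** matrix_inv (\<gamma> t d x) ** \<eta> t d x)) * (C * det (\<gamma> t d x)) powr (1/4))"
      by (rule det_weight_derivative[OF der[OF d t] P S C]) blast
    have "((\<lambda>s. weight g c v (\<gamma> s) x) has_real_derivative D) (at t within {a..b})"
      by (rule has_field_derivative_transform_within[OF D(1), of 1])
         (use t in \<open>auto simp: weight_def rd vu\<close>)
    then show ?thesis using D(2) by (auto simp: sd)
  qed
  show ?thesis
  proof (cases "x \<in> chart_dom c")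
    case True
    then show ?thesis using *[OF c] by blast
  next
    case False
    \<comment> \<open>The quadratic form vanishes identically here, which any chart around
      \<open>x\<close> reproduces with \<open>u = 0\<close>.\<close>
    then have "\<gamma> s c x = 0" if "s \<in> {a..b}" for s
      using tensor_outside[OF metrics_sym[OF \<gamma>[OF that]]] by blast
    then show ?thesis using *[OF chart_at, where u = 0] by simp
  qed
qed

lemma weight_increment_bound:
  assumes ab: "a \<le> b" and g: "g \<in> metrics A" and \<gamma>: "\<And>t. t \<in> {a..b} \<Longrightarrow> \<gamma> t \<in> metrics A" and \<eta>: "\<And>t. t \<in> {a..b} \<Longrightarrow> \<eta> t \<in> smooth_sym_tensors A"
    and der: "\<And>c t x. c \<in> A \<Longrightarrow> x \<in> chart_dom c \<Longrightarrow> t \<in> {a..b} \<Longrightarrow>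
      ((\<lambda>s. \<gamma> s c x) has_vector_derivative \<eta> t c x) (at t within {a..b})"
    and cont: "continuous_on ({a..b} \<times> UNIV) (\<lambda>(t, x). speed_density g (\<gamma> t) (\<eta> t) x)"
    and c: "c \<in> A"
  shows "\<bar>weight g c v (\<gamma> b) x - weight g c v (\<gamma> a) x\<bar> \<le>
    (sqrt (CARD('n)) + 1) * integral {a..b} (\<lambda>t. sqrt (speed_density g (\<gamma> t) (\<eta> t) x))"
proof -
  obtain D where D: "\<And>t. t \<in> {a..b} \<Longrightarrow> ((\<lambda>s. weight g c v (\<gamma> s) x) has_real_derivative D t) (at t within {a..b})"
    "\<And>t. t \<in> {a..b} \<Longrightarrow> \<bar>D t\<bar> \<le> (sqrt (CARD('n)) + 1) * sqrt (speed_density g (\<gamma> t) (\<eta> t) x)"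
  proof -
    have "\<forall>t\<in>{a..b}. \<exists>D. ((\<lambda>s. weight g c v (\<gamma> s) x) has_real_derivative D) (at t within {a..b}) \<and>
        \<bar>D\<bar> \<le> (sqrt (CARD('n)) + 1) * sqrt (speed_density g (\<gamma> t) (\<eta> t) x)"
      by (intro ballI weight_derivative[OF g \<gamma> \<eta> der c])
    from bchoice[OF this] show thesis using that by blast
  qed
  \<comment> \<open>\<open>D\<close> is chosen separately at each time; the gauge integral
    integrates every derivative.\<close>
  have FTC: "(D has_integral weight g c v (\<gamma> b) x - weight g c v (\<gamma> a) x) {a..b}"
    using D(1) by (intro fundamental_theorem_of_calculus ab) (simp add: has_real_derivative_iff_has_vector_derivative)
  have "continuous_on {a..b} (\<lambda>t. (\<lambda>(t, x). speed_density g (\<gamma> t) (\<eta> t) x) (t, x))"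
    by (rule continuous_on_compose2[OF cont]) (auto intro!: continuous_intros)
  then have int: "(\<lambda>t. (sqrt (CARD('n)) + 1) * sqrt (speed_density g (\<gamma> t) (\<eta> t) x)) integrable_on {a..b}"
    by (intro integrable_continuous_real continuous_intros) simp
  have "norm (integral {a..b} D) \<le> integral {a..b} (\<lambda>t. (sqrt (CARD('n)) + 1) * sqrt (speed_density g (\<gamma> t) (\<eta> t) x))"
    using FTC D(2) by (intro integral_norm_bound_integral int) auto
  then show ?thesis using integral_unique[OF FTC] by simp
qed

end

section \<open>Linear combinations of smooth functions\<close>

text \<open>The next derivative at y depends on values near y, so the induction carries the identity
  on all of the open set \<open>S\<close>; differentiability comes out of the same argument.\<close>

lemma partials_linear_combination:
  fixes f k :: "real^'n \<Rightarrow> 'b::real_normed_vector"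
  assumes S: "open S" and f: "smooth_on S f" and k: "smooth_on S k" and y: "y \<in> S"
  shows "partials is (\<lambda>y. \<alpha> *\<^sub>R f y + \<beta> *\<^sub>R k y) y = \<alpha> *\<^sub>R partials is f y + \<beta> *\<^sub>R partials is k y"
    and "partials is (\<lambda>y. \<alpha> *\<^sub>R f y + \<beta> *\<^sub>R k y) differentiable (at y)"
proof -
  have der: "(partials is (\<lambda>y. \<alpha> *\<^sub>R f y + \<beta> *\<^sub>R k y) has_derivative
      (\<lambda>v. \<alpha> *\<^sub>R frechet_derivative (partials is f) (at y) v + \<beta> *\<^sub>R frechet_derivative (partials is k) (at y) v)) (at y)"
    if eq: "\<And>y. y \<in> S \<Longrightarrow> partials is (\<lambda>y. \<alpha> *\<^sub>R f y + \<beta> *\<^sub>R k y) y = \<alpha> *\<^sub>R partials is f y + \<beta> *\<^sub>R partials is k y"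
      and y: "y \<in> S" for "is" y
  proof (rule has_derivative_transform_within_open[OF _ S y])
    show "((\<lambda>y. \<alpha> *\<^sub>R partials is f y + \<beta> *\<^sub>R partials is k y) has_derivative
      (\<lambda>v. \<alpha> *\<^sub>R frechet_derivative (partials is f) (at y) v + \<beta> *\<^sub>R frechet_derivative (partials is k) (at y) v)) (at y)"
      using f k y unfolding smooth_on_def
      by (intro has_derivative_add has_derivative_scaleR_right) (auto simp: frechet_derivative_works)
  qed (simp add: eq)
  have eq: "partials is (\<lambda>y. \<alpha> *\<^sub>R f y + \<beta> *\<^sub>R k y) y = \<alpha> *\<^sub>R partials is f y + \<beta> *\<^sub>R partials is k y" if "y \<in> S" for "is" y
    using that
  proof (induction "is" arbitrary: y)
    case Nil
    then show ?case by simp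
  next
    case (Cons i "is")
    show ?case
      using frechet_derivative_at[OF der[OF Cons.IH Cons.prems]] by (simp add: fun_eq_iff)
  qed
  then show "partials is (\<lambda>y. \<alpha> *\<^sub>R f y + \<beta> *\<^sub>R k y) y = \<alpha> *\<^sub>R partials is f y + \<beta> *\<^sub>R partials is k y"
    using y by blast
  show "partials is (\<lambda>y. \<alpha> *\<^sub>R f y + \<beta> *\<^sub>R k y) differentiable (at y)"
    using der[OF eq y] by (rule differentiableI)
qed

section \<open>The distance dominates the integral distance of the weights\<close>

context closed_oriented_manifold
begin

lemma smooth_sym_tensors_linear_combination:
  assumes h: "h \<in> smooth_sym_tensors A" and k: "k \<in> smooth_sym_tensors A"
  shows "(\<lambda>c x. \<alpha> *\<^sub>R h c x + \<beta> *\<^sub>R k c x) \<in> smooth_sym_tensors A"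
proof -
  let ?m = "\<lambda>c x. \<alpha> *\<^sub>R h c x + \<beta> *\<^sub>R k c x"
  have sh: "sym_tensor_field A h" and sk: "sym_tensor_field A k"
    using h k by (simp_all add: smooth_sym_tensors_sym)
  have lin: "transpose J ** (\<alpha> *\<^sub>R P + \<beta> *\<^sub>R Q) ** J = \<alpha> *\<^sub>R (transpose J ** P ** J) + \<beta> *\<^sub>R (transpose J ** Q ** J)"
    for J P Q :: "real^'n^'n"
    by (simp add: matrix_matrix_mult_def vec_eq_iff sum.distrib sum_distrib_left sum_distrib_right algebra_simps)
  have "sym_tensor_field A ?m"
    unfolding sym_tensor_field_def
  proof (intro conjI ballI allI impI)
    fix c x assume c: "c \<in> A" and x: "x \<in> chart_dom c"
    have "transpose (\<alpha> *\<^sub>R P + \<beta> *\<^sub>R Q) = \<alpha> *\<^sub>R transpose P + \<beta> *\<^sub>R transpose Q" for P Q :: "real^'n^'n"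
      by (simp add: transpose_def vec_eq_iff)
    then show "transpose (?m c x) = ?m c x"
      using tensor_symmetric[OF sh c x] tensor_symmetric[OF sk c x] by simp
  next
    fix c d x assume c: "c \<in> A" "d \<in> A" and x: "x \<in> chart_dom c \<inter> chart_dom d"
    show "?m c x = transpose (jacobian c d x) ** ?m d x ** jacobian c d x"
      unfolding lin tensor_transform[OF sh c x, symmetric] tensor_transform[OF sk c x, symmetric] ..
  next
    fix c x assume "\<not> (c \<in> A \<and> x \<in> chart_dom c)"
    then have "h c x = 0" "k c x = 0" using sh sk unfolding sym_tensor_field_def by blast+
    then show "?m c x = 0" by simp
  qed
  moreover have "smooth_on (chart_img c) (coord_rep c ?m)" if c: "c \<in> A" for c
  proof -
    have "smooth_on (chart_img c) (coord_rep c h)" "smooth_on (chart_img c) (coord_rep c k)"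
      using h k c by (auto simp: smooth_sym_tensors_def)
    then have "smooth_on (chart_img c) (\<lambda>y. \<alpha> *\<^sub>R coord_rep c h y + \<beta> *\<^sub>R coord_rep c k y)"
      unfolding smooth_on_def[of _ "\<lambda>y. \<alpha> *\<^sub>R coord_rep c h y + \<beta> *\<^sub>R coord_rep c k y"]
      by (intro allI ballI partials_linear_combination(2)[OF open_img[OF c]])
    then show ?thesis by (simp add: coord_rep_def[abs_def])
  qed
  ultimately show ?thesis by (simp add: smooth_sym_tensors_def)
qed

text \<open>Convexity of the set of metrics: the straight segment is an admissible path, so the set
  of lengths whose \<open>Inf\<close> is the distance is not empty.\<close>

lemma metrics_segment:
  assumes h: "h \<in> metrics A" and k: "k \<in> metrics A" and t: "t \<in> {0..1}"
  shows "(\<lambda>c x. (1 - t) *\<^sub>R h c x + t *\<^sub>R k c x) \<in> metrics A"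
proof -
  have "v \<bullet> (((1 - t) *\<^sub>R h c x + t *\<^sub>R k c x) *v v) > 0" if "c \<in> A" "x \<in> chart_dom c" "v \<noteq> 0" for c x v
  proof -
    have "v \<bullet> (h c x *v v) > 0" "v \<bullet> (k c x *v v) > 0"
      using metrics_pos_def[OF h that(1,2)] metrics_pos_def[OF k that(1,2)] that(3) by (auto simp: pos_def_def)
    moreover have "v \<bullet> (((1 - t) *\<^sub>R h c x + t *\<^sub>R k c x) *v v) = (1 - t) * (v \<bullet> (h c x *v v)) + t * (v \<bullet> (k c x *v v))"
      by (simp add: matrix_vector_mult_add_rdistrib scaleR_matrix_vector_assoc[symmetric] inner_add_right)
    ultimately show ?thesis
      using t by (cases "t = 0") (auto intro!: add_nonneg_pos)
  qed
  then show ?thesis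
    using smooth_sym_tensors_linear_combination[OF metrics_smooth[OF h] metrics_smooth[OF k]]
    by (simp add: metrics_def pos_def_at_def)
qed

lemma segment_C1_path:
  assumes h: "h \<in> metrics A" and k: "k \<in> metrics A"
  shows "C1_path_on A a b (\<lambda>t c x. (1 - t) *\<^sub>R h c x + t *\<^sub>R k c x)"
  unfolding C1_path_on_def
proof (intro exI ballI conjI)
  fix t :: real
  let ?\<eta> = "\<lambda>c x. 1 *\<^sub>R k c x + (-1) *\<^sub>R h c x"
  show "?\<eta> \<in> smooth_sym_tensors A"
    by (intro smooth_sym_tensors_linear_combination metrics_smooth h k)
  show "Cinf_tendsto A (\<lambda>_. ?\<eta>) ?\<eta> (at t within {a..b})"
    unfolding Cinf_tendsto_def by (auto intro: uniform_limit_const)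
  \<comment> \<open>The difference quotient of the segment is constantly \<open>k - h\<close> away
    from \<open>s = t\<close>, which the filter omits; every required limit is then trivial.\<close>
  have "(\<lambda>c x. (((1 - s) *\<^sub>R h c x + s *\<^sub>R k c x) - ((1 - t) *\<^sub>R h c x + t *\<^sub>R k c x)) /\<^sub>R (s - t)) = ?\<eta>" if "s \<noteq> t" for s
  proof -
    have "(((1 - s) *\<^sub>R P + s *\<^sub>R Q) - ((1 - t) *\<^sub>R P + t *\<^sub>R Q)) = (s - t) *\<^sub>R (1 *\<^sub>R Q + (-1) *\<^sub>R P)" for P Q :: "real^'n^'n"
      by (simp add: algebra_simps)
    then show ?thesis using that by (simp only:) (simp add: fun_eq_iff)
  qed
  then have ev: "\<forall>\<^sub>F s in at t within {a..b}. (\<lambda>c x. (((1 - s) *\<^sub>R h c x + s *\<^sub>R k c x) - ((1 - t) *\<^sub>R h c x + t *\<^sub>R k c x)) /\<^sub>R (s - t)) = ?\<eta>"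
    by (auto simp: eventually_at intro!: exI[of _ 1])
  show "Cinf_tendsto A (\<lambda>s c x. (((1 - s) *\<^sub>R h c x + s *\<^sub>R k c x) - ((1 - t) *\<^sub>R h c x + t *\<^sub>R k c x)) /\<^sub>R (s - t)) ?\<eta> (at t within {a..b})"
    unfolding Cinf_tendsto_def
  proof (intro ballI allI impI uniform_limitI)
    fix c K "is" and e :: real assume "e > 0"
    show "\<forall>\<^sub>F s in at t within {a..b}. \<forall>y\<in>K. dist (partials is (coord_rep c (\<lambda>c x. (((1 - s) *\<^sub>R h c x + s *\<^sub>R k c x) - ((1 - t) *\<^sub>R h c x + t *\<^sub>R k c x)) /\<^sub>R (s - t))) y)
        (partials is (coord_rep c ?\<eta>) y) < e"
      by (rule eventually_mono[OF ev]) (simp only: dist_self, use \<open>e > 0\<close> in simp)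
  qed
qed

lemma weight_measurable:
  assumes g: "g \<in> metrics A" and h: "h \<in> metrics A" and c: "c \<in> A"
  shows "weight g c v h \<in> borel_measurable borel"
proof -
  have "(\<lambda>x. indicator (chart_dom c) x *\<^sub>R h c x) \<in> borel_measurable borel"
    by (intro borel_measurable_continuous_on_indicator tensor_continuous metrics_smooth h c borel_open open_dom)
  moreover have "(\<lambda>x. indicator (chart_dom c) x *\<^sub>R h c x) = h c"
    using tensor_outside[OF metrics_sym[OF h]] by (auto simp: indicator_def fun_eq_iff)
  ultimately have [measurable]: "h c \<in> borel_measurable borel" by simp
  have [measurable]: "rel_det A g h \<in> borel_measurable borel"
    by (intro borel_measurable_continuous_onI rel_det_continuous g metrics_smooth h)
  have [measurable]: "(\<lambda>M :: real^'n^'n. v \<bullet> (M *v v)) \<in> borel_measurable borel"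
    unfolding inner_vec_def matrix_vector_mult_def by (intro borel_measurable_continuous_onI continuous_intros)
  show ?thesis unfolding weight_def[abs_def] by measurable
qed

section \<open>From the speed of a path to the distance\<close>

definition path_speed :: "(real \<Rightarrow> ('a, 'n) tensor_field) \<Rightarrow> real \<Rightarrow> real"
  where "path_speed \<gamma> t = sqrt (L2_inner A (\<gamma> t) (velocity \<gamma> t) (velocity \<gamma> t))"

text \<open>The first factor stems from \<open>det_weight_derivative\<close>, the root of the volume
  from Cauchy-Schwarz; the added 1 makes the second factor visibly positive, so that one can divide
  by the constant.\<close>

definition lip_const :: "('a, 'n) tensor_field \<Rightarrow> real"
  where "lip_const g = (sqrt (CARD('n)) + 1) * (sqrt (measure (volume_measure A g) UNIV) + 1)"

lemma lip_const_pos: "lip_const g > 0"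
  unfolding lip_const_def by (intro mult_pos_pos add_nonneg_pos) auto

text \<open>\<open>k'\<close> will be the \<open>velocity\<close> of a path, compared with the
  smooth derivative only inside charts of the atlas; \<open>pointwise_inner\<close> reads nothing
  else.\<close>

lemma L2_inner_speed_density:
  assumes g: "g \<in> metrics A" and h: "h \<in> metrics A" and k: "k \<in> smooth_sym_tensors A"
    and k': "\<And>c x. c \<in> A \<Longrightarrow> x \<in> chart_dom c \<Longrightarrow> k' c x = k c x"
  shows "L2_inner A h k' k' = (\<integral>x. speed_density g h k x \<partial>volume_measure A g)"
proof -
  have pw: "pointwise_inner A h k' k' = pointwise_inner A h k k"
    by (simp add: pointwise_inner_def fun_eq_iff Let_def k' chart_at)
  \<comment> \<open>A dummy time turns a single tensor field into a constant family.\<close>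
  have cont: "continuous_on ({0::real} \<times> UNIV) (\<lambda>(t, x). speed_density g h k x)"
    by (rule speed_density_continuous[OF g])
       (auto simp: h k case_prod_unfold intro!: continuous_on_compose2[OF tensor_continuous[OF metrics_smooth[OF h]]]
         continuous_on_compose2[OF tensor_continuous[OF k]] continuous_intros)
  have "continuous_on UNIV (\<lambda>x. (\<lambda>(t, x). speed_density g h k x) (0 :: real, x))"
    by (rule continuous_on_compose2[OF cont]) (auto intro!: continuous_intros)
  then have sd: "speed_density g h k \<in> borel_measurable borel"
    by (intro borel_measurable_continuous_onI) simp
  have rd: "(\<lambda>x. sqrt (rel_det A g h x)) \<in> borel_measurable borel"
    by (intro borel_measurable_continuous_onI continuous_intros rel_det_continuous g metrics_smooth h)
  have "pointwise_inner A h k k x = speed_density g h k x / sqrt (rel_det A g h x)" for x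
    using rel_det_pos[OF g h, of x] by (simp add: speed_density_def)
  then have "pointwise_inner A h k k \<in> borel_measurable borel"
    using sd rd by (simp add: borel_measurable_divide cong: measurable_cong)
  then have "L2_inner A h k' k' = (\<integral>x. sqrt (rel_det A g h x) *\<^sub>R pointwise_inner A h k k x \<partial>volume_measure A g)"
    unfolding L2_inner_def pw volume_measure_density[OF g h]
    using rd rel_det_pos[OF g h] sets_volume_measure[OF g]
    by (intro integral_density) (auto simp: less_imp_le cong: measurable_cong_sets)
  then show ?thesis by (simp add: speed_density_def mult.commute)
qed

lemma C1_segment_estimate:
  assumes g: "g \<in> metrics A" and ab: "a < b" and C1: "C1_path_on A a b \<gamma>"
    and \<gamma>: "\<And>t. t \<in> {a..b} \<Longrightarrow> \<gamma> t \<in> metrics A"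
  shows "path_speed \<gamma> integrable_on {a..b}" "0 \<le> integral {a..b} (path_speed \<gamma>)"
    "c \<in> A \<Longrightarrow> (\<integral>\<^sup>+x. ennreal \<bar>weight g c v (\<gamma> b) x - weight g c v (\<gamma> a) x\<bar> \<partial>volume_measure A g)
      \<le> ennreal (lip_const g * integral {a..b} (path_speed \<gamma>))"
proof -
  let ?\<mu> = "volume_measure A g"
  obtain \<eta> where \<eta>: "\<And>t. t \<in> {a..b} \<Longrightarrow> \<eta> t \<in> smooth_sym_tensors A"
    and der: "\<And>c t x. c \<in> A \<Longrightarrow> x \<in> chart_dom c \<Longrightarrow> t \<in> {a..b} \<Longrightarrow>
      ((\<lambda>s. \<gamma> s c x) has_vector_derivative \<eta> t c x) (at t within {a..b})"
    and c\<gamma>: "\<And>c. c \<in> A \<Longrightarrow> continuous_on ({a..b} \<times> chart_dom c) (\<lambda>(t, x). \<gamma> t c x)"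
    and c\<eta>: "\<And>c. c \<in> A \<Longrightarrow> continuous_on ({a..b} \<times> chart_dom c) (\<lambda>(t, x). \<eta> t c x)"
    by (rule C1_path[OF C1 \<gamma>]) blast+
  have cont: "continuous_on ({a..b} \<times> UNIV) (\<lambda>(t, x). speed_density g (\<gamma> t) (\<eta> t) x)"
    by (rule speed_density_continuous[OF g \<gamma> \<eta> c\<gamma> c\<eta>])
  have nonneg: "0 \<le> speed_density g (\<gamma> t) (\<eta> t) x" if "t \<in> {a..b}" for t x
    using that by (intro speed_density_nonneg g \<gamma> smooth_sym_tensors_sym \<eta>)
  define s where "s = (\<lambda>t. sqrt (\<integral>x. speed_density g (\<gamma> t) (\<eta> t) x \<partial>?\<mu>))"
  have K: "0 \<le> sqrt (CARD('n)) + (1::real)" by simp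
  note inc = integral_increment_bound[OF finite_volume_measure[OF g] sets_volume_measure[OF g] compact_UNIV cont nonneg K,
      folded s_def]
  \<comment> \<open>With \<open>w = 0\<close> and \<open>K = 0\<close> the pointwise bound holds
    trivially and integrability of \<open>s\<close> is what remains.\<close>
  have s_int: "s integrable_on {a..b}"
    unfolding s_def
    by (rule integral_increment_bound(1)[OF finite_volume_measure[OF g] sets_volume_measure[OF g] compact_UNIV cont nonneg order_refl,
          of "\<lambda>_. 0"]) simp_all
  \<comment> \<open>\<open>velocity\<close> is a two-sided derivative while \<open>\<eta>\<close> is
    taken within \<open>{a..b}\<close>; they are compared in the open interval, and the two
    endpoints do not affect the integral.\<close>
  have s_eq: "path_speed \<gamma> t = s t" if t: "t \<in> {a<..<b}" for t
  proof -
    have "velocity \<gamma> t c x = \<eta> t c x" if "c \<in> A" "x \<in> chart_dom c" for c x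
    proof -
      have "((\<lambda>s. \<gamma> s c x) has_vector_derivative \<eta> t c x) (at t)"
        using der[OF that, of t] t at_within_Icc_at[of a t b] by auto
      then show ?thesis unfolding velocity_def by (rule vector_derivative_at)
    qed
    then show ?thesis
      using t \<gamma>[of t] \<eta>[of t] L2_inner_speed_density[OF g, of "\<gamma> t" "\<eta> t" "velocity \<gamma> t"]
      by (simp add: path_speed_def s_def)
  qed
  have "(path_speed \<gamma> has_integral integral {a..b} s) {a..b}"
    by (rule has_integral_spike_finite[of "{a, b}", OF _ _ integrable_integral[OF s_int]]) (auto simp: s_eq)
  then have sp: "path_speed \<gamma> integrable_on {a..b}" "integral {a..b} (path_speed \<gamma>) = integral {a..b} s"
    by (auto simp: integral_unique)
  show "path_speed \<gamma> integrable_on {a..b}" by (rule sp)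
  have s0: "0 \<le> integral {a..b} s"
    using nonneg by (intro Henstock_Kurzweil_Integration.integral_nonneg s_int) (simp add: s_def)
  then show "0 \<le> integral {a..b} (path_speed \<gamma>)" by (simp add: sp)
  show "(\<integral>\<^sup>+x. ennreal \<bar>weight g c v (\<gamma> b) x - weight g c v (\<gamma> a) x\<bar> \<partial>?\<mu>)
      \<le> ennreal (lip_const g * integral {a..b} (path_speed \<gamma>))" if c: "c \<in> A"
  proof -
    have "(\<integral>\<^sup>+x. ennreal \<bar>weight g c v (\<gamma> b) x - weight g c v (\<gamma> a) x\<bar> \<partial>?\<mu>)
      \<le> ennreal ((sqrt (CARD('n)) + 1) * sqrt (measure ?\<mu> UNIV) * integral {a..b} s)"
      using ab by (intro inc(2) weight_increment_bound g \<gamma> \<eta> der cont c) auto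
    also have "\<dots> \<le> ennreal (lip_const g * integral {a..b} (path_speed \<gamma>))"
      unfolding sp(2) lip_const_def using s0 by (intro ennreal_leI mult_right_mono mult_left_mono) auto
    finally show ?thesis .
  qed
qed

text \<open>Induction over the break points: one inside the interval splits it, and the triangle
  inequality in L^1 matches additivity of the length; one outside is dropped. The interval has to
  vary because both halves invoke the induction hypothesis.\<close>

lemma piecewise_C1_estimate:
  assumes g: "g \<in> metrics A" and "finite S" and "a < b"
    and "\<And>a' b'. a \<le> a' \<Longrightarrow> a' < b' \<Longrightarrow> b' \<le> b \<Longrightarrow> {a'<..<b'} \<inter> S = {} \<Longrightarrow> C1_path_on A a' b' \<gamma>"
    and "\<And>t. t \<in> {a..b} \<Longrightarrow> \<gamma> t \<in> metrics A"
  shows "path_speed \<gamma> integrable_on {a..b} \<and> 0 \<le> integral {a..b} (path_speed \<gamma>) \<and>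
    (\<forall>c\<in>A. \<forall>v. (\<integral>\<^sup>+x. ennreal \<bar>weight g c v (\<gamma> b) x - weight g c v (\<gamma> a) x\<bar> \<partial>volume_measure A g)
      \<le> ennreal (lip_const g * integral {a..b} (path_speed \<gamma>)))"
  using assms(2-)
proof (induction S arbitrary: a b rule: finite_induct)
  case empty
  then have "C1_path_on A a b \<gamma>" by simp
  then show ?case using C1_segment_estimate[where \<gamma> = \<gamma> and a = a and b = b, OF g empty(1) _ empty(3)] by blast
next
  case (insert s S)
  show ?case
  proof (cases "s \<in> {a<..<b}")
    case False
    show ?thesis
    proof (rule insert.IH[OF insert.prems(1) _ insert.prems(3)])
      fix a' b' assume "a \<le> a'" "a' < b'" "b' \<le> b" "{a'<..<b'} \<inter> S = {}"
      then show "C1_path_on A a' b' \<gamma>" using False by (intro insert.prems(2)) auto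
    qed auto
  next
    case True
    let ?\<mu> = "volume_measure A g"
    have 1: "path_speed \<gamma> integrable_on {a..s} \<and> 0 \<le> integral {a..s} (path_speed \<gamma>) \<and>
      (\<forall>c\<in>A. \<forall>v. (\<integral>\<^sup>+x. ennreal \<bar>weight g c v (\<gamma> s) x - weight g c v (\<gamma> a) x\<bar> \<partial>?\<mu>)
        \<le> ennreal (lip_const g * integral {a..s} (path_speed \<gamma>)))"
    proof (rule insert.IH)
      fix a' b' assume "a \<le> a'" "a' < b'" "b' \<le> s" "{a'<..<b'} \<inter> S = {}"
      then show "C1_path_on A a' b' \<gamma>" using True by (intro insert.prems(2)) auto
    qed (use True insert.prems in auto)
    have 2: "path_speed \<gamma> integrable_on {s..b} \<and> 0 \<le> integral {s..b} (path_speed \<gamma>) \<and>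
      (\<forall>c\<in>A. \<forall>v. (\<integral>\<^sup>+x. ennreal \<bar>weight g c v (\<gamma> b) x - weight g c v (\<gamma> s) x\<bar> \<partial>?\<mu>)
        \<le> ennreal (lip_const g * integral {s..b} (path_speed \<gamma>)))"
    proof (rule insert.IH)
      fix a' b' assume "s \<le> a'" "a' < b'" "b' \<le> b" "{a'<..<b'} \<inter> S = {}"
      then show "C1_path_on A a' b' \<gamma>" using True by (intro insert.prems(2)) auto
    qed (use True insert.prems in auto)
    have int: "path_speed \<gamma> integrable_on {a..b}"
      using 1 2 True by (intro Henstock_Kurzweil_Integration.integrable_combine[of a s b]) auto
    have sum: "integral {a..b} (path_speed \<gamma>) = integral {a..s} (path_speed \<gamma>) + integral {s..b} (path_speed \<gamma>)"
      using True int by (intro Henstock_Kurzweil_Integration.integral_combine[symmetric]) auto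
    have "(\<integral>\<^sup>+x. ennreal \<bar>weight g c v (\<gamma> b) x - weight g c v (\<gamma> a) x\<bar> \<partial>?\<mu>)
        \<le> ennreal (lip_const g * integral {a..b} (path_speed \<gamma>))" if c: "c \<in> A" for c v
    proof -
      have m: "weight g c v (\<gamma> t) \<in> borel_measurable ?\<mu>" if "t \<in> {a..b}" for t
        using weight_measurable[OF g insert.prems(3)[OF that] c] sets_volume_measure[OF g]
        by (simp cong: measurable_cong_sets)
      have [measurable]: "weight g c v (\<gamma> a) \<in> borel_measurable ?\<mu>" "weight g c v (\<gamma> b) \<in> borel_measurable ?\<mu>"
        "weight g c v (\<gamma> s) \<in> borel_measurable ?\<mu>"
        using True insert.prems(1) by (auto intro!: m)
      have "(\<integral>\<^sup>+x. ennreal \<bar>weight g c v (\<gamma> b) x - weight g c v (\<gamma> a) x\<bar> \<partial>?\<mu>)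
        \<le> (\<integral>\<^sup>+x. ennreal \<bar>weight g c v (\<gamma> s) x - weight g c v (\<gamma> a) x\<bar> + ennreal \<bar>weight g c v (\<gamma> b) x - weight g c v (\<gamma> s) x\<bar> \<partial>?\<mu>)"
        by (intro nn_integral_mono) (auto simp flip: ennreal_plus intro!: ennreal_leI)
      also have "\<dots> = (\<integral>\<^sup>+x. ennreal \<bar>weight g c v (\<gamma> s) x - weight g c v (\<gamma> a) x\<bar> \<partial>?\<mu>) +
          (\<integral>\<^sup>+x. ennreal \<bar>weight g c v (\<gamma> b) x - weight g c v (\<gamma> s) x\<bar> \<partial>?\<mu>)"
        by (intro nn_integral_add) measurable
      also have "\<dots> \<le> ennreal (lip_const g * integral {a..s} (path_speed \<gamma>)) + ennreal (lip_const g * integral {s..b} (path_speed \<gamma>))"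
        using 1 2 c by (intro add_mono) auto
      also have "\<dots> = ennreal (lip_const g * integral {a..b} (path_speed \<gamma>))"
        using 1 2 lip_const_pos[of g] by (simp add: sum distrib_left flip: ennreal_plus)
      finally show ?thesis .
    qed
    then show ?thesis using int 1 2 sum by simp
  qed
qed

text \<open>Every admissible length is at least \<open>i / lip_const g\<close>, with
  \<open>i\<close> the finite L^1 distance of the weights; the same lower bound passes to the
  infimum.\<close>

lemma weight_L2_dist:
  assumes g: "g \<in> metrics A" and h: "h \<in> metrics A" and k: "k \<in> metrics A" and c: "c \<in> A"
  shows "0 \<le> L2_dist A h k"
    and "(\<integral>\<^sup>+x. ennreal \<bar>weight g c v k x - weight g c v h x\<bar> \<partial>volume_measure A g) \<le> ennreal (lip_const g * L2_dist A h k)"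
    (is "?I \<le> _")
proof -
  let ?P = "\<lambda>\<gamma>. (\<forall>t\<in>{0..1}. \<gamma> t \<in> metrics A) \<and> piecewise_C1_path A \<gamma> \<and> \<gamma> 0 = h \<and> \<gamma> 1 = k"
  define Ls where "Ls = {L2_length A \<gamma> |\<gamma>. ?P \<gamma>}"
  define \<sigma> where "\<sigma> = (\<lambda>t c x. (1 - t) *\<^sub>R h c x + t *\<^sub>R k c x)"
  have "piecewise_C1_path A \<sigma>"
    using segment_C1_path[OF h k] unfolding piecewise_C1_path_def \<sigma>_def by (intro exI[of _ "{}"]) simp
  then have "?P \<sigma>" using metrics_segment[OF h k] by (simp add: \<sigma>_def)
  then have "L2_length A \<sigma> \<in> Ls" unfolding Ls_def by (intro CollectI exI[of _ \<sigma>] conjI refl) simp_all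
  then have ne: "Ls \<noteq> {}" by auto
  have bound: "0 \<le> L \<and> ?I \<le> ennreal (lip_const g * L)" if L: "L \<in> Ls" for L
  proof -
    obtain \<gamma> where \<gamma>: "L = L2_length A \<gamma>" "\<And>t. t \<in> {0..1} \<Longrightarrow> \<gamma> t \<in> metrics A" "piecewise_C1_path A \<gamma>" "\<gamma> 0 = h" "\<gamma> 1 = k"
      using L unfolding Ls_def by blast
    obtain S where S: "finite S" "\<And>a b. 0 \<le> a \<Longrightarrow> a < b \<Longrightarrow> b \<le> 1 \<Longrightarrow> {a<..<b} \<inter> S = {} \<Longrightarrow> C1_path_on A a b \<gamma>"
      using \<gamma>(3) unfolding piecewise_C1_path_def by blast
    have L: "L = integral {0..1} (path_speed \<gamma>)"
      by (simp add: \<gamma>(1) L2_length_def path_speed_def[abs_def])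
    have "path_speed \<gamma> integrable_on {0..1} \<and> 0 \<le> integral {0..1} (path_speed \<gamma>) \<and>
      (\<forall>c\<in>A. \<forall>v. (\<integral>\<^sup>+x. ennreal \<bar>weight g c v (\<gamma> 1) x - weight g c v (\<gamma> 0) x\<bar> \<partial>volume_measure A g)
        \<le> ennreal (lip_const g * integral {0..1} (path_speed \<gamma>)))"
      by (rule piecewise_C1_estimate[OF g S(1) zero_less_one]) (rule S(2), assumption+, rule \<gamma>(2))
    then show ?thesis unfolding \<gamma>(4,5) L using c by blast
  qed
  obtain L0 where L0: "L0 \<in> Ls" using ne by blast
  then have "?I < \<infinity>" using le_less_trans[OF conjunct2[OF bound[OF L0]] ennreal_less_top] by simp
  then obtain i where i: "?I = ennreal i" "0 \<le> i" by (cases ?I rule: ennreal_cases) auto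
  have "i / lip_const g \<le> L" if "L \<in> Ls" for L
  proof -
    have "0 \<le> lip_const g * L" "ennreal i \<le> ennreal (lip_const g * L)"
      using bound[OF that] lip_const_pos[of g] i by simp_all
    then have "i \<le> lip_const g * L" by (simp add: ennreal_le_iff)
    then show ?thesis using lip_const_pos[of g] by (simp add: divide_le_eq mult.commute)
  qed
  then have le: "i / lip_const g \<le> L2_dist A h k"
    unfolding L2_dist_def Ls_def[symmetric] using ne by (intro cInf_greatest)
  have "0 \<le> i / lip_const g" using lip_const_pos[of g] i by simp
  then show "0 \<le> L2_dist A h k" using le by (rule order_trans)
  show "?I \<le> ennreal (lip_const g * L2_dist A h k)"
    using le lip_const_pos[of g] i by (simp add: ennreal_leI divide_le_eq mult.commute)
qed

end

section \<open>Uniqueness of the limit\<close>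

lemma convergent_if_suminf_increments_finite:
  fixes u :: "nat \<Rightarrow> real"
  assumes "(\<Sum>k. ennreal \<bar>u (Suc k) - u k\<bar>) < \<infinity>"
  shows "convergent u"
proof -
  have "summable (\<lambda>k. \<bar>u (Suc k) - u k\<bar>)"
    using assms by (intro summable_suminf_not_top) auto
  then have "summable (\<lambda>k. u (Suc k) - u k)"
    by (rule summable_rabs_cancel)
  then have "convergent (\<lambda>n. \<Sum>k<n. u (Suc k) - u k)"
    by (simp add: summable_iff_convergent)
  then have "convergent (\<lambda>n. u n - u 0)"
    by (simp add: sum_lessThan_telescope)
  then show ?thesis
    using convergent_add_const_right_iff[of u "- u 0"] by simp
qed

context closed_oriented_manifold
begin

lemma weight_zero: "weight g c 0 h x = rel_det A g h x powr (1/4)"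
  by (simp add: weight_def)

lemma rel_det_eq_weight:
  assumes "g \<in> metrics A" "h \<in> metrics A"
  shows "rel_det A g h x = weight g c 0 h x ^ 4" "weight g c 0 h x > 0"
proof -
  have "(rel_det A g h x powr (1/4)) powr (real 4) = rel_det A g h x"
    using rel_det_pos[OF assms, of x] by (simp add: powr_powr)
  then show "rel_det A g h x = weight g c 0 h x ^ 4"
    using rel_det_pos[OF assms, of x] by (subst (asm) powr_realpow) (auto simp: weight_zero)
  show "weight g c 0 h x > 0" using rel_det_pos[OF assms, of x] by (simp add: weight_zero)
qed

lemma weight_measurable_volume:
  assumes "g \<in> metrics A" "h \<in> metrics A" "c \<in> A"
  shows "weight g c v h \<in> borel_measurable (volume_measure A g)"
  using weight_measurable[OF assms] sets_volume_measure[OF assms(1)] by (simp cong: measurable_cong_sets)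

text \<open>Summable distances make the integral of the total variation of the sequence of weights
  finite, so this variation is finite almost everywhere.\<close>

lemma weight_convergent_AE:
  assumes g: "g \<in> metrics A" and c: "c \<in> A" and gs: "\<And>k. gs k \<in> metrics A"
    and sum: "summable (\<lambda>k. L2_dist A (gs k) (gs (Suc k)))"
  shows "AE x in volume_measure A g. convergent (\<lambda>k. weight g c v (gs k) x)"
proof -
  let ?\<mu> = "volume_measure A g"
  note [measurable] = weight_measurable_volume[OF g gs c]
  let ?d = "\<lambda>k. L2_dist A (gs k) (gs (Suc k))"
  have d0: "0 \<le> lip_const g * ?d k" for k
    using weight_L2_dist(1)[OF g gs gs c] lip_const_pos[of g] by simp
  have "(\<integral>\<^sup>+x. (\<Sum>k. ennreal \<bar>weight g c v (gs (Suc k)) x - weight g c v (gs k) x\<bar>) \<partial>?\<mu>) =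
      (\<Sum>k. \<integral>\<^sup>+x. ennreal \<bar>weight g c v (gs (Suc k)) x - weight g c v (gs k) x\<bar> \<partial>?\<mu>)"
    by (intro nn_integral_suminf) measurable
  also have "\<dots> \<le> (\<Sum>k. ennreal (lip_const g * ?d k))"
    by (intro suminf_le weight_L2_dist(2) g gs c) auto
  also have "\<dots> = ennreal (\<Sum>k. lip_const g * ?d k)"
    using d0 by (intro suminf_ennreal2 summable_mult sum) auto
  also have "\<dots> < \<infinity>" by simp
  finally have "AE x in ?\<mu>. (\<Sum>k. ennreal \<bar>weight g c v (gs (Suc k)) x - weight g c v (gs k) x\<bar>) \<noteq> \<infinity>"
    by (intro nn_integral_PInf_AE) auto
  then show ?thesis
    by (rule eventually_mono) (intro convergent_if_suminf_increments_finite, simp add: top.not_eq_extremum)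
qed

text \<open>The differences tend to 0 in L^1, hence almost everywhere along a subsequence, which is
  common to all points x although the statement lets it vary.\<close>

lemma weight_difference_AE:
  assumes g: "g \<in> metrics A" and c: "c \<in> A" and hs: "\<And>k. hs k \<in> metrics A" and ks: "\<And>k. ks k \<in> metrics A"
    and lim: "(\<lambda>k. L2_dist A (hs k) (ks k)) \<longlonglongrightarrow> 0"
  shows "AE x in volume_measure A g. \<exists>r. strict_mono (r :: nat \<Rightarrow> nat) \<and>
    (\<lambda>k. weight g c v (ks (r k)) x - weight g c v (hs (r k)) x) \<longlonglongrightarrow> 0"
proof -
  let ?\<mu> = "volume_measure A g"
  let ?u = "\<lambda>k x. weight g c v (ks k) x - weight g c v (hs k) x"
  note [measurable] = weight_measurable_volume[OF g hs c] weight_measurable_volume[OF g ks c]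
  have le: "(\<integral>\<^sup>+x. ennreal (norm (?u k x)) \<partial>?\<mu>) \<le> ennreal (lip_const g * L2_dist A (hs k) (ks k))" for k
    using weight_L2_dist(2)[OF g hs ks c] by simp
  have int: "integrable ?\<mu> (?u k)" for k
    using le_less_trans[OF le ennreal_less_top] by (intro integrableI_bounded) auto
  have bound: "(\<integral>x. norm (?u k x) \<partial>?\<mu>) \<le> lip_const g * L2_dist A (hs k) (ks k)" for k
  proof -
    have "ennreal (\<integral>x. norm (?u k x) \<partial>?\<mu>) = (\<integral>\<^sup>+x. ennreal (norm (?u k x)) \<partial>?\<mu>)"
      by (intro nn_integral_eq_integral[symmetric] integrable_norm int) auto
    then have "ennreal (\<integral>x. norm (?u k x) \<partial>?\<mu>) \<le> ennreal (lip_const g * L2_dist A (hs k) (ks k))"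
      using le[of k] by simp
    moreover have "0 \<le> lip_const g * L2_dist A (hs k) (ks k)"
      using weight_L2_dist(1)[OF g hs ks c] lip_const_pos[of g] by simp
    ultimately show ?thesis by (simp add: ennreal_le_iff)
  qed
  have "(\<lambda>k. \<integral>x. norm (?u k x) \<partial>?\<mu>) \<longlonglongrightarrow> 0"
  proof (rule tendsto_sandwich[OF always_eventually always_eventually tendsto_const tendsto_mult_right_zero[OF lim]])
    show "\<forall>k. 0 \<le> (\<integral>x. norm (?u k x) \<partial>?\<mu>)" by (intro allI integral_nonneg_AE AE_I2 norm_ge_zero)
    show "\<forall>k. (\<integral>x. norm (?u k x) \<partial>?\<mu>) \<le> lip_const g * L2_dist A (hs k) (ks k)"
      using bound by blast
  qed
  then obtain r :: "nat \<Rightarrow> nat" where "strict_mono r" "AE x in ?\<mu>. (\<lambda>k. ?u (r k) x) \<longlonglongrightarrow> 0"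
    using tendsto_L1_AE_subseq[where u = ?u, OF int] by blast
  then show ?thesis by (auto elim!: eventually_mono)
qed

text \<open>Deflation asks for arbitrarily small determinants at some index, not for a limit. As
  every term is positive, a convergent sequence with nonzero limit stays away from 0: its inverses
  are bounded.\<close>

lemma deflated_iff_limit_zero:
  assumes g: "g \<in> metrics A" and gs: "\<And>k. gs k \<in> metrics A"
    and lim: "(\<lambda>k. weight g c 0 (gs k) x) \<longlonglongrightarrow> \<alpha>"
  shows "x \<in> deflated_set A g gs \<longleftrightarrow> \<alpha> = 0"
proof -
  have det: "(\<lambda>k. rel_det A g (gs k) x) \<longlonglongrightarrow> \<alpha> ^ 4"
    using tendsto_power[OF lim, of 4] by (simp add: rel_det_eq_weight(1)[OF g gs, of _ x c])
  show ?thesis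
  proof
    assume "\<alpha> = 0"
    show "x \<in> deflated_set A g gs"
      unfolding deflated_set_def
    proof (intro CollectI allI impI)
      fix \<delta> :: real assume "\<delta> > 0"
      then have "\<forall>\<^sub>F k in sequentially. rel_det A g (gs k) x < \<delta>"
        using order_tendstoD(2)[OF det] \<open>\<alpha> = 0\<close> by simp
      then show "\<exists>k. rel_det A g (gs k) x < \<delta>"
        by (auto simp: eventually_sequentially)
    qed
  next
    assume x: "x \<in> deflated_set A g gs"
    show "\<alpha> = 0"
    proof (rule ccontr)
      assume "\<alpha> \<noteq> 0"
      then have "(\<lambda>k. inverse (rel_det A g (gs k) x)) \<longlonglongrightarrow> inverse (\<alpha> ^ 4)"
        by (intro tendsto_inverse det) simp
      then have "Bseq (\<lambda>k. inverse (rel_det A g (gs k) x))"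
        by (intro convergent_imp_Bseq convergentI)
      then obtain B where B: "B > 0" "\<And>k. norm (inverse (rel_det A g (gs k) x)) \<le> B"
        by (auto elim: BseqE)
      obtain k where k: "rel_det A g (gs k) x < inverse B"
      proof -
        have "\<forall>\<delta>>0. \<exists>k. rel_det A g (gs k) x < \<delta>"
          using x by (simp only: deflated_set_def mem_Collect_eq)
        moreover have "inverse B > 0" using B(1) by simp
        ultimately show thesis using that by blast
      qed
      have pos: "rel_det A g (gs k) x > 0" by (rule rel_det_pos[OF g gs])
      then have "inverse (rel_det A g (gs k) x) > B"
        using less_imp_inverse_less[OF k pos] by simp
      then show False using B(2)[of k] pos by simp
    qed
  qed
qed

lemma equiv_semimetric_rel: "equiv (measurable_semimetrics A) (semimetric_rel A g)"
proof (rule equivI)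
  show "semimetric_rel A g \<subseteq> measurable_semimetrics A \<times> measurable_semimetrics A"
    by (auto simp: semimetric_rel_def)
  show "refl_on (measurable_semimetrics A) (semimetric_rel A g)"
    by (auto simp: refl_on_def semimetric_rel_def)
  show "sym (semimetric_rel A g)"
  proof (rule symI)
    fix h k assume "(h, k) \<in> semimetric_rel A g"
    then have mem: "h \<in> measurable_semimetrics A" "k \<in> measurable_semimetrics A"
      and 1: "AE x in volume_measure A g. x \<in> degenerate_set A h \<longleftrightarrow> x \<in> degenerate_set A k"
      and 2: "AE x in volume_measure A g. x \<notin> degenerate_set A h \<union> degenerate_set A k \<longrightarrow>
          (\<forall>c\<in>A. x \<in> chart_dom c \<longrightarrow> h c x = k c x)"
      by (auto simp: semimetric_rel_def)
    have "AE x in volume_measure A g. x \<in> degenerate_set A k \<longleftrightarrow> x \<in> degenerate_set A h"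
      using 1 by eventually_elim blast
    moreover have "AE x in volume_measure A g. x \<notin> degenerate_set A k \<union> degenerate_set A h \<longrightarrow>
          (\<forall>c\<in>A. x \<in> chart_dom c \<longrightarrow> k c x = h c x)"
      using 2 by eventually_elim simp
    ultimately show "(k, h) \<in> semimetric_rel A g"
      using mem by (simp add: semimetric_rel_def)
  qed
  show "trans (semimetric_rel A g)"
  proof (rule transI)
    fix h k m assume "(h, k) \<in> semimetric_rel A g" "(k, m) \<in> semimetric_rel A g"
    then have mem: "h \<in> measurable_semimetrics A" "m \<in> measurable_semimetrics A"
      and 1: "AE x in volume_measure A g. x \<in> degenerate_set A h \<longleftrightarrow> x \<in> degenerate_set A k"
      and 2: "AE x in volume_measure A g. x \<notin> degenerate_set A h \<union> degenerate_set A k \<longrightarrow>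
          (\<forall>c\<in>A. x \<in> chart_dom c \<longrightarrow> h c x = k c x)"
      and 3: "AE x in volume_measure A g. x \<in> degenerate_set A k \<longleftrightarrow> x \<in> degenerate_set A m"
      and 4: "AE x in volume_measure A g. x \<notin> degenerate_set A k \<union> degenerate_set A m \<longrightarrow>
          (\<forall>c\<in>A. x \<in> chart_dom c \<longrightarrow> k c x = m c x)"
      by (auto simp: semimetric_rel_def)
    have "AE x in volume_measure A g. x \<in> degenerate_set A h \<longleftrightarrow> x \<in> degenerate_set A m"
      using 1 3 by eventually_elim blast
    \<comment> \<open>Where \<open>h\<close> and \<open>m\<close> are nondegenerate, almost
      everywhere so is \<open>k\<close>, because the degenerate sets agree up to nullsets; only then
      do the two equalities compose.\<close>
    moreover have "AE x in volume_measure A g. x \<notin> degenerate_set A h \<union> degenerate_set A m \<longrightarrow>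
          (\<forall>c\<in>A. x \<in> chart_dom c \<longrightarrow> h c x = m c x)"
      using 1 2 3 4 by eventually_elim simp
    ultimately show "(h, m) \<in> semimetric_rel A g"
      using mem by (simp add: semimetric_rel_def)
  qed
qed

text \<open>For \<alpha> nonzero the weights tend to \<alpha> / (1 + q0) and \<alpha> / (1 + q1),
  where q0 and q1 are the limiting quadratic forms at v. The subsequence forces these to agree, so
  q0 = q1, and polarization finishes.\<close>

lemma limits_equal_at:
  assumes g: "g \<in> metrics A" and gs0: "\<And>k. gs0 k \<in> metrics A" and gs1: "\<And>k. gs1 k \<in> metrics A"
    and h0: "sym_tensor_field A h0" and h1: "sym_tensor_field A h1"
    and c: "c \<in> A" "x \<in> chart_dom c"
    and \<alpha>: "\<alpha> \<noteq> 0" "(\<lambda>k. weight g c 0 (gs0 k) x) \<longlonglongrightarrow> \<alpha>" "(\<lambda>k. weight g c 0 (gs1 k) x) \<longlonglongrightarrow> \<alpha>"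
    and lim: "(\<lambda>k. gs0 k c x) \<longlonglongrightarrow> h0 c x" "(\<lambda>k. gs1 k c x) \<longlonglongrightarrow> h1 c x"
    and sub: "\<And>i j. \<exists>r. strict_mono (r :: nat \<Rightarrow> nat) \<and>
      (\<lambda>k. weight g c (axis i 1 + axis j 1) (gs1 (r k)) x - weight g c (axis i 1 + axis j 1) (gs0 (r k)) x) \<longlonglongrightarrow> 0"
  shows "h0 c x = h1 c x"
proof (rule symmetric_matrix_eqI)
  show "transpose (h0 c x) = h0 c x" "transpose (h1 c x) = h1 c x"
    using tensor_symmetric[OF h0 c] tensor_symmetric[OF h1 c] by auto
  fix i j
  define v :: "real^'n" where "v = axis i 1 + axis j 1"
  have q: "0 \<le> v \<bullet> (h c x *v v) \<and> (\<lambda>k. weight g c v (gs k) x) \<longlonglongrightarrow> \<alpha> / (1 + v \<bullet> (h c x *v v))"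
    if gs: "\<And>k. gs k \<in> metrics A" and l: "(\<lambda>k. gs k c x) \<longlonglongrightarrow> h c x" and a: "(\<lambda>k. weight g c 0 (gs k) x) \<longlonglongrightarrow> \<alpha>" for gs h
  proof -
    have s: "(\<lambda>k. v \<bullet> (gs k c x *v v)) \<longlonglongrightarrow> v \<bullet> (h c x *v v)"
      unfolding inner_vec_def matrix_vector_mult_def by (auto intro!: tendsto_intros l)
    have "0 \<le> v \<bullet> (gs k c x *v v)" for k
      using metrics_pos_def[OF gs c] by (cases "v = 0") (auto simp: pos_def_def less_imp_le)
    \<comment> \<open>Nonnegativity survives in the limit and keeps the limiting denominator at
      least 1.\<close>
    then have s0: "0 \<le> v \<bullet> (h c x *v v)"
      by (intro LIMSEQ_le_const[OF s]) auto
    have "(\<lambda>k. weight g c 0 (gs k) x / (1 + v \<bullet> (gs k c x *v v))) \<longlonglongrightarrow> \<alpha> / (1 + v \<bullet> (h c x *v v))"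
      using s0 by (intro tendsto_divide tendsto_add tendsto_const a s) simp
    then show ?thesis using s0 by (simp add: weight_def)
  qed
  note q0 = q[where gs = gs0 and h = h0, OF gs0 lim(1) \<alpha>(2)] and q1 = q[where gs = gs1 and h = h1, OF gs1 lim(2) \<alpha>(3)]
  obtain r :: "nat \<Rightarrow> nat" where r: "strict_mono r" "(\<lambda>k. weight g c v (gs1 (r k)) x - weight g c v (gs0 (r k)) x) \<longlonglongrightarrow> 0"
    using sub unfolding v_def by blast
  have "(\<lambda>k. weight g c v (gs1 k) x - weight g c v (gs0 k) x) \<longlonglongrightarrow> \<alpha> / (1 + v \<bullet> (h1 c x *v v)) - \<alpha> / (1 + v \<bullet> (h0 c x *v v))"
    using q0 q1 by (intro tendsto_diff) auto
  from LIMSEQ_unique[OF LIMSEQ_subseq_LIMSEQ[OF this r(1), unfolded o_def] r(2)]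
  have "\<alpha> / (1 + v \<bullet> (h1 c x *v v)) = \<alpha> / (1 + v \<bullet> (h0 c x *v v))" by simp
  then have "v \<bullet> (h0 c x *v v) = v \<bullet> (h1 c x *v v)"
    using q0 q1 \<alpha>(1) by (simp add: frac_eq_eq)
  then show "(axis i 1 + axis j 1) \<bullet> (h0 c x *v (axis i 1 + axis j 1)) = (axis i 1 + axis j 1) \<bullet> (h1 c x *v (axis i 1 + axis j 1))"
    by (simp add: v_def)
qed

lemma tensor_eq_all_charts:
  assumes "sym_tensor_field A h" "sym_tensor_field A k" "c \<in> A" "x \<in> chart_dom c" "h c x = k c x"
    and "d \<in> A" "x \<in> chart_dom d"
  shows "h d x = k d x"
  using tensor_transform[OF assms(1) assms(6,3), of x] tensor_transform[OF assms(2) assms(6,3), of x] assms by simp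

lemma omega_limits_related:
  assumes g: "g \<in> metrics A" and om0: "omega_converges A g gs0 G0" and om1: "omega_converges A g gs1 G1"
    and dist: "(\<lambda>k. L2_dist A (gs0 k) (gs1 k)) \<longlonglongrightarrow> 0"
    and h0: "h0 \<in> G0" "h0 \<in> measurable_semimetrics A" and h1: "h1 \<in> G1" "h1 \<in> measurable_semimetrics A"
  shows "(h0, h1) \<in> semimetric_rel A g"
proof -
  let ?\<mu> = "volume_measure A g"
  have gs0: "\<And>k. gs0 k \<in> metrics A" and gs1: "\<And>k. gs1 k \<in> metrics A"
    using om0 om1 by (auto simp: omega_converges_def)
  have s0: "sym_tensor_field A h0" and s1: "sym_tensor_field A h1"
    using h0 h1 by (auto simp: measurable_semimetrics_def)
  have deg: "AE x in ?\<mu>. x \<in> degenerate_set A h0 \<longleftrightarrow> x \<in> deflated_set A g gs0"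
      "AE x in ?\<mu>. x \<in> degenerate_set A h1 \<longleftrightarrow> x \<in> deflated_set A g gs1"
    and lim: "AE x in ?\<mu>. x \<notin> deflated_set A g gs0 \<longrightarrow> (\<forall>c\<in>A. x \<in> chart_dom c \<longrightarrow> (\<lambda>k. gs0 k c x) \<longlonglongrightarrow> h0 c x)"
      "AE x in ?\<mu>. x \<notin> deflated_set A g gs1 \<longrightarrow> (\<forall>c\<in>A. x \<in> chart_dom c \<longrightarrow> (\<lambda>k. gs1 k c x) \<longlonglongrightarrow> h1 c x)"
    and sum: "summable (\<lambda>k. L2_dist A (gs0 k) (gs0 (Suc k)))" "summable (\<lambda>k. L2_dist A (gs1 k) (gs1 (Suc k)))"
    using om0 om1 h0(1) h1(1) by (simp_all add: omega_converges_def)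
  \<comment> \<open>The atlas may be uncountable, so exceptional sets are collected over the charts
    \<open>cs m\<close> only. These cover the manifold, and \<open>tensor_eq_all_charts\<close>
    carries equality to the other charts.\<close>
  obtain cs :: "nat \<Rightarrow> ('a, 'n) chart" and D :: "nat \<Rightarrow> 'a set" where
    cs: "\<And>i. cs i \<in> A" and D: "\<And>i. D i \<subseteq> chart_dom (cs i)" "(\<Union>i. D i) = UNIV"
    by (rule chart_partition) blast
  define W where "W v m x \<longleftrightarrow> (\<exists>r. strict_mono (r :: nat \<Rightarrow> nat) \<and>
      (\<lambda>k. weight g (cs m) v (gs1 (r k)) x - weight g (cs m) v (gs0 (r k)) x) \<longlonglongrightarrow> 0)" for v m x
  have W: "AE x in ?\<mu>. W v m x" for v m
    unfolding W_def by (rule weight_difference_AE[OF g cs gs0 gs1 dist])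
  have "AE x in ?\<mu>. \<forall>m i j. W (axis i 1 + axis j 1) m x"
    unfolding AE_all_countable using W by blast
  moreover have "AE x in ?\<mu>. \<forall>m. W 0 m x"
    unfolding AE_all_countable using W by blast
  moreover have "AE x in ?\<mu>. \<forall>m. convergent (\<lambda>k. weight g (cs m) 0 (gs0 k) x)"
    unfolding AE_all_countable using weight_convergent_AE[OF g cs gs0 sum(1)] by blast
  moreover have "AE x in ?\<mu>. \<forall>m. convergent (\<lambda>k. weight g (cs m) 0 (gs1 k) x)"
    unfolding AE_all_countable using weight_convergent_AE[OF g cs gs1 sum(2)] by blast
  ultimately have main: "AE x in ?\<mu>. (x \<in> degenerate_set A h0 \<longleftrightarrow> x \<in> degenerate_set A h1) \<and>
      (x \<notin> degenerate_set A h0 \<union> degenerate_set A h1 \<longrightarrow> (\<forall>d\<in>A. x \<in> chart_dom d \<longrightarrow> h0 d x = h1 d x))"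
    using deg lim
  proof eventually_elim
    case (elim x)
    obtain m where m: "x \<in> chart_dom (cs m)" using D by blast
    obtain \<alpha> where \<alpha>: "(\<lambda>k. weight g (cs m) 0 (gs0 k) x) \<longlonglongrightarrow> \<alpha>" using elim(3) unfolding convergent_def by blast
    obtain \<beta> where \<beta>: "(\<lambda>k. weight g (cs m) 0 (gs1 k) x) \<longlonglongrightarrow> \<beta>" using elim(4) unfolding convergent_def by blast
    obtain r :: "nat \<Rightarrow> nat" where r: "strict_mono r" "(\<lambda>k. weight g (cs m) 0 (gs1 (r k)) x - weight g (cs m) 0 (gs0 (r k)) x) \<longlonglongrightarrow> 0"
      using elim(2) unfolding W_def by blast
    \<comment> \<open>The whole sequence of differences converges, so its limit is the one seen
      along the subsequence.\<close>
    have "\<beta> - \<alpha> = 0"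
      using LIMSEQ_unique[OF LIMSEQ_subseq_LIMSEQ[OF tendsto_diff[OF \<beta> \<alpha>] r(1), unfolded o_def] r(2)] .
    then have \<beta>': "(\<lambda>k. weight g (cs m) 0 (gs1 k) x) \<longlonglongrightarrow> \<alpha>" using \<beta> by simp
    have defl: "x \<in> deflated_set A g gs0 \<longleftrightarrow> \<alpha> = 0" "x \<in> deflated_set A g gs1 \<longleftrightarrow> \<alpha> = 0"
      by (rule deflated_iff_limit_zero[OF g gs0 \<alpha>], rule deflated_iff_limit_zero[OF g gs1 \<beta>'])
    show ?case
    proof (intro conjI impI ballI)
      show "x \<in> degenerate_set A h0 \<longleftrightarrow> x \<in> degenerate_set A h1" using elim(5,6) defl by simp
      fix d assume x: "x \<notin> degenerate_set A h0 \<union> degenerate_set A h1" and d: "d \<in> A" "x \<in> chart_dom d"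
      have "\<alpha> \<noteq> 0" using x elim(5) defl by simp
      have nd: "x \<notin> deflated_set A g gs0" "x \<notin> deflated_set A g gs1" using \<open>\<alpha> \<noteq> 0\<close> defl by simp_all
      have "h0 (cs m) x = h1 (cs m) x"
      proof (rule limits_equal_at[OF g gs0 gs1 s0 s1 cs m \<open>\<alpha> \<noteq> 0\<close> \<alpha> \<beta>'])
        show "(\<lambda>k. gs0 k (cs m) x) \<longlonglongrightarrow> h0 (cs m) x" "(\<lambda>k. gs1 k (cs m) x) \<longlonglongrightarrow> h1 (cs m) x"
          using elim(7,8) nd cs m by blast+
        show "\<exists>r. strict_mono (r :: nat \<Rightarrow> nat) \<and>
          (\<lambda>k. weight g (cs m) (axis i 1 + axis j 1) (gs1 (r k)) x - weight g (cs m) (axis i 1 + axis j 1) (gs0 (r k)) x) \<longlonglongrightarrow> 0" for i j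
          using elim(1) unfolding W_def by blast
      qed
      then show "h0 d x = h1 d x" by (rule tensor_eq_all_charts[OF s0 s1 cs m _ d])
    qed
  qed
  have "AE x in ?\<mu>. x \<in> degenerate_set A h0 \<longleftrightarrow> x \<in> degenerate_set A h1"
    using main by eventually_elim simp
  moreover have "AE x in ?\<mu>. x \<notin> degenerate_set A h0 \<union> degenerate_set A h1 \<longrightarrow> (\<forall>d\<in>A. x \<in> chart_dom d \<longrightarrow> h0 d x = h1 d x)"
    using main by eventually_elim simp
  ultimately show ?thesis using h0(2) h1(2) by (simp add: semimetric_rel_def)
qed

text \<open>The conditions on representatives would be vacuous for an empty \<open>G\<close>; an
  equivalence class, however, contains the element that generates it.\<close>

lemma omega_limit_nonempty:
  assumes "omega_converges A g gs G"
  obtains h where "h \<in> G" "h \<in> measurable_semimetrics A"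
proof -
  have "G \<in> measurable_semimetrics A // semimetric_rel A g"
    using assms by (simp add: omega_converges_def semimetric_classes_def)
  then show thesis
    using that equiv_semimetric_rel by (metis equiv_class_self quotientE)
qed

end

theorem theorem4p31:
  fixes A :: "('a::{t2_space, second_countable_topology}, 'n::finite) chart set"
    and g :: "('a, 'n) tensor_field"
    and gs\<^sub>0 gs\<^sub>1 :: "nat \<Rightarrow> ('a, 'n) tensor_field"
    and G\<^sub>0 G\<^sub>1 :: "('a, 'n) tensor_field set"
  assumes "smooth_atlas A" and "oriented_atlas A" and "compact (UNIV :: 'a set)"
    and "g \<in> metrics A"
    and "omega_converges A g gs\<^sub>0 G\<^sub>0" and "omega_converges A g gs\<^sub>1 G\<^sub>1"
    and "(\<lambda>k. L2_dist A (gs\<^sub>0 k) (gs\<^sub>1 k)) \<longlonglongrightarrow> 0"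
  shows "G\<^sub>0 = G\<^sub>1"
proof -
  interpret closed_oriented_manifold A by unfold_locales fact+
  obtain h\<^sub>0 where h0: "h\<^sub>0 \<in> G\<^sub>0" "h\<^sub>0 \<in> measurable_semimetrics A"
    by (rule omega_limit_nonempty[OF assms(5)])
  obtain h\<^sub>1 where h1: "h\<^sub>1 \<in> G\<^sub>1" "h\<^sub>1 \<in> measurable_semimetrics A"
    by (rule omega_limit_nonempty[OF assms(6)])
  have "G\<^sub>0 \<in> measurable_semimetrics A // semimetric_rel A g" "G\<^sub>1 \<in> measurable_semimetrics A // semimetric_rel A g"
    using assms(5,6) by (simp_all add: omega_converges_def semimetric_classes_def)
  then show ?thesis
    using quotient_eqI[OF equiv_semimetric_rel] h0 h1 omega_limits_related[OF assms(4-7) h0 h1] by blast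
qed

end
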